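(* Let $V:\mathbb R^n\to\mathbb R$ be of class $C^2$ with $\int e^{-V}dx<\infty$, and let $\mu(dx)=Z^{-1}e^{-V(x)}dx$. Let $\rho:\mathbb R^n\to\mathbb R$ be a function such that $\langle u,\operatorname{Hess}V(x)\,u\rangle\ge \rho(x)|u|^2$ for all $x,u\in\mathbb R^n$, with $\rho\ge\rho_0$ for some constant $\rho_0>0$ and $\mu(\rho)>0$. Assume that either $\rho$ is continuous, or $V$ is $C^3$ and $\rho$ is locally bounded. Assume that there is a cost function $c$ with $\|\rho\|_c<+\infty$, and a continuous increasing function $\alpha:[0,\infty)\to[0,\infty)$ with $\alpha(0)=0$ such that $\mu$ satisfies the inequality $WI(\alpha,c)$. Then $$C_P(\mu)\le \frac{1}{\rho_0+\varepsilon'}$$ where $\varepsilon'$ may be taken to be either (1) (if $\mathrm{Osc}(\rho)<\infty$) $$\varepsilon'=\Big((\mu(\rho)-\rho_0)+\tfrac{1}{\rho_0}\mathrm{Osc}^2(\rho)\Big)\left(1-\sqrt{1-\frac{(\mu(\rho)-\rho_0)^2}{\big((\mu(\rho)-\rho_0)+\frac{1}{\rho_0}\mathrm{Osc}^2(\rho)\big)^2}}\right),$$ or (2) (if $\rho$ is Lipschitz) $$\varepsilon'=\Big((\mu(\rho)-\rho_0)+\tfrac{4}{\rho_0^2}\|\rho\|_{Lip}^2\Big)\left(1-\sqrt{1-\frac{(\mu(\rho)-\rho_0)^2}{\big((\mu(\rho)-\rho_0)+\frac{4}{\rho_0^2}\|\rho\|_{Lip}^2\big)^2}}\right).$$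
   Context: $\mu(f)$ denotes $\int f\,d\mu$. $C_P(\mu)$ is the smallest constant such that $\mathrm{Var}_\mu(f)\le C_P(\mu)\,\mu(|\nabla f|^2)$ for all smooth $f$. $\mathrm{Osc}(u)=\sup_{x,y}|u(x)-u(y)|$ and $\|u\|_{Lip}$ is the Lipschitz constant. A cost function $c$ on $\mathbb R^n\times\mathbb R^n$ is lower semicontinuous, nonnegative, symmetric, with $c(x,x)=0$. $\|u\|_c=\sup_{x\ne y}|u(x)-u(y)|/c(x,y)$. $T_c(\nu,\mu)=\inf_\pi\int c\,d\pi$ over couplings $\pi$ of $\nu$ and $\mu$. The Fisher information is $I(\nu|\mu)=\mu(|\nabla\sqrt f|^2)$ if $\nu=f\mu$ with $f>0$ locally Lipschitz, and $+\infty$ otherwise. $\mu$ satisfies $WI(\alpha,c)$ if $\alpha(T_c(\nu,\mu))\le I(\nu|\mu)$ for every probability measure $\nu$. *)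

theory Defs
  imports "HOL-Analysis.Analysis" "HOL-Probability.Probability"
begin

coinductive smooth_fun :: "('a::euclidean_space \<Rightarrow> real) \<Rightarrow> bool" where
  "(\<forall>x. f differentiable (at x)) \<Longrightarrow>
   (\<forall>u. smooth_fun (\<lambda>x. frechet_derivative f (at x) u)) \<Longrightarrow> smooth_fun f"

definition grad_norm :: "('a::euclidean_space \<Rightarrow> real) \<Rightarrow> 'a \<Rightarrow> real" where
  "grad_norm f x = onorm (frechet_derivative f (at x))"

definition gibbs :: "('a::euclidean_space \<Rightarrow> real) \<Rightarrow> 'a measure" where
  "gibbs V = density lborel
     (\<lambda>x. ennreal (exp (- V x) / (\<integral>y. exp (- V y) \<partial>lborel)))"

definition var_meas :: "'a measure \<Rightarrow> ('a \<Rightarrow> real) \<Rightarrow> real" where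
  "var_meas M f = (\<integral>x. (f x - (\<integral>y. f y \<partial>M))\<^sup>2 \<partial>M)"

definition poincare_ok :: "'a::euclidean_space measure \<Rightarrow> real \<Rightarrow> bool" where
  "poincare_ok M C \<longleftrightarrow> (\<forall>f. smooth_fun f \<and> integrable M (\<lambda>x. (f x)\<^sup>2)
       \<and> integrable M (\<lambda>x. (grad_norm f x)\<^sup>2) \<longrightarrow>
       var_meas M f \<le> C * (\<integral>x. (grad_norm f x)\<^sup>2 \<partial>M))"

definition poincare_const :: "'a::euclidean_space measure \<Rightarrow> real" where
  "poincare_const M = Inf {C. 0 \<le> C \<and> poincare_ok M C}"

definition osc :: "('a \<Rightarrow> real) \<Rightarrow> ereal" where
  "osc u = (SUP p. ereal \<bar>u (fst p) - u (snd p)\<bar>)"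

definition lip_const :: "('a::metric_space \<Rightarrow> real) \<Rightarrow> ereal" where
  "lip_const u = (SUP p\<in>{p. fst p \<noteq> snd p}.
       ereal (\<bar>u (fst p) - u (snd p)\<bar> / dist (fst p) (snd p)))"

definition c_norm :: "('a \<Rightarrow> 'a \<Rightarrow> real) \<Rightarrow> ('a \<Rightarrow> real) \<Rightarrow> ereal" where
  "c_norm c u = (SUP p\<in>{p. fst p \<noteq> snd p}.
       (if c (fst p) (snd p) = 0 then (if u (fst p) = u (snd p) then 0 else \<infinity>)
        else ereal (\<bar>u (fst p) - u (snd p)\<bar> / c (fst p) (snd p))))"

definition cost_fun :: "('a::topological_space \<Rightarrow> 'a \<Rightarrow> real) \<Rightarrow> bool" where
  "cost_fun c \<longleftrightarrow> (\<forall>t. closed {p. c (fst p) (snd p) \<le> t})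
     \<and> (\<forall>x y. 0 \<le> c x y) \<and> (\<forall>x y. c x y = c y x) \<and> (\<forall>x. c x x = 0)"

definition couplings :: "'a measure \<Rightarrow> 'a measure \<Rightarrow> ('a \<times> 'a) measure set" where
  "couplings N M = {P. prob_space P \<and> sets P = sets (N \<Otimes>\<^sub>M M)
      \<and> distr P N fst = N \<and> distr P M snd = M}"

definition transport_cost :: "('a \<Rightarrow> 'a \<Rightarrow> real) \<Rightarrow> 'a measure \<Rightarrow> 'a measure \<Rightarrow> ennreal" where
  "transport_cost c N M = (INF P\<in>couplings N M. \<integral>\<^sup>+ p. ennreal (c (fst p) (snd p)) \<partial>P)"

definition locally_lipschitz :: "('a::metric_space \<Rightarrow> real) \<Rightarrow> bool" where
  "locally_lipschitz f \<longleftrightarrow> (\<forall>x. \<exists>e>0. \<exists>L. lipschitz_on L (ball x e) f)"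

definition fisher_dens :: "'a::euclidean_space measure \<Rightarrow> 'a measure \<Rightarrow> ('a \<Rightarrow> real) \<Rightarrow> bool" where
  "fisher_dens M N f \<longleftrightarrow> (\<forall>x. 0 < f x) \<and> locally_lipschitz f
      \<and> N = density M (\<lambda>x. ennreal (f x))"

definition fisher_info :: "'a::euclidean_space measure \<Rightarrow> 'a measure \<Rightarrow> ennreal" where
  "fisher_info N M = (if \<exists>f. fisher_dens M N f
      then (\<integral>\<^sup>+ x. ennreal ((grad_norm (\<lambda>y. sqrt ((SOME f. fisher_dens M N f) y)) x)\<^sup>2) \<partial>M)
      else \<infinity>)"

definition alpha_ext :: "(real \<Rightarrow> real) \<Rightarrow> ennreal \<Rightarrow> ennreal" where
  "alpha_ext \<alpha> T = (if T = \<infinity> then (SUP t\<in>{0..}. ennreal (\<alpha> t)) else ennreal (\<alpha> (enn2real T)))"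

definition WI :: "'a::euclidean_space measure \<Rightarrow> (real \<Rightarrow> real) \<Rightarrow> ('a \<Rightarrow> 'a \<Rightarrow> real) \<Rightarrow> bool" where
  "WI M \<alpha> c \<longleftrightarrow> (\<forall>N. prob_space N \<and> sets N = sets M \<longrightarrow>
      alpha_ext \<alpha> (transport_cost c N M) \<le> fisher_info N M)"

text \<open>The constant epsilon' from the theorem, with K = Osc^2/rho0 or 4 Lip^2/rho0^2.\<close>
definition eps_prime :: "real \<Rightarrow> real \<Rightarrow> real" where
  "eps_prime m K = (m + K) * (1 - sqrt (1 - m\<^sup>2 / (m + K)\<^sup>2))"

end

theory Submission
  imports Defs
begin

text \<open>Proof idea. On a fine grid with weights \<open>exp (-V)\<close> take the reversible nearest neighbour walk. If
  \<open>-L u = F - mean F\<close>, then the Bochner inequality for \<open>g = |D u|\<close>, summed over the grid, reads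
  \<open>\<Sum> m D u \<bullet> D F \<ge> E(g) + \<Sum> m \<rho> g^2\<close> up to errors vanishing with the mesh, so every lower
  bound \<open>E(g) + \<Sum> m \<rho> g^2 \<ge> \<kappa> \<Sum> m g^2\<close> gives a discrete Poincare inequality with constant \<open>1/\<kappa>\<close>.
  The bound \<open>\<rho> \<ge> \<rho>0\<close> yields \<open>\<kappa> = \<rho>0\<close>. To improve it to \<open>\<rho>0 + \<epsilon>\<close>, note that a normalised \<open>g\<close> with
  \<open>E(g) < \<epsilon>\<close> is so spread out that \<open>\<Sum> m \<rho> g^2\<close> is almost the mean of \<open>\<rho>\<close>: if \<open>\<rho>\<close> has finite
  oscillation, because the Poincare inequality with \<open>\<rho>0\<close> bounds the variance of \<open>g\<close>; if \<open>\<rho>\<close> is Lipschitz,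
  because the solution of \<open>-L u = \<rho> - mean \<rho>\<close> satisfies \<open>|D u| \<le> Lip / \<rho>0\<close> by the maximum principle.
  Since \<open>\<epsilon>'\<close> solves \<open>\<epsilon> + sqrt (2 K \<epsilon>) = \<mu>(\<rho>) - \<rho>0\<close>, either bound suffices with a factor to
  spare. Finally the mesh tends to zero (Riemann sums) and the box exhausts the space.\<close>

section \<open>Reversible walks on a box grid\<close>

text \<open>The duality argument needs a solution of a Poisson equation that is regular enough for
  the Bochner formula, up to the boundary or at infinity. On a finite grid solvability is linear
  algebra and regularity is void; the price is that every identity acquires errors, which the
  tolerance \<open>\<eta>\<close> has to absorb. Since \<open>V\<close> is merely C^2, no third
  derivative may enter: with the rates chosen here, the commutator of \<open>lap\<close> with a
  difference contains only second differences of \<open>V\<close>. The domain is a box because on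
  flat faces the Neumann boundary terms vanish or have the favourable sign. The energy
  \<open>E(g)\<close> comes from the squared second differences of \<open>u\<close> through a
  discrete Kato inequality; the classical Lichnerowicz estimate throws this term away, and the
  improvement exploits it. The spare factor arises as follows: if \<open>\<rho>\<close> has finite
  oscillation, the variance of \<open>g\<close> is at most about
  \<open>\<epsilon> / \<rho>0\<close>, and allowing twice that absorbs the grid errors; if
  \<open>\<rho>\<close> is Lipschitz, the covariance is about \<open>sqrt (K \<epsilon>)\<close>,
  against the permitted \<open>sqrt (2 K \<epsilon>)\<close>.\<close>

lemma spd_system_solvable: \<comment> \<open>Gaussian elimination: \<open>B\<close> below is the Schur complement of the entry \<open>z\<close>.\<close>
  fixes A :: "'b \<Rightarrow> 'b \<Rightarrow> real" and s :: "'b \<Rightarrow> real"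
  assumes "finite X"
    and "\<And>x y. x \<in> X \<Longrightarrow> y \<in> X \<Longrightarrow> A x y = A y x"
    and "\<And>u. (\<exists>x\<in>X. u x \<noteq> 0) \<Longrightarrow> (\<Sum>x\<in>X. \<Sum>y\<in>X. u x * A x y * u y) > 0"
  shows "\<exists>u. \<forall>x\<in>X. (\<Sum>y\<in>X. A x y * u y) = s x"
  using assms
proof (induction X arbitrary: A s rule: finite_induct)
  case empty
  then show ?case by simp
next
  case (insert z X)
  have sym: "A x y = A y x" if "x \<in> insert z X" "y \<in> insert z X" for x y
    using insert.prems(1) that by blast
  have expand: "(\<Sum>x\<in>insert z X. \<Sum>y\<in>insert z X. u x * A x y * u y)
      = u z * A z z * u z + 2 * u z * (\<Sum>y\<in>X. A z y * u y) + (\<Sum>x\<in>X. \<Sum>y\<in>X. u x * A x y * u y)" for u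
  proof -
    have "(\<Sum>x\<in>X. u x * A x z * u z) = u z * (\<Sum>y\<in>X. A z y * u y)"
      unfolding sum_distrib_left by (rule sum.cong) (use sym in auto)
    moreover have "(\<Sum>y\<in>X. u z * A z y * u y) = u z * (\<Sum>y\<in>X. A z y * u y)"
      by (simp add: sum_distrib_left mult.assoc)
    ultimately show ?thesis
      using insert.hyps by (simp add: sum.distrib)
  qed
  have zz: "A z z > 0"
  proof -
    have "(\<Sum>x\<in>insert z X. \<Sum>y\<in>insert z X. of_bool (x = z) * A x y * of_bool (y = z)) > 0"
      by (rule insert.prems(2)) auto
    then show ?thesis
      unfolding expand[of "\<lambda>x. of_bool (x = z)"] using insert.hyps by (auto simp: of_bool_def sum.neutral)
  qed
  define B where "B = (\<lambda>x y. A x y - A x z * A z y / A z z)"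
  have Bsym: "B x y = B y x" if "x \<in> X" "y \<in> X" for x y
    using sym[of x y] sym[of x z] sym[of y z] that by (simp add: B_def)
  have Bpos: "(\<Sum>x\<in>X. \<Sum>y\<in>X. u x * B x y * u y) > 0" if u: "\<exists>x\<in>X. u x \<noteq> 0" for u
  proof -
    define a where "a = (\<Sum>y\<in>X. A z y * u y)"
    \<comment> \<open>The value at \<open>z\<close> minimises the form over that coordinate; what
      remains is exactly the form of \<open>B\<close>.\<close>
    define v where "v = u(z := - a / A z z)"
    have vX: "v x = u x" if "x \<in> X" for x using that insert.hyps by (auto simp: v_def)
    have "0 < (\<Sum>x\<in>insert z X. \<Sum>y\<in>insert z X. v x * A x y * v y)"
      by (rule insert.prems(2)) (use u vX in auto)
    also have "\<dots> = v z * A z z * v z + 2 * v z * (\<Sum>y\<in>X. A z y * v y)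
        + (\<Sum>x\<in>X. \<Sum>y\<in>X. v x * A x y * v y)" by (rule expand)
    also have "(\<Sum>y\<in>X. A z y * v y) = a" unfolding a_def by (rule sum.cong) (auto simp: vX)
    also have "(\<Sum>x\<in>X. \<Sum>y\<in>X. v x * A x y * v y) = (\<Sum>x\<in>X. \<Sum>y\<in>X. u x * A x y * u y)"
      by (intro sum.cong) (auto simp: vX)
    also have "v z * A z z * v z + 2 * v z * a = - (a * a / A z z)"
      using zz by (simp add: v_def field_simps)
    also have "a * a / A z z = (\<Sum>x\<in>X. \<Sum>y\<in>X. u x * (A x z * A z y / A z z) * u y)"
    proof -
      have "a * a = (\<Sum>x\<in>X. \<Sum>y\<in>X. u x * (A x z * A z y) * u y)"
        unfolding a_def sum_product by (intro sum.cong refl) (use sym in \<open>auto simp: mult_ac\<close>)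
      then show ?thesis by (simp add: sum_divide_distrib)
    qed
    also have "- (\<Sum>x\<in>X. \<Sum>y\<in>X. u x * (A x z * A z y / A z z) * u y) + (\<Sum>x\<in>X. \<Sum>y\<in>X. u x * A x y * u y)
        = (\<Sum>x\<in>X. \<Sum>y\<in>X. u x * B x y * u y)"
      by (simp add: B_def algebra_simps sum_subtractf)
    finally show ?thesis .
  qed
  from insert.IH[of B "\<lambda>x. s x - A x z * s z / A z z", OF Bsym Bpos]
  obtain u where u: "\<And>x. x \<in> X \<Longrightarrow> (\<Sum>y\<in>X. B x y * u y) = s x - A x z * s z / A z z" by blast
  define a where "a = (\<Sum>y\<in>X. A z y * u y)"
  define v where "v = u(z := (s z - a) / A z z)"
  have vX: "(\<Sum>y\<in>X. A x y * v y) = (\<Sum>y\<in>X. A x y * u y)" for x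
    by (rule sum.cong) (use insert.hyps in \<open>auto simp: v_def\<close>)
  have "(\<Sum>y\<in>insert z X. A x y * v y) = s x" if "x \<in> insert z X" for x
  proof (cases "x = z")
    case True
    then show ?thesis using insert.hyps zz by (simp add: vX a_def[symmetric]) (simp add: v_def)
  next
    case False
    then have x: "x \<in> X" using that by simp
    have "(\<Sum>y\<in>X. B x y * u y) = (\<Sum>y\<in>X. A x y * u y) - A x z / A z z * a"
      unfolding B_def a_def sum_distrib_left sum_subtractf[symmetric]
      by (rule sum.cong) (auto simp: algebra_simps)
    moreover have "(\<Sum>y\<in>insert z X. A x y * v y) = A x z * v z + (\<Sum>y\<in>X. A x y * u y)"
      using insert.hyps by (simp add: vX)
    ultimately show ?thesis
      using u[OF x] by (simp add: v_def diff_divide_distrib algebra_simps)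
  qed
  then show ?case by blast
qed

text \<open>A change of variable in which the summands lost at either face vanish by assumption.
  Neumann differences satisfy this, so summation by parts has no boundary term.\<close>

lemma sum_shift:
  fixes f :: "'a::ab_group_add \<Rightarrow> real"
  assumes "finite X" and "\<And>x. x \<in> X \<Longrightarrow> x - d \<notin> X \<Longrightarrow> f x = 0"
    and "\<And>x. x \<in> X \<Longrightarrow> x + d \<notin> X \<Longrightarrow> f (x + d) = 0"
  shows "(\<Sum>x\<in>X. f x) = (\<Sum>x\<in>X. f (x + d))"
proof -
  have "(\<Sum>x\<in>X. f x) = (\<Sum>x\<in>{x\<in>X. x - d \<in> X}. f x)"
    by (rule sum.mono_neutral_right) (use assms in auto)
  also have "\<dots> = (\<Sum>x\<in>{x\<in>X. x + d \<in> X}. f (x + d))"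
    by (rule sum.reindex_bij_witness[of _ "\<lambda>x. x + d" "\<lambda>x. x - d"]) auto
  also have "\<dots> = (\<Sum>x\<in>X. f (x + d))"
    by (rule sum.mono_neutral_left) (use assms in auto)
  finally show ?thesis .
qed

text \<open>The axioms keep what is needed of a product of discrete intervals.
  \<open>box_plus\<close> and \<open>box_minus\<close> express that faces are flat: a step along
  \<open>j\<close> cannot change whether a step along \<open>i\<close> stays inside. Connectedness
  is phrased through functions without increments, the form in which it meets the kernel of the
  energy.\<close>

locale box_grid =
  fixes X :: "'a::euclidean_space set" and h :: real and V :: "'a \<Rightarrow> real"
  assumes finite_grid: "finite X" and grid_nonempty: "X \<noteq> {}" and h_pos: "h > 0"
    and box_plus: "\<And>x i j. \<lbrakk>i \<in> Basis; j \<in> Basis; i \<noteq> j; x \<in> X; x + h *\<^sub>R j \<in> X\<rbrakk>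
      \<Longrightarrow> x + h *\<^sub>R j + h *\<^sub>R i \<in> X \<longleftrightarrow> x + h *\<^sub>R i \<in> X"
    and box_minus: "\<And>x i j. \<lbrakk>i \<in> Basis; j \<in> Basis; i \<noteq> j; x \<in> X; x + h *\<^sub>R j \<in> X\<rbrakk>
      \<Longrightarrow> x + h *\<^sub>R j - h *\<^sub>R i \<in> X \<longleftrightarrow> x - h *\<^sub>R i \<in> X"
    and grid_connected: "\<And>(u :: 'a \<Rightarrow> real) x y.
      (\<And>b z. b \<in> Basis \<Longrightarrow> z \<in> X \<Longrightarrow> z + h *\<^sub>R b \<in> X \<Longrightarrow> u (z + h *\<^sub>R b) = u z)
      \<Longrightarrow> x \<in> X \<Longrightarrow> y \<in> X \<Longrightarrow> u x = u y"
begin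

abbreviation fwd :: "'a \<Rightarrow> 'a \<Rightarrow> 'a" where "fwd b x \<equiv> x + h *\<^sub>R b"
abbreviation bwd :: "'a \<Rightarrow> 'a \<Rightarrow> 'a" where "bwd b x \<equiv> x - h *\<^sub>R b"

text \<open>The conductance \<open>w b x\<close> of an edge is the geometric mean of the density at its ends, and
  \<open>al\<close>, \<open>be\<close> are the resulting jump rates forwards and backwards: their differences along
  another edge are then governed by second differences of \<open>V\<close>. Differences across the boundary
  of the box are set to zero (Neumann condition); \<open>lap\<close> is the nonnegative generator \<open>-h^2 L\<close>.\<close>

definition m :: "'a \<Rightarrow> real" where "m x = exp (- V x)"
definition al :: "'a \<Rightarrow> 'a \<Rightarrow> real" where "al b x = exp ((V x - V (fwd b x)) / 2)"
definition be :: "'a \<Rightarrow> 'a \<Rightarrow> real" where "be b x = exp ((V x - V (bwd b x)) / 2)"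
definition w :: "'a \<Rightarrow> 'a \<Rightarrow> real" where "w b x = exp (- (V x + V (fwd b x)) / 2)"
definition fd :: "('a \<Rightarrow> real) \<Rightarrow> 'a \<Rightarrow> 'a \<Rightarrow> real" where
  "fd u b x = (if x \<in> X \<and> fwd b x \<in> X then u (fwd b x) - u x else 0)"
definition grd :: "('a \<Rightarrow> real) \<Rightarrow> 'a \<Rightarrow> 'a" where "grd u x = (\<Sum>b\<in>Basis. fd u b x *\<^sub>R b)"
definition lap :: "('a \<Rightarrow> real) \<Rightarrow> 'a \<Rightarrow> real" where
  "lap u x = (\<Sum>b\<in>Basis. be b x * fd u b (bwd b x) - al b x * fd u b x)"
definition en :: "('a \<Rightarrow> real) \<Rightarrow> ('a \<Rightarrow> real) \<Rightarrow> real" where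
  "en u v = (\<Sum>x\<in>X. \<Sum>b\<in>Basis. w b x * fd u b x * fd v b x)"

section \<open>Rules for edge weights and differences, and summation by parts\<close>

lemma m_pos: "m x > 0" by (simp add: m_def)
lemma al_pos: "al b x > 0" by (simp add: al_def)
lemma be_pos: "be b x > 0" by (simp add: be_def)
lemma w_pos: "w b x > 0" by (simp add: w_def)

lemma m_al: "m x * al b x = w b x"
  by (simp add: m_def al_def w_def mult_exp_exp field_simps)

lemma m_be: "m x * be b x = w b (bwd b x)"
  by (simp add: m_def be_def w_def mult_exp_exp field_simps)

lemma fd_outside: "x \<notin> X \<Longrightarrow> fd u b x = 0" "fwd b x \<notin> X \<Longrightarrow> fd u b x = 0"
  by (auto simp: fd_def)

lemma fd_cong: "(\<And>x. x \<in> X \<Longrightarrow> u x = v x) \<Longrightarrow> fd u b x = fd v b x"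
  by (simp add: fd_def)

lemma grd_inner: "b \<in> Basis \<Longrightarrow> grd u x \<bullet> b = fd u b x"
  by (simp add: grd_def inner_sum_left inner_Basis if_distrib cong: if_cong)

lemma grd_inner_grd: "grd u x \<bullet> grd v y = (\<Sum>b\<in>Basis. fd u b x * fd v b y)"
  by (subst euclidean_inner) (simp add: grd_inner)

lemma grd_norm: "(norm (grd u x))^2 = (\<Sum>b\<in>Basis. (fd u b x)^2)"
  unfolding power2_norm_eq_inner grd_inner_grd by (simp add: power2_eq_square)

lemma grd_cong: "(\<And>x. x \<in> X \<Longrightarrow> u x = v x) \<Longrightarrow> grd u x = grd v x"
  unfolding grd_def using fd_cong[of u v] by simp

lemma sum_by_parts: "(\<Sum>x\<in>X. m x * lap u x * v x) = en u v"
proof -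
  have "(\<Sum>x\<in>X. m x * lap u x * v x)
      = (\<Sum>x\<in>X. \<Sum>b\<in>Basis. (m x * be b x) * fd u b (bwd b x) * v x - (m x * al b x) * fd u b x * v x)"
    unfolding lap_def sum_distrib_left sum_distrib_right
    by (intro sum.cong refl) (simp only: right_diff_distrib left_diff_distrib mult.assoc)
  also have "\<dots> = (\<Sum>x\<in>X. \<Sum>b\<in>Basis. w b (bwd b x) * fd u b (bwd b x) * v x - w b x * fd u b x * v x)"
    unfolding m_al m_be ..
  also have "\<dots> = (\<Sum>b\<in>Basis. (\<Sum>x\<in>X. w b (bwd b x) * fd u b (bwd b x) * v x)
      - (\<Sum>x\<in>X. w b x * fd u b x * v x))"
    by (subst sum.swap) (simp add: sum_subtractf)
  also have "\<dots> = (\<Sum>b\<in>Basis. \<Sum>x\<in>X. w b x * fd u b x * fd v b x)"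
  proof (rule sum.cong[OF refl])
    fix b :: 'a assume b: "b \<in> Basis"
    have "(\<Sum>x\<in>X. w b (bwd b x) * fd u b (bwd b x) * v x)
        = (\<Sum>x\<in>X. w b (bwd b (fwd b x)) * fd u b (bwd b (fwd b x)) * v (fwd b x))"
      by (rule sum_shift[OF finite_grid]) (auto simp: fd_outside)
    then show "(\<Sum>x\<in>X. w b (bwd b x) * fd u b (bwd b x) * v x) - (\<Sum>x\<in>X. w b x * fd u b x * v x)
        = (\<Sum>x\<in>X. w b x * fd u b x * fd v b x)"
      by (simp add: sum_subtractf[symmetric]) (rule sum.cong, auto simp: fd_def algebra_simps)
  qed
  also have "\<dots> = en u v" unfolding en_def by (rule sum.swap)
  finally show ?thesis .
qed

lemma en_sym: "en u v = en v u"
  by (simp add: en_def mult_ac)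

lemma en_nonneg: "en u u \<ge> 0"
  unfolding en_def by (intro sum_nonneg) (simp add: mult.assoc w_pos less_imp_le)

lemma en_zero_const:
  assumes "en u u = 0" "x \<in> X" "y \<in> X" shows "u x = u y"
proof (rule grid_connected[OF _ assms(2,3)])
  fix b z assume b: "b \<in> Basis" and z: "z \<in> X" "fwd b z \<in> X"
  have nn: "0 \<le> w b x * fd u b x * fd u b x" for x b
    by (simp add: mult.assoc w_pos less_imp_le)
  have "(\<Sum>b\<in>Basis. w b z * fd u b z * fd u b z) = 0"
    using assms(1) z(1) unfolding en_def
    by (subst (asm) sum_nonneg_eq_0_iff) (auto intro!: sum_nonneg nn finite_grid)
  then have "w b z * fd u b z * fd u b z = 0"
    using b by (subst (asm) sum_nonneg_eq_0_iff) (auto intro!: nn)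
  then show "u (fwd b z) = u z"
    using z w_pos[of b z] by (auto simp: fd_def)
qed

text \<open>\<open>lap\<close> annihilates constants, so \<open>T\<close> adds a rank one term that
  makes the form definite; the factor \<open>m x\<close> makes the matrix symmetric. The added term
  drops out of the solution because \<open>s\<close> has weighted sum 0.\<close>

lemma poisson_solvable:
  assumes s: "(\<Sum>x\<in>X. m x * s x) = 0"
  shows "\<exists>u. \<forall>x\<in>X. lap u x = s x"
proof -
  define T where "T = (\<lambda>u x. m x * lap u x + m x * (\<Sum>z\<in>X. m z * u z))"
  \<comment> \<open>Unit vectors: \<open>T (dl y) x\<close> is the matrix entry in row
    \<open>x\<close> and column \<open>y\<close>.\<close>
  define dl :: "'a \<Rightarrow> 'a \<Rightarrow> real" where "dl = (\<lambda>y x. of_bool (x = y))"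
  have fd_lin: "fd (\<lambda>x. c * u x + v x) b x = c * fd u b x + fd v b x" for c u v b x
    by (simp add: fd_def algebra_simps)
  have T_lin: "T (\<lambda>x. c * u x + v x) x = c * T u x + T v x" for c u v x
    unfolding T_def lap_def fd_lin
    by (simp add: algebra_simps sum.distrib sum_distrib_left sum_subtractf)
  have T0: "T (\<lambda>x. 0) x = 0" for x
    using T_lin[of "-1" "\<lambda>x. 0" "\<lambda>x. 0" x] by simp
  have T_sum: "T (\<lambda>x. \<Sum>y\<in>S. u y * dl y x) x = (\<Sum>y\<in>S. T (dl y) x * u y)" if "finite S" for S u x
    using that
  proof (induction S rule: finite_induct)
    case (insert y S)
    then show ?case
      using T_lin[of "u y" "dl y" "\<lambda>x. \<Sum>y\<in>S. u y * dl y x" x] by (simp add: mult.commute)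
  qed (simp add: T0)
  have T_cong: "T u x = T v x" if "\<And>x. x \<in> X \<Longrightarrow> u x = v x" for u v x
  proof -
    have "fd u b x = fd v b x" for b x by (rule fd_cong) (rule that)
    moreover have "(\<Sum>z\<in>X. m z * u z) = (\<Sum>z\<in>X. m z * v z)" by (rule sum.cong) (auto simp: that)
    ultimately show ?thesis by (simp add: T_def lap_def)
  qed
  have rep: "(\<Sum>y\<in>X. T (dl y) x * u y) = T u x" for u x
  proof -
    have "T (\<lambda>x. \<Sum>y\<in>X. u y * dl y x) x = T u x"
      by (rule T_cong) (simp add: dl_def finite_grid if_distrib of_bool_def cong: if_cong)
    then show ?thesis using T_sum[OF finite_grid] by simp
  qed
  have form: "(\<Sum>x\<in>X. v x * T u x) = en u v + (\<Sum>z\<in>X. m z * u z) * (\<Sum>z\<in>X. m z * v z)" for u v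
    unfolding sum_by_parts[symmetric] T_def
    by (simp add: algebra_simps sum.distrib sum_distrib_left sum_distrib_right)
  have "\<exists>u. \<forall>x\<in>X. (\<Sum>y\<in>X. T (dl y) x * u y) = m x * s x"
  proof (rule spd_system_solvable[OF finite_grid])
    have pick: "(\<Sum>z\<in>X. dl x z * v z) = v x" if "x \<in> X" for x v
      using that by (simp add: dl_def finite_grid of_bool_def if_distrib[of "\<lambda>t. t * _"] cong: if_cong)
    fix x y assume "x \<in> X" "y \<in> X"
    then show "T (dl y) x = T (dl x) y"
      using form[of "dl x" "dl y"] form[of "dl y" "dl x"] by (simp add: pick en_sym mult.commute)
  next
    fix u :: "'a \<Rightarrow> real" assume nz: "\<exists>x\<in>X. u x \<noteq> 0"
    have eq: "(\<Sum>x\<in>X. \<Sum>y\<in>X. u x * T (dl y) x * u y) = en u u + (\<Sum>z\<in>X. m z * u z)^2"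
      unfolding mult.assoc sum_distrib_left[symmetric] rep power2_eq_square by (rule form)
    show "(\<Sum>x\<in>X. \<Sum>y\<in>X. u x * T (dl y) x * u y) > 0"
    proof (rule ccontr)
      assume "\<not> ?thesis"
      then have "en u u = 0" and mean: "(\<Sum>z\<in>X. m z * u z)^2 = 0"
        using eq en_nonneg[of u] zero_le_power2[of "\<Sum>z\<in>X. m z * u z"] by linarith+
      then have const: "u x = u y" if "x \<in> X" "y \<in> X" for x y using en_zero_const that by blast
      obtain x where x: "x \<in> X" "u x \<noteq> 0" using nz by blast
      have "(\<Sum>z\<in>X. m z * u z) = (\<Sum>z\<in>X. m z) * u x"
        unfolding sum_distrib_right by (rule sum.cong) (auto simp: const[OF _ x(1)])
      moreover have "(\<Sum>z\<in>X. m z) > 0"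
        by (rule sum_pos) (use finite_grid grid_nonempty m_pos in auto)
      ultimately show False using mean x by simp
    qed
  qed
  then obtain u where u: "\<And>x. x \<in> X \<Longrightarrow> T u x = m x * s x" by (auto simp: rep)
  have fd1: "fd (\<lambda>_. 1) b x = 0" for b x by (simp add: fd_def)
  \<comment> \<open>Testing against the constant 1, which has no energy, isolates the rank one
    term.\<close>
  have "(\<Sum>x\<in>X. 1 * T u x) = (\<Sum>z\<in>X. m z * u z) * (\<Sum>z\<in>X. m z)"
    using form[of "\<lambda>_. 1" u] fd1 by (simp add: en_def)
  moreover have "(\<Sum>x\<in>X. 1 * T u x) = 0" using u s by simp
  moreover have "(\<Sum>z\<in>X. m z) > 0"
    by (rule sum_pos) (use finite_grid grid_nonempty m_pos in auto)
  ultimately have "(\<Sum>z\<in>X. m z * u z) = 0" by simp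
  then have "lap u x = s x" if "x \<in> X" for x
    using u[OF that] m_pos[of x] by (simp add: T_def)
  then show ?thesis by blast
qed

end

section \<open>The discrete Bochner inequality\<close>

text \<open>Weighted Young inequality: a share \<open>\<eta>\<close> of the quadratic term absorbs
  the cross term. The bound \<open>a \<ge> 1/2\<close> holds for every jump rate on a fine
  grid.\<close>

lemma quadratic_absorb:
  fixes a c d g \<eta> :: real
  assumes "a \<ge> 1/2" "\<eta> > 0"
  shows "a * (1/2) * d^2 - c * g * d \<ge> (1 - \<eta>) / 2 * (a * d^2) - c^2 * g^2 / \<eta>"
proof -
  have "0 \<le> (\<eta> * d / 2 - c * g)^2 / \<eta>" using assms by simp
  also have "\<dots> = \<eta> * d^2 / 4 - c * g * d + c^2 * g^2 / \<eta>"
    using assms by (simp add: power2_eq_square field_simps)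
  also have "\<dots> \<le> a * (1/2) * \<eta> * d^2 - c * g * d + c^2 * g^2 / \<eta>"
    using mult_right_mono[OF assms(1), of "\<eta> * d^2"] assms by (simp add: field_simps)
  finally have "0 \<le> a * (1/2) * \<eta> * d^2 - c * g * d + c^2 * g^2 / \<eta>" .
  moreover have "(1 - \<eta>) / 2 * (a * d^2) = a * (1/2) * d^2 - a * (1/2) * \<eta> * d^2"
    by (simp add: field_simps)
  ultimately show ?thesis by linarith
qed

context box_grid
begin

text \<open>The commutator of \<open>lap\<close> with a difference; \<open>cP + cM\<close> approximates \<open>h^2\<close> times the Hessian entry \<open>i, j\<close> of \<open>V\<close>.\<close>

definition cP :: "'a \<Rightarrow> 'a \<Rightarrow> 'a \<Rightarrow> real" where "cP i j x = al i x - al i (fwd j x)"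
definition cM :: "'a \<Rightarrow> 'a \<Rightarrow> 'a \<Rightarrow> real" where "cM i j x = be i (fwd j x) - be i x"

text \<open>Leibniz rule: the first summand of each pair carries second differences of
  \<open>u\<close>, the second the variation of the rate. The latter multiplies a difference at a
  shifted point, which is the source of the error term in \<open>bochner_edge\<close>.\<close>

lemma fd_lap:
  assumes "x \<in> X" "fwd j x \<in> X"
  shows "fd (lap u) j x = (\<Sum>i\<in>Basis.
      (- al i x * (fd u i (fwd j x) - fd u i x) + cP i j x * fd u i (fwd j x))
    + (be i x * (fd u i (bwd i (fwd j x)) - fd u i (bwd i x))
       + cM i j x * fd u i (bwd i (fwd j x))))"
proof -
  have "fd (lap u) j x = lap u (fwd j x) - lap u x" using assms by (simp add: fd_def)
  also have "\<dots> = (\<Sum>i\<in>Basis. (be i (fwd j x) * fd u i (bwd i (fwd j x)) - al i (fwd j x) * fd u i (fwd j x))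
       - (be i x * fd u i (bwd i x) - al i x * fd u i x))"
    by (simp add: lap_def sum_subtractf)
  finally show ?thesis
    by (simp add: cP_def cM_def algebra_simps)
qed

text \<open>Second differences commute once all four corners of the square lie in the grid; the box
  property supplies the fourth, so no Neumann zero interferes.\<close>

lemma fd_swap:
  assumes "x \<in> X" "fwd j x \<in> X" "fwd i x \<in> X" "i \<in> Basis" "j \<in> Basis"
  shows "fd u i (fwd j x) - fd u i x = fd u j (fwd i x) - fd u j x"
proof (cases "i = j")
  case False
  then have "fwd i (fwd j x) \<in> X" using box_plus assms by blast
  moreover have e: "fwd i (fwd j x) = fwd j (fwd i x)" by simp
  ultimately show ?thesis unfolding fd_def e using assms by simp
qed simp

lemma fd_swap_minus:
  assumes "x \<in> X" "fwd j x \<in> X" "bwd i x \<in> X" "i \<in> Basis" "j \<in> Basis"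
  shows "fd u i (bwd i (fwd j x)) - fd u i (bwd i x) = fd u j x - fd u j (bwd i x)"
proof (cases "i = j")
  case False
  then have "bwd i (fwd j x) \<in> X" using box_minus assms by blast
  moreover have e: "bwd i (fwd j x) = fwd j (bwd i x)" by simp
  ultimately show ?thesis unfolding fd_def e using assms by simp
qed simp

lemma abs_fd_le_norm_grd: "i \<in> Basis \<Longrightarrow> \<bar>fd u i x\<bar> \<le> norm (grd u x)"
  using Basis_le_norm[of i "grd u x"] by (simp add: grd_inner)

lemma abs_fd_diff_le: "i \<in> Basis \<Longrightarrow> \<bar>fd u i x - fd u i y\<bar> \<le> norm (grd u x - grd u y)"
  using Basis_le_norm[of i "grd u x - grd u y"] by (simp add: grd_inner inner_diff_left)

lemma inner_norm_identity:
  fixes a b :: 'a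
  shows "a \<bullet> (a - b) = ((norm a)^2 - (norm b)^2) / 2 + (norm (a - b))^2 / 2"
  by (simp add: power2_norm_eq_inner inner_diff_left inner_diff_right inner_commute field_simps)

lemma norm_diff_square_le:
  fixes a b :: 'a
  shows "(norm a - norm b)^2 \<le> (norm (a - b))^2"
  using norm_triangle_ineq3[of a b] by (simp add: abs_le_square_iff[symmetric])

text \<open>One argument for both kinds of edge: \<open>y\<close> is the neighbour across the edge
  along \<open>i\<close>, \<open>a\<close> the rate and \<open>r\<close> its variation.
  \<open>inner_norm_identity\<close> splits the second differences into half the increment of the
  squared gradient norm, which rebuilds \<open>lap\<close>, and half of
  \<open>(norm (grd u x - grd u y))^2\<close>. The latter dominates the squared increment of the
  gradient norm (Kato) and also pays for replacing \<open>e j\<close> by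
  \<open>fd u i x\<close>.\<close>

lemma bochner_edge:
  assumes i: "i \<in> Basis" and eta: "\<eta> > 0" "\<eta> \<le> 1" and c: "c \<ge> 0" and a: "a \<ge> 1/2"
    and r: "\<And>j. j \<in> Basis \<Longrightarrow> \<bar>r j\<bar> \<le> c"
    and e: "\<And>j. j \<in> Basis \<Longrightarrow> fwd j x \<in> X \<Longrightarrow> \<bar>e j - fd u i x\<bar> \<le> 2 * norm (grd u x - grd u y)"
    and t: "\<And>j. j \<in> Basis \<Longrightarrow> fwd j x \<in> X \<Longrightarrow> t j = fd u j x - fd u j y"
  shows "(\<Sum>j\<in>Basis. fd u j x * (a * t j + r j * e j))
    \<ge> (1 - \<eta>) / 2 * (a * (norm (grd u x) - norm (grd u y))^2) + a * ((norm (grd u x))^2 - (norm (grd u y))^2) / 2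
      + (\<Sum>j\<in>Basis. fd u j x * r j * fd u i x) - (real DIM('a) * (2 * c))^2 * (norm (grd u x))^2 / \<eta>"
proof -
  let ?g = "norm (grd u x)" and ?d = "norm (grd u x - grd u y)"
  have "fd u j x * (a * t j + r j * e j) \<ge> a * (fd u j x * (fd u j x - fd u j y)) + fd u j x * r j * fd u i x - (2 * c) * ?g * ?d"
    if j: "j \<in> Basis" for j
  proof (cases "fwd j x \<in> X")
    case True
    have "\<bar>fd u j x * r j * (e j - fd u i x)\<bar> \<le> ?g * c * (2 * ?d)"
      unfolding abs_mult using r[OF j] c
      by (intro mult_mono abs_fd_le_norm_grd j e True mult_nonneg_nonneg) auto
    then show ?thesis unfolding t[OF j True] by (simp add: algebra_simps abs_le_iff)
  qed (use c in \<open>simp add: fd_outside\<close>)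
  then have "(\<Sum>j\<in>Basis. fd u j x * (a * t j + r j * e j))
      \<ge> (\<Sum>j\<in>Basis. a * (fd u j x * (fd u j x - fd u j y)) + fd u j x * r j * fd u i x - (2 * c) * ?g * ?d)"
    by (rule sum_mono)
  also have "(\<Sum>j\<in>Basis. a * (fd u j x * (fd u j x - fd u j y)) + fd u j x * r j * fd u i x - (2 * c) * ?g * ?d)
      = a * (grd u x \<bullet> (grd u x - grd u y)) + (\<Sum>j\<in>Basis. fd u j x * r j * fd u i x) - real DIM('a) * (2 * c) * ?g * ?d"
    by (simp add: inner_diff_right grd_inner_grd sum.distrib sum_subtractf right_diff_distrib sum_distrib_left)
  finally have "(\<Sum>j\<in>Basis. fd u j x * (a * t j + r j * e j)) \<ge> \<dots>" .
  moreover have "a * (grd u x \<bullet> (grd u x - grd u y)) = a * (?g^2 - (norm (grd u y))^2) / 2 + a * (1/2) * ?d^2"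
    unfolding inner_norm_identity by (simp add: field_simps)
  moreover have "(1 - \<eta>) / 2 * (a * (?g - norm (grd u y))^2) \<le> (1 - \<eta>) / 2 * (a * ?d^2)"
    using eta a by (intro mult_left_mono norm_diff_square_le) auto
  ultimately show ?thesis
    using quadratic_absorb[OF a eta(1), of ?d "real DIM('a) * (2 * c)" ?g] by linarith
qed

lemma bochner_plus:
  assumes x: "x \<in> X" and i: "i \<in> Basis" and eta: "\<eta> > 0" "\<eta> \<le> 1" and c: "c \<ge> 0"
    and al: "al i x \<ge> 1/2" and P: "\<And>j. j \<in> Basis \<Longrightarrow> \<bar>cP i j x\<bar> \<le> c"
  shows "(\<Sum>j\<in>Basis. fd u j x * (- al i x * (fd u i (fwd j x) - fd u i x) + cP i j x * fd u i (fwd j x)))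
    \<ge> (1 - \<eta>) / 2 * (al i x * (fd (\<lambda>y. norm (grd u y)) i x)^2) - al i x * fd (\<lambda>y. (norm (grd u y))^2) i x / 2
      + (\<Sum>j\<in>Basis. fd u j x * cP i j x * fd u i x)
      - (real DIM('a) * (2 * c))^2 * (norm (grd u x))^2 / \<eta>" (is "?L \<ge> ?R")
proof (cases "fwd i x \<in> X")
  case True
  have e: "\<bar>fd u i (fwd j x) - fd u i x\<bar> \<le> 2 * norm (grd u x - grd u (fwd i x))"
    and t: "- (fd u i (fwd j x) - fd u i x) = fd u j x - fd u j (fwd i x)"
    if "j \<in> Basis" "fwd j x \<in> X" for j
    using fd_swap[OF x that(2) True i that(1), of u] abs_fd_diff_le[OF that(1), of u x "fwd i x"] by linarith+
  have 1: "(fd (\<lambda>y. norm (grd u y)) i x)^2 = (norm (grd u x) - norm (grd u (fwd i x)))^2"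
    using x True by (simp add: fd_def power2_commute)
  have 2: "al i x * fd (\<lambda>y. (norm (grd u y))^2) i x / 2 = - (al i x * ((norm (grd u x))^2 - (norm (grd u (fwd i x)))^2) / 2)"
    using x True by (simp add: fd_def field_simps)
  show ?thesis using bochner_edge[where r = "\<lambda>j. cP i j x" and e = "\<lambda>j. fd u i (fwd j x)"
      and t = "\<lambda>j. - (fd u i (fwd j x) - fd u i x)", OF i eta c al P e t]
    unfolding 1 2 mult_minus_left mult_minus_right by linarith
next
  case False
  \<comment> \<open>On the upper face the differences along \<open>i\<close> vanish at
    \<open>x\<close> and at its neighbours \<open>fwd j x\<close> in the grid, and the summand
    \<open>j = i\<close> has the factor \<open>fd u i x = 0\<close>.\<close>
  have "fd u j x * (- al i x * (fd u i (fwd j x) - fd u i x) + cP i j x * fd u i (fwd j x)) = 0"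
    if j: "j \<in> Basis" for j
  proof (cases "fwd j x \<in> X \<and> i \<noteq> j")
    case True
    then have "fwd i (fwd j x) \<notin> X" using box_plus[OF i j _ x] False by blast
    then show ?thesis using False by (simp add: fd_outside)
  next
    case nt: False
    then have "fd u j x = 0" using False by (auto simp: fd_outside)
    then show ?thesis by simp
  qed
  then have "?L = 0" by (intro sum.neutral ballI)
  moreover have "(\<Sum>j\<in>Basis. fd u j x * cP i j x * fd u i x) = 0" using False by (simp add: fd_outside)
  ultimately show ?thesis using False eta by (simp add: fd_outside)
qed

lemma bochner_minus:
  assumes x: "x \<in> X" and i: "i \<in> Basis" and eta: "\<eta> > 0" "\<eta> \<le> 1" and c: "c \<ge> 0"
    and be: "be i x \<ge> 1/2" and M: "\<And>j. j \<in> Basis \<Longrightarrow> \<bar>cM i j x\<bar> \<le> c"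
  shows "(\<Sum>j\<in>Basis. fd u j x * (be i x * (fd u i (bwd i (fwd j x)) - fd u i (bwd i x)) + cM i j x * fd u i (bwd i (fwd j x))))
    \<ge> (1 - \<eta>) / 2 * (be i x * (fd (\<lambda>y. norm (grd u y)) i (bwd i x))^2)
        + be i x * fd (\<lambda>y. (norm (grd u y))^2) i (bwd i x) / 2
      + (\<Sum>j\<in>Basis. fd u j x * cM i j x * fd u i x)
      - (real DIM('a) * (2 * c))^2 * (norm (grd u x))^2 / \<eta>" (is "?L \<ge> ?R")
proof (cases "bwd i x \<in> X")
  case True
  let ?y = "bwd i x"
  have e: "\<bar>fd u i (bwd i (fwd j x)) - fd u i x\<bar> \<le> 2 * norm (grd u x - grd u ?y)"
    and t: "fd u i (bwd i (fwd j x)) - fd u i ?y = fd u j x - fd u j ?y"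
    if "j \<in> Basis" "fwd j x \<in> X" for j
    using fd_swap_minus[OF x that(2) True i that(1), of u] abs_fd_diff_le[OF that(1), of u x ?y]
      abs_fd_diff_le[OF i, of u x ?y] by linarith+
  have 1: "fd (\<lambda>y. norm (grd u y)) i ?y = norm (grd u x) - norm (grd u ?y)"
    and 2: "fd (\<lambda>y. (norm (grd u y))^2) i ?y = (norm (grd u x))^2 - (norm (grd u ?y))^2" using x True by (simp_all add: fd_def)
  show ?thesis using bochner_edge[where r = "\<lambda>j. cM i j x" and e = "\<lambda>j. fd u i (bwd i (fwd j x))"
      and t = "\<lambda>j. fd u i (bwd i (fwd j x)) - fd u i ?y", OF i eta c be M e t]
    unfolding 1 2 by linarith
next
  case False
  let ?g = "norm (grd u x)"
  \<comment> \<open>Differences sit at the lower end of their edge, so on the lower face the summand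
    \<open>j = i\<close> survives. It leaves \<open>be i x * (fd u i x)^2\<close>, of the favourable
    sign, which pays for the off-diagonal commutators inserted to reach the same formula as in the
    interior.\<close>
  have "fd u j x * (be i x * (fd u i (bwd i (fwd j x)) - fd u i (bwd i x)) + cM i j x * fd u i (bwd i (fwd j x)))
      \<ge> (if j = i then be i x * (fd u i x)^2 else 0) + fd u j x * cM i j x * fd u i x - c * ?g * \<bar>fd u i x\<bar>"
    if j: "j \<in> Basis" for j
  proof (cases "j = i")
    case True
    then show ?thesis using False c by (simp add: fd_outside algebra_simps power2_eq_square)
  next
    case ji: False
    have "\<bar>fd u j x * cM i j x * fd u i x\<bar> \<le> ?g * c * \<bar>fd u i x\<bar>"
      unfolding abs_mult using M[OF j] c
      by (intro mult_mono abs_fd_le_norm_grd j mult_nonneg_nonneg) auto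
    moreover have "fd u j x * fd u i (bwd i (fwd j x)) = 0"
      using box_minus[OF i j _ x] False ji by (cases "fwd j x \<in> X") (auto simp: fd_outside)
    moreover have "fd u i (bwd i x) = 0" using False by (simp add: fd_outside)
    ultimately show ?thesis using ji by (auto simp: algebra_simps abs_le_iff)
  qed
  then have "?L \<ge> (\<Sum>j\<in>Basis. (if j = i then be i x * (fd u i x)^2 else 0) + fd u j x * cM i j x * fd u i x - c * ?g * \<bar>fd u i x\<bar>)"
    by (rule sum_mono)
  also have "(\<Sum>j\<in>Basis. (if j = i then be i x * (fd u i x)^2 else 0) + fd u j x * cM i j x * fd u i x - c * ?g * \<bar>fd u i x\<bar>)
    = be i x * (fd u i x)^2 + (\<Sum>j\<in>Basis. fd u j x * cM i j x * fd u i x) - real DIM('a) * c * ?g * \<bar>fd u i x\<bar>"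
    using i by (simp add: sum.distrib sum_subtractf)
  finally have L: "?L \<ge> \<dots>" .
  let ?t = "\<bar>fd u i x\<bar>"
  have "be i x * (1/2) * ?t^2 \<le> be i x * (fd u i x)^2" using be by simp
  moreover have "be i x * (1/2) * ?t^2 - real DIM('a) * c * ?g * ?t \<ge> - ((real DIM('a) * c)^2 * ?g^2 / 1)"
    using quadratic_absorb[OF be, of 1 ?t "real DIM('a) * c" ?g] by simp
  moreover have "(real DIM('a) * c)^2 * ?g^2 / 1 \<le> (real DIM('a) * (2 * c))^2 * ?g^2 / \<eta>"
  proof (rule frac_le)
    show "(real DIM('a) * c)^2 * ?g^2 \<le> (real DIM('a) * (2 * c))^2 * ?g^2"
      using c by (intro mult_right_mono power_mono) auto
  qed (use eta in auto)
  ultimately show ?thesis using L False by (simp add: fd_outside)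
qed

text \<open>The carre du champ of the walk in the unnormalised form of \<open>gam_lap\<close>, that
  is, \<open>2 * h^2\<close> times the usual one.\<close>

definition gam :: "('a \<Rightarrow> real) \<Rightarrow> 'a \<Rightarrow> real" where
  "gam u x = (\<Sum>i\<in>Basis. al i x * (fd u i x)^2 + be i x * (fd u i (bwd i x))^2)"

lemma gam_nonneg: "gam u x \<ge> 0"
  unfolding gam_def by (intro sum_nonneg) (simp add: al_pos be_pos less_imp_le)

lemma gam_lap:
  assumes "x \<in> X" shows "gam u x = 2 * u x * lap u x - lap (\<lambda>y. (u y)^2) x"
proof -
  have "2 * u x * lap u x - lap (\<lambda>y. (u y)^2) x = (\<Sum>i\<in>Basis.
      2 * u x * (be i x * fd u i (bwd i x) - al i x * fd u i x)
      - (be i x * fd (\<lambda>y. (u y)^2) i (bwd i x) - al i x * fd (\<lambda>y. (u y)^2) i x))"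
    unfolding lap_def sum_distrib_left sum_subtractf[symmetric] by (rule refl)
  also have "\<dots> = gam u x"
    unfolding gam_def
  proof (rule sum.cong[OF refl])
    fix i :: 'a
    have 1: "fd (\<lambda>y. (u y)^2) i x = fd u i x * (2 * u x + fd u i x)"
      by (simp add: fd_def power2_eq_square algebra_simps)
    have 2: "fd (\<lambda>y. (u y)^2) i (bwd i x) = fd u i (bwd i x) * (2 * u x - fd u i (bwd i x))"
      by (simp add: fd_def power2_eq_square algebra_simps)
    show "2 * u x * (be i x * fd u i (bwd i x) - al i x * fd u i x)
      - (be i x * fd (\<lambda>y. (u y)^2) i (bwd i x) - al i x * fd (\<lambda>y. (u y)^2) i x)
      = al i x * (fd u i x)^2 + be i x * (fd u i (bwd i x))^2"
      unfolding 1 2 by (simp add: power2_eq_square algebra_simps)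
  qed
  finally show ?thesis ..
qed

text \<open>Summed over \<open>i\<close>, the commutators form the Hessian at
  \<open>grd u x\<close>. In dimension \<open>n\<close> its \<open>n^2\<close> entries cost
  \<open>n^2 * \<delta>\<close>, and the \<open>2 * n\<close> edges cost
  \<open>(2 * n * c)^2 / \<eta>\<close> each, whence \<open>8 * n^3 * c^2 / \<eta>\<close>. With
  \<open>c\<close> of order \<open>h^2\<close> the last error is of order
  \<open>h^4\<close>.\<close>

lemma bochner:
  assumes x: "x \<in> X" and eta: "\<eta> > 0" "\<eta> \<le> 1" and c: "c \<ge> 0"
    and al: "\<And>i. i \<in> Basis \<Longrightarrow> al i x \<ge> 1/2" and be: "\<And>i. i \<in> Basis \<Longrightarrow> be i x \<ge> 1/2"
    and P: "\<And>i j. i \<in> Basis \<Longrightarrow> j \<in> Basis \<Longrightarrow> \<bar>cP i j x\<bar> \<le> c"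
    and M: "\<And>i j. i \<in> Basis \<Longrightarrow> j \<in> Basis \<Longrightarrow> \<bar>cM i j x\<bar> \<le> c"
    and PM: "\<And>i j. i \<in> Basis \<Longrightarrow> j \<in> Basis \<Longrightarrow> \<bar>cP i j x + cM i j x - h^2 * (i \<bullet> H j)\<bar> \<le> h^2 * \<delta>"
    and linH: "linear H" and Hr: "\<And>v. v \<bullet> H v \<ge> r * (norm v)^2"
  shows "grd u x \<bullet> grd (lap u) x \<ge> lap (\<lambda>y. (norm (grd u y))^2) x / 2
    + (1 - \<eta>) / 2 * gam (\<lambda>y. norm (grd u y)) x
    + (h^2 * (r - (real DIM('a))^2 * \<delta>) - 8 * real DIM('a) ^ 3 * c^2 / \<eta>) * (norm (grd u x))^2"
proof -
  let ?g = "norm (grd u x)" and ?n = "\<lambda>y. norm (grd u y)"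
  define P where "P = (\<lambda>i. (1 - \<eta>) / 2 * (al i x * (fd ?n i x)^2) - al i x * fd (\<lambda>y. (?n y)^2) i x / 2)"
  define Q where "Q = (\<lambda>i. (1 - \<eta>) / 2 * (be i x * (fd ?n i (bwd i x))^2) + be i x * fd (\<lambda>y. (?n y)^2) i (bwd i x) / 2)"
  have PQ: "lap (\<lambda>y. (?n y)^2) x / 2 + (1 - \<eta>) / 2 * gam ?n x = (\<Sum>i\<in>Basis. P i + Q i)"
    unfolding lap_def gam_def P_def Q_def sum_divide_distrib sum_distrib_left sum.distrib[symmetric]
    by (intro sum.cong refl) (simp add: field_simps)
  define p where "p = (\<lambda>i j. - al i x * (fd u i (fwd j x) - fd u i x) + cP i j x * fd u i (fwd j x))"
  define q where "q = (\<lambda>i j. be i x * (fd u i (bwd i (fwd j x)) - fd u i (bwd i x)) + cM i j x * fd u i (bwd i (fwd j x)))"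
  have "grd u x \<bullet> grd (lap u) x = (\<Sum>j\<in>Basis. fd u j x * (\<Sum>i\<in>Basis. p i j + q i j))"
    unfolding grd_inner_grd
  proof (rule sum.cong[OF refl])
    fix j :: 'a assume "j \<in> Basis"
    show "fd u j x * fd (lap u) j x = fd u j x * (\<Sum>i\<in>Basis. p i j + q i j)"
      using fd_lap[OF x, of j u] by (cases "fwd j x \<in> X") (auto simp: fd_outside p_def q_def)
  qed
  also have "\<dots> = (\<Sum>i\<in>Basis. (\<Sum>j\<in>Basis. fd u j x * p i j) + (\<Sum>j\<in>Basis. fd u j x * q i j))"
    unfolding sum_distrib_left by (subst sum.swap) (simp add: sum.distrib distrib_left)
  finally have eq: "grd u x \<bullet> grd (lap u) x = \<dots>" .
  have each: "(\<Sum>j\<in>Basis. fd u j x * p i j) + (\<Sum>j\<in>Basis. fd u j x * q i j)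
      \<ge> P i + Q i + (\<Sum>j\<in>Basis. fd u j x * (cP i j x + cM i j x) * fd u i x) - 8 * (real DIM('a) * c)^2 * ?g^2 / \<eta>"
    if i: "i \<in> Basis" for i
  proof -
    have "(\<Sum>j\<in>Basis. fd u j x * (cP i j x + cM i j x) * fd u i x)
       = (\<Sum>j\<in>Basis. fd u j x * cP i j x * fd u i x) + (\<Sum>j\<in>Basis. fd u j x * cM i j x * fd u i x)"
      by (simp add: sum.distrib[symmetric] algebra_simps)
    moreover have "(real DIM('a) * (2 * c))^2 * ?g^2 / \<eta> + (real DIM('a) * (2 * c))^2 * ?g^2 / \<eta> = 8 * (real DIM('a) * c)^2 * ?g^2 / \<eta>"
      by (simp add: power_mult_distrib field_simps)
    ultimately show ?thesis
      using bochner_plus[OF x i eta c al[OF i] P[OF i], of u] bochner_minus[OF x i eta c be[OF i] M[OF i], of u]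
      unfolding p_def q_def P_def Q_def by linarith
  qed
  have cross: "(\<Sum>i\<in>Basis. \<Sum>j\<in>Basis. fd u j x * (cP i j x + cM i j x) * fd u i x) \<ge> h^2 * (r - (real DIM('a))^2 * \<delta>) * ?g^2"
  proof -
    have HG: "H (grd u x) = (\<Sum>j\<in>Basis. fd u j x *\<^sub>R H j)"
      unfolding grd_def using linH by (simp add: linear_sum linear_scale)
    have "(\<Sum>i\<in>Basis. \<Sum>j\<in>Basis. fd u j x * (h^2 * (i \<bullet> H j)) * fd u i x) = h^2 * (grd u x \<bullet> H (grd u x))"
      unfolding HG by (subst sum.swap) (simp add: grd_def[of u x] inner_sum_left inner_sum_right sum_distrib_left mult_ac)
    moreover have "h^2 * (grd u x \<bullet> H (grd u x)) \<ge> h^2 * (r * ?g^2)"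
      by (intro mult_left_mono Hr) simp
    moreover have "(\<Sum>i\<in>Basis. \<Sum>j\<in>Basis. fd u j x * (cP i j x + cM i j x) * fd u i x)
        \<ge> (\<Sum>i\<in>Basis. \<Sum>j\<in>Basis. fd u j x * (h^2 * (i \<bullet> H j)) * fd u i x - ?g * (h^2 * \<delta>) * ?g)"
    proof (intro sum_mono)
      fix i j :: 'a assume ij: "i \<in> Basis" "j \<in> Basis"
      have "0 \<le> h^2 * \<delta>" using PM[OF ij] by linarith
      then have "0 \<le> \<delta>" using h_pos by (simp add: zero_le_mult_iff)
      then have "\<bar>fd u j x * (cP i j x + cM i j x - h^2 * (i \<bullet> H j)) * fd u i x\<bar> \<le> ?g * (h^2 * \<delta>) * ?g"
        unfolding abs_mult by (intro mult_mono abs_fd_le_norm_grd ij PM mult_nonneg_nonneg) auto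
      then show "fd u j x * (h^2 * (i \<bullet> H j)) * fd u i x - ?g * (h^2 * \<delta>) * ?g \<le> fd u j x * (cP i j x + cM i j x) * fd u i x"
        by (simp add: algebra_simps abs_le_iff)
    qed
    ultimately show ?thesis by (simp add: sum_subtractf algebra_simps power2_eq_square)
  qed
  have "grd u x \<bullet> grd (lap u) x \<ge> (\<Sum>i\<in>Basis. P i + Q i + (\<Sum>j\<in>Basis. fd u j x * (cP i j x + cM i j x) * fd u i x) - 8 * (real DIM('a) * c)^2 * ?g^2 / \<eta>)"
    unfolding eq by (rule sum_mono) (rule each)
  also have "(\<Sum>i\<in>Basis. P i + Q i + (\<Sum>j\<in>Basis. fd u j x * (cP i j x + cM i j x) * fd u i x) - 8 * (real DIM('a) * c)^2 * ?g^2 / \<eta>)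
    = (\<Sum>i\<in>Basis. P i + Q i) + (\<Sum>i\<in>Basis. \<Sum>j\<in>Basis. fd u j x * (cP i j x + cM i j x) * fd u i x) - real DIM('a) * (8 * (real DIM('a) * c)^2 * ?g^2 / \<eta>)"
    by (simp only: sum.distrib sum_subtractf sum_constant)
  finally have "grd u x \<bullet> grd (lap u) x \<ge> \<dots>" .
  moreover have "real DIM('a) * (8 * (real DIM('a) * c)^2 * ?g^2 / \<eta>) = 8 * real DIM('a) ^ 3 * c^2 / \<eta> * ?g^2"
    by (simp add: power2_eq_square power3_eq_cube)
  ultimately show ?thesis
    using PQ cross left_diff_distrib[of "h^2 * (r - (real DIM('a))^2 * \<delta>)" "8 * real DIM('a) ^ 3 * c^2 / \<eta>" "?g^2"]
    by linarith
qed

end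

section \<open>Discrete Poincare and covariance inequalities\<close>

lemma weighted_Cauchy_Schwarz:
  fixes p a b :: "'b \<Rightarrow> real"
  assumes "\<And>x. x \<in> X \<Longrightarrow> p x \<ge> 0"
  shows "(\<Sum>x\<in>X. p x * a x * b x)^2 \<le> (\<Sum>x\<in>X. p x * (a x)^2) * (\<Sum>x\<in>X. p x * (b x)^2)"
proof -
  have "(\<Sum>x\<in>X. (sqrt (p x) * a x) * (sqrt (p x) * b x))^2
      \<le> (\<Sum>x\<in>X. (sqrt (p x) * a x)^2) * (\<Sum>x\<in>X. (sqrt (p x) * b x)^2)"
    by (rule Cauchy_Schwarz_ineq_sum)
  moreover have "(\<Sum>x\<in>X. (sqrt (p x) * a x) * (sqrt (p x) * b x)) = (\<Sum>x\<in>X. p x * a x * b x)"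
  proof (intro sum.cong refl)
    fix x assume "x \<in> X"
    have "(sqrt (p x) * a x) * (sqrt (p x) * b x) = (sqrt (p x) * sqrt (p x)) * a x * b x" by (simp only: mult_ac)
    then show "(sqrt (p x) * a x) * (sqrt (p x) * b x) = p x * a x * b x" using assms[OF \<open>x \<in> X\<close>] by simp
  qed
  moreover have "(\<Sum>x\<in>X. (sqrt (p x) * a x)^2) = (\<Sum>x\<in>X. p x * (a x)^2)" for a
    by (intro sum.cong refl) (simp add: assms power_mult_distrib)
  ultimately show ?thesis by metis
qed

text \<open>Uses \<open>\<Sum>p \<bar>g^2 - 1\<bar> \<le> \<parallel>g - 1\<parallel> \<parallel>g + 1\<parallel> = 2 sqrt (Var g)\<close> when \<open>\<Sum>p g^2 = 1\<close>.\<close>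
lemma covariance_square_le_osc:
  fixes p g \<rho> :: "'b \<Rightarrow> real"
  assumes p: "\<And>x. x \<in> X \<Longrightarrow> p x \<ge> 0" and p1: "(\<Sum>x\<in>X. p x) = 1" and g2: "(\<Sum>x\<in>X. p x * (g x)^2) = 1"
    and \<rho>: "\<And>x. x \<in> X \<Longrightarrow> a \<le> \<rho> x" "\<And>x. x \<in> X \<Longrightarrow> \<rho> x \<le> a + \<omega>" and \<omega>: "\<omega> \<ge> 0"
  shows "(\<Sum>x\<in>X. p x * \<rho> x) - (\<Sum>x\<in>X. p x * \<rho> x * (g x)^2) \<le> \<omega> * sqrt (1 - (\<Sum>x\<in>X. p x * g x)^2)"
proof -
  let ?A = "\<Sum>x\<in>X. p x * g x"
  \<comment> \<open>The midpoint of the range halves the oscillation; subtracting it is free because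
    \<open>p\<close> and \<open>p * g^2\<close> have equal mass.\<close>
  define r where "r = a + \<omega> / 2"
  have "(\<Sum>x\<in>X. p x * \<rho> x) - (\<Sum>x\<in>X. p x * \<rho> x * (g x)^2)
      = (\<Sum>x\<in>X. p x * (\<rho> x - r) * (1 - (g x)^2)) + r * ((\<Sum>x\<in>X. p x) - (\<Sum>x\<in>X. p x * (g x)^2))"
    by (simp add: sum_subtractf[symmetric] sum.distrib[symmetric] sum_distrib_left algebra_simps)
  also have "\<dots> \<le> (\<Sum>x\<in>X. \<omega> / 2 * (p x * \<bar>1 - g x\<bar> * \<bar>1 + g x\<bar>))"
  proof -
    have "p x * (\<rho> x - r) * (1 - (g x)^2) \<le> \<omega> / 2 * (p x * \<bar>1 - g x\<bar> * \<bar>1 + g x\<bar>)" if "x \<in> X" for x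
    proof -
      have "(\<rho> x - r) * (1 - (g x)^2) \<le> \<bar>\<rho> x - r\<bar> * \<bar>1 - (g x)^2\<bar>" by (simp add: abs_mult[symmetric])
      also have "\<dots> \<le> \<omega> / 2 * \<bar>1 - (g x)^2\<bar>"
        using \<rho>[OF that] by (intro mult_right_mono) (auto simp: r_def abs_le_iff field_simps)
      also have "\<bar>1 - (g x)^2\<bar> = \<bar>1 - g x\<bar> * \<bar>1 + g x\<bar>"
        unfolding abs_mult[symmetric] by (simp add: power2_eq_square algebra_simps)
      finally have "(\<rho> x - r) * (1 - (g x)^2) \<le> \<omega> / 2 * (\<bar>1 - g x\<bar> * \<bar>1 + g x\<bar>)" .
      from mult_left_mono[OF this p[OF that]] show ?thesis by (simp add: mult_ac)
    qed
    then show ?thesis using p1 g2 by (auto intro!: sum_mono)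
  qed
  also have "\<dots> = \<omega> / 2 * (\<Sum>x\<in>X. p x * \<bar>1 - g x\<bar> * \<bar>1 + g x\<bar>)" by (simp add: sum_distrib_left)
  also have "\<dots> \<le> \<omega> / 2 * (2 * sqrt (1 - ?A^2))"
  proof (rule mult_left_mono)
    have "(\<Sum>x\<in>X. p x * \<bar>1 - g x\<bar> * \<bar>1 + g x\<bar>)^2
        \<le> (\<Sum>x\<in>X. p x * \<bar>1 - g x\<bar>^2) * (\<Sum>x\<in>X. p x * \<bar>1 + g x\<bar>^2)"
      by (rule weighted_Cauchy_Schwarz) (rule p)
    also have "(\<Sum>x\<in>X. p x * \<bar>1 - g x\<bar>^2) = (\<Sum>x\<in>X. p x) - 2 * ?A + (\<Sum>x\<in>X. p x * (g x)^2)"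
      by (simp add: sum_subtractf[symmetric] sum.distrib[symmetric] sum_distrib_left power2_eq_square algebra_simps)
    also have "(\<Sum>x\<in>X. p x * \<bar>1 + g x\<bar>^2) = (\<Sum>x\<in>X. p x) + 2 * ?A + (\<Sum>x\<in>X. p x * (g x)^2)"
      by (simp add: sum.distrib[symmetric] sum_distrib_left power2_eq_square algebra_simps)
    also have "((\<Sum>x\<in>X. p x) - 2 * ?A + (\<Sum>x\<in>X. p x * (g x)^2)) * ((\<Sum>x\<in>X. p x) + 2 * ?A + (\<Sum>x\<in>X. p x * (g x)^2))
        = 4 * (1 - ?A^2)"
      unfolding p1 g2 by (simp add: power2_eq_square algebra_simps)
    finally have "(\<Sum>x\<in>X. p x * \<bar>1 - g x\<bar> * \<bar>1 + g x\<bar>) \<le> sqrt (4 * (1 - ?A^2))"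
      by (rule real_le_rsqrt)
    then show "(\<Sum>x\<in>X. p x * \<bar>1 - g x\<bar> * \<bar>1 + g x\<bar>) \<le> 2 * sqrt (1 - ?A^2)"
      by (simp only: real_sqrt_mult) simp
  qed (use \<omega> in auto)
  finally show ?thesis by simp
qed

text \<open>A single tolerance \<open>\<eta>\<close> collects all discretisation errors, so that the
  arguments below are finite algebra. That fine cubic grids satisfy the axioms is
  \<open>eventually_curved_grid\<close>.\<close>

locale curved_grid = box_grid X h V
  for X :: "'a::euclidean_space set" and h :: real and V :: "'a \<Rightarrow> real" +
  fixes \<rho> :: "'a \<Rightarrow> real" and \<rho>0 \<eta> :: real
  assumes eta: "0 < \<eta>" "\<eta> < 1" "\<eta> < \<rho>0"
    and al_ge: "\<And>x i. x \<in> X \<Longrightarrow> i \<in> Basis \<Longrightarrow> 1 - \<eta> \<le> al i x"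
    and al_le: "\<And>x i. x \<in> X \<Longrightarrow> i \<in> Basis \<Longrightarrow> al i x \<le> 1 + \<eta>"
    and rho_ge: "\<And>x. x \<in> X \<Longrightarrow> \<rho>0 \<le> \<rho> x"
    and bochner_grid: "\<And>u x. x \<in> X \<Longrightarrow> grd u x \<bullet> grd (lap u) x \<ge> lap (\<lambda>y. (norm (grd u y))^2) x / 2
      + (1 - \<eta>) / 2 * gam (\<lambda>y. norm (grd u y)) x + h^2 * (\<rho> x - \<eta>) * (norm (grd u x))^2"
begin

definition Z :: real where "Z = (\<Sum>x\<in>X. m x)"
definition mean :: "('a \<Rightarrow> real) \<Rightarrow> real" where "mean f = (\<Sum>x\<in>X. m x * f x) / Z"

lemma Z_pos: "Z > 0"
  unfolding Z_def by (rule sum_pos) (use finite_grid grid_nonempty m_pos in auto)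

abbreviation wsq :: "('a \<Rightarrow> real) \<Rightarrow> real" where "wsq f \<equiv> \<Sum>x\<in>X. m x * (f x)^2"
abbreviation wsq_grd :: "('a \<Rightarrow> real) \<Rightarrow> real" where "wsq_grd f \<equiv> \<Sum>x\<in>X. m x * (norm (grd f x))^2"

text \<open>The interface through which both assumptions on \<open>\<rho>\<close> enter: functions
  of low energy see almost the full mean of \<open>\<rho>\<close>. It depends on the grid,
  \<open>V\<close> and \<open>\<rho>\<close> but not on \<open>\<eta>\<close>, so it can be proved
  with one tolerance and used with another.\<close>

definition covariance_control :: "real \<Rightarrow> real \<Rightarrow> bool" where
  "covariance_control \<epsilon> k \<longleftrightarrow> (\<forall>g. (\<forall>x. 0 \<le> g x) \<longrightarrow> 0 < (wsq g) \<longrightarrow>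
     en g g \<le> \<epsilon> * h^2 * (wsq g) \<longrightarrow>
     (mean \<rho> - k) * (wsq g) \<le> (\<Sum>x\<in>X. m x * (\<rho> x * (g x)^2)))"

lemma covariance_control_mono:
  assumes "covariance_control \<epsilon> k" "k \<le> k'" shows "covariance_control \<epsilon> k'"
  unfolding covariance_control_def
proof (intro allI impI)
  fix g :: "'a \<Rightarrow> real"
  let ?q = "wsq g"
  assume g: "\<forall>x. 0 \<le> g x" "0 < ?q" "en g g \<le> \<epsilon> * h^2 * ?q"
  have "(mean \<rho> - k') * ?q \<le> (mean \<rho> - k) * ?q" using assms(2) g(2) by (intro mult_right_mono) auto
  also have "\<dots> \<le> (\<Sum>x\<in>X. m x * (\<rho> x * (g x)^2))" using assms(1) g unfolding covariance_control_def by blast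
  finally show "(mean \<rho> - k') * ?q \<le> (\<Sum>x\<in>X. m x * (\<rho> x * (g x)^2))" .
qed

lemma sum_centered: "(\<Sum>x\<in>X. m x * (f x - mean f)) = 0"
proof -
  have "(\<Sum>x\<in>X. m x * (f x - mean f)) = (\<Sum>x\<in>X. m x * f x) - Z * mean f"
    by (simp add: Z_def right_diff_distrib sum_subtractf sum_distrib_right)
  then show ?thesis using Z_pos by (simp add: mean_def)
qed

lemma sum_centered_square: "(\<Sum>x\<in>X. m x * (f x - mean f)^2) = (wsq f) - Z * (mean f)^2"
proof -
  have "(\<Sum>x\<in>X. m x * (f x - k)^2) = (wsq f) - 2 * k * (\<Sum>x\<in>X. m x * f x) + Z * k^2" for k
    unfolding Z_def sum_distrib_left sum_distrib_right sum_subtractf[symmetric] sum.distrib[symmetric]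
    by (intro sum.cong refl) (simp add: power2_eq_square algebra_simps)
  moreover have "(\<Sum>x\<in>X. m x * f x) = Z * mean f" using Z_pos by (simp add: mean_def)
  ultimately show ?thesis by (simp add: power2_eq_square)
qed

lemma fd_const: "fd (\<lambda>y. f y - k) b x = fd f b x"
  by (simp add: fd_def)

lemma sum_m_lap: "(\<Sum>x\<in>X. m x * lap f x) = 0"
proof -
  have "fd (\<lambda>_. 1) b x = 0" for b x by (simp add: fd_def)
  then show ?thesis using sum_by_parts[of f "\<lambda>_. 1"] by (simp add: en_def)
qed

lemma sum_m_gam: "(\<Sum>x\<in>X. m x * gam f x) = 2 * en f f"
proof -
  have "(\<Sum>x\<in>X. m x * gam f x) = 2 * (\<Sum>x\<in>X. m x * lap f x * f x) - (\<Sum>x\<in>X. m x * lap (\<lambda>y. (f y)^2) x)"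
    unfolding sum_distrib_left sum_subtractf[symmetric]
    by (intro sum.cong refl) (simp add: gam_lap algebra_simps)
  then show ?thesis by (simp add: sum_by_parts sum_m_lap)
qed

lemma bochner_summed:
  "(\<Sum>x\<in>X. m x * (grd u x \<bullet> grd (lap u) x))
    \<ge> (1 - \<eta>) * en (\<lambda>y. norm (grd u y)) (\<lambda>y. norm (grd u y)) + h^2 * (\<Sum>x\<in>X. m x * ((\<rho> x - \<eta>) * (norm (grd u x))^2))"
proof -
  let ?g = "\<lambda>y. norm (grd u y)"
  have "(\<Sum>x\<in>X. m x * (grd u x \<bullet> grd (lap u) x)) \<ge> (\<Sum>x\<in>X. m x * (lap (\<lambda>y. (?g y)^2) x / 2
      + (1 - \<eta>) / 2 * gam ?g x + h^2 * (\<rho> x - \<eta>) * (?g x)^2))"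
    by (intro sum_mono mult_left_mono bochner_grid) (simp_all add: m_pos less_imp_le)
  also have "(\<Sum>x\<in>X. m x * (lap (\<lambda>y. (?g y)^2) x / 2
      + (1 - \<eta>) / 2 * gam ?g x + h^2 * (\<rho> x - \<eta>) * (?g x)^2))
    = (1/2) * (\<Sum>x\<in>X. m x * lap (\<lambda>y. (?g y)^2) x) + (1 - \<eta>) / 2 * (\<Sum>x\<in>X. m x * gam ?g x)
      + h^2 * (\<Sum>x\<in>X. m x * ((\<rho> x - \<eta>) * (?g x)^2))"
    unfolding sum_distrib_left sum.distrib[symmetric] by (intro sum.cong refl) (simp add: algebra_simps)
  finally show ?thesis by (simp add: sum_m_lap sum_m_gam)
qed

lemma en_le: "en f g \<le> (1 + \<eta>) * (\<Sum>x\<in>X. m x * (norm (grd f x) * norm (grd g x)))"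
proof -
  have "en f g \<le> (\<Sum>x\<in>X. (1 + \<eta>) * m x * (\<Sum>b\<in>Basis. \<bar>fd f b x\<bar> * \<bar>fd g b x\<bar>))"
    unfolding en_def
  proof (intro sum_mono)
    fix x assume x: "x \<in> X"
    have "w b x * fd f b x * fd g b x \<le> (1 + \<eta>) * m x * (\<bar>fd f b x\<bar> * \<bar>fd g b x\<bar>)" if b: "b \<in> Basis" for b
    proof -
      have "w b x * fd f b x * fd g b x \<le> w b x * (\<bar>fd f b x\<bar> * \<bar>fd g b x\<bar>)"
        unfolding mult.assoc abs_mult[symmetric] using w_pos[of b x] by (intro mult_left_mono) auto
      also have "\<dots> \<le> (1 + \<eta>) * m x * (\<bar>fd f b x\<bar> * \<bar>fd g b x\<bar>)"
        unfolding m_al[symmetric] using al_le[OF x b] m_pos[of x]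
        by (intro mult_right_mono) (auto simp: mult.commute)
      finally show ?thesis .
    qed
    then show "(\<Sum>b\<in>Basis. w b x * fd f b x * fd g b x) \<le> (1 + \<eta>) * m x * (\<Sum>b\<in>Basis. \<bar>fd f b x\<bar> * \<bar>fd g b x\<bar>)"
      unfolding sum_distrib_left by (rule sum_mono)
  qed
  also have "\<dots> \<le> (\<Sum>x\<in>X. (1 + \<eta>) * m x * (norm (grd f x) * norm (grd g x)))"
  proof (intro sum_mono mult_left_mono)
    fix x
    have "(\<Sum>b\<in>Basis. \<bar>fd f b x\<bar> * \<bar>fd g b x\<bar>)^2 \<le> (\<Sum>b\<in>Basis. \<bar>fd f b x\<bar>^2) * (\<Sum>b\<in>Basis. \<bar>fd g b x\<bar>^2)"
      by (rule Cauchy_Schwarz_ineq_sum)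
    also have "\<dots> = (norm (grd f x) * norm (grd g x))^2" by (simp add: power_mult_distrib grd_norm)
    finally show "(\<Sum>b\<in>Basis. \<bar>fd f b x\<bar> * \<bar>fd g b x\<bar>) \<le> norm (grd f x) * norm (grd g x)"
      by (rule power2_le_imp_le) simp
  qed (use eta m_pos in \<open>auto simp: less_imp_le\<close>)
  finally show ?thesis by (simp add: sum_distrib_left mult.assoc)
qed

lemma en_ge: "(1 - \<eta>) * (wsq_grd f) \<le> en f f"
  unfolding en_def sum_distrib_left grd_norm
proof (intro sum_mono)
  fix x b :: 'a assume x: "x \<in> X" and b: "b \<in> Basis"
  have "(1 - \<eta>) * (m x * (fd f b x)^2) \<le> al b x * (m x * (fd f b x)^2)"
    using al_ge[OF x b] m_pos[of x] by (intro mult_right_mono) auto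
  then show "(1 - \<eta>) * (m x * (fd f b x)^2) \<le> w b x * fd f b x * fd f b x"
    by (simp add: m_al[symmetric] power2_eq_square mult_ac)
qed

text \<open>Duality: solving \<open>lap u = F - mean F\<close> turns the summed Bochner inequality into a Poincare inequality.\<close>
lemma poincare_of_gap:
  assumes lam: "\<kappa> > 0"
    and gap: "\<And>g. (\<And>x. g x \<ge> 0) \<Longrightarrow> (1 - \<eta>) * en g g + h^2 * (\<Sum>x\<in>X. m x * ((\<rho> x - \<eta>) * (g x)^2)) \<ge> \<kappa> * h^2 * (wsq g)"
  shows "\<kappa> * h^2 * (\<Sum>x\<in>X. m x * (F x - mean F)^2) \<le> (1 + \<eta>) * (wsq_grd F)"
proof -
  obtain u where u: "\<And>x. x \<in> X \<Longrightarrow> lap u x = F x - mean F"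
    using poisson_solvable[OF sum_centered[of F]] by blast
  have grd_lap: "grd (lap u) x = grd F x" for x
  proof -
    have "grd (lap u) x = grd (\<lambda>y. F y - mean F) x" by (rule grd_cong) (rule u)
    then show ?thesis by (simp add: grd_def fd_const)
  qed
  define U where "U = (wsq_grd u)"
  define W where "W = (wsq_grd F)"
  define t where "t = \<kappa> * h^2"
  have t: "t > 0" using lam h_pos by (simp add: t_def)
  \<comment> \<open>Young's inequality with weight \<open>t\<close>, so that \<open>U\<close> can be
    absorbed: together with the gap it yields \<open>t^2 * U \<le> W\<close>, and the mixed sum is
    then at most \<open>W / t\<close>.\<close>
  have cross: "t * (\<Sum>x\<in>X. m x * (norm (grd u x) * norm (grd F x))) \<le> (t^2 * U + W) / 2"
  proof -
    have "t * (m x * (norm (grd u x) * norm (grd F x))) \<le> (t^2 * (m x * (norm (grd u x))^2) + m x * (norm (grd F x))^2) / 2" for x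
    proof -
      have "0 \<le> m x * (t * norm (grd u x) - norm (grd F x))^2" using m_pos[of x] by simp
      then show ?thesis by (simp add: power2_eq_square algebra_simps)
    qed
    then show ?thesis
      unfolding U_def W_def sum_distrib_left sum.distrib[symmetric] sum_divide_distrib by (rule sum_mono)
  qed
  have "t * U \<le> (\<Sum>x\<in>X. m x * (grd u x \<bullet> grd (lap u) x))"
    using gap[of "\<lambda>y. norm (grd u y)"] bochner_summed[of u] by (simp add: t_def U_def)
  also have "\<dots> \<le> (\<Sum>x\<in>X. m x * (norm (grd u x) * norm (grd F x)))"
    unfolding grd_lap by (intro sum_mono mult_left_mono norm_cauchy_schwarz) (simp add: m_pos less_imp_le)
  finally have "t * (t * U) \<le> t * (\<Sum>x\<in>X. m x * (norm (grd u x) * norm (grd F x)))"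
    using t by simp
  then have UW: "t^2 * U \<le> W" using cross by (simp add: power2_eq_square)
  have "(\<Sum>x\<in>X. m x * (F x - mean F)^2) = (\<Sum>x\<in>X. m x * lap u x * (F x - mean F))"
    by (intro sum.cong refl) (simp add: u power2_eq_square)
  also have "\<dots> = en u (\<lambda>y. F y - mean F)" by (rule sum_by_parts)
  also have "\<dots> = en u F" by (simp add: en_def fd_const)
  also have "\<dots> \<le> (1 + \<eta>) * (\<Sum>x\<in>X. m x * (norm (grd u x) * norm (grd F x)))" by (rule en_le)
  finally have "t * (\<Sum>x\<in>X. m x * (F x - mean F)^2) \<le> t * ((1 + \<eta>) * (\<Sum>x\<in>X. m x * (norm (grd u x) * norm (grd F x))))"
    using t by simp
  also have "\<dots> = (1 + \<eta>) * (t * (\<Sum>x\<in>X. m x * (norm (grd u x) * norm (grd F x))))" by simp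
  also have "\<dots> \<le> (1 + \<eta>) * W"
    using cross UW eta by (intro mult_left_mono) auto
  finally show ?thesis by (simp add: t_def W_def)
qed

lemma rho_sum_ge: "(\<rho>0 - \<eta>) * (wsq g) \<le> (\<Sum>x\<in>X. m x * ((\<rho> x - \<eta>) * (g x)^2))"
  unfolding sum_distrib_left
proof (intro sum_mono)
  fix x assume "x \<in> X"
  then have "m x * ((\<rho>0 - \<eta>) * (g x)^2) \<le> m x * ((\<rho> x - \<eta>) * (g x)^2)"
    using rho_ge m_pos[of x] by (intro mult_left_mono mult_right_mono) auto
  then show "(\<rho>0 - \<eta>) * (m x * (g x)^2) \<le> m x * ((\<rho> x - \<eta>) * (g x)^2)" by (simp add: mult_ac)
qed

text \<open>The classical estimate, obtained by discarding the energy. It serves as a bootstrap: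
  \<open>covariance_osc\<close> applies it to bound the variance of \<open>g\<close>.\<close>

lemma poincare_lichnerowicz:
  "(\<rho>0 - \<eta>) * h^2 * (\<Sum>x\<in>X. m x * (F x - mean F)^2) \<le> (1 + \<eta>) * (wsq_grd F)"
proof (rule poincare_of_gap)
  fix g :: "'a \<Rightarrow> real"
  have "(1 - \<eta>) * en g g \<ge> 0" using eta en_nonneg[of g] by simp
  moreover have "h^2 * ((\<rho>0 - \<eta>) * (wsq g)) \<le> h^2 * (\<Sum>x\<in>X. m x * ((\<rho> x - \<eta>) * (g x)^2))"
    by (intro mult_left_mono rho_sum_ge) simp
  ultimately show "(1 - \<eta>) * en g g + h^2 * (\<Sum>x\<in>X. m x * ((\<rho> x - \<eta>) * (g x)^2)) \<ge> (\<rho>0 - \<eta>) * h^2 * (wsq g)"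
    by (simp add: mult_ac)
qed (use eta in simp)

text \<open>Dichotomy: if \<open>g\<close> has energy at least \<open>\<epsilon> h^2 \<Sum> m g^2\<close>, the energy alone provides the gain \<open>\<epsilon>\<close>; otherwise \<open>cov\<close> does.\<close>
lemma poincare_improved:
  assumes cov: "covariance_control \<epsilon> k" and mean: "mean \<rho> \<ge> \<rho>0 + \<epsilon> + k - \<delta>"
    and \<epsilon>: "\<epsilon> \<ge> 0" and \<delta>: "\<delta> \<ge> 0" and pos: "\<rho>0 + (1 - \<eta>) * \<epsilon> - \<eta> - \<delta> > 0"
  shows "(\<rho>0 + (1 - \<eta>) * \<epsilon> - \<eta> - \<delta>) * h^2 * (\<Sum>x\<in>X. m x * (F x - mean F)^2) \<le> (1 + \<eta>) * (wsq_grd F)"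
proof (rule poincare_of_gap[OF pos])
  fix g :: "'a \<Rightarrow> real" assume g: "\<And>x. g x \<ge> 0"
  let ?q = "wsq g"
  have q: "?q \<ge> 0" by (intro sum_nonneg) (simp add: m_pos less_imp_le)
  have e: "en g g \<ge> 0" by (rule en_nonneg)
  show "(1 - \<eta>) * en g g + h^2 * (\<Sum>x\<in>X. m x * ((\<rho> x - \<eta>) * (g x)^2)) \<ge> (\<rho>0 + (1 - \<eta>) * \<epsilon> - \<eta> - \<delta>) * h^2 * ?q"
  proof (cases "en g g \<ge> \<epsilon> * h^2 * ?q")
    case True
    have "(1 - \<eta>) * (\<epsilon> * h^2 * ?q) \<le> (1 - \<eta>) * en g g" using True eta by (intro mult_left_mono) auto
    moreover have "h^2 * ((\<rho>0 - \<eta>) * ?q) \<le> h^2 * (\<Sum>x\<in>X. m x * ((\<rho> x - \<eta>) * (g x)^2))"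
      by (intro mult_left_mono rho_sum_ge) simp
    moreover have "\<delta> * (h^2 * ?q) \<ge> 0" using \<delta> q by simp
    ultimately show ?thesis by (simp add: algebra_simps)
  next
    case False
    then have "?q > 0" using e q by (cases "?q = 0") auto
    then have "(mean \<rho> - k) * ?q \<le> (\<Sum>x\<in>X. m x * (\<rho> x * (g x)^2))"
      using cov g False by (simp add: covariance_control_def)
    moreover have "(\<rho>0 + \<epsilon> - \<delta>) * ?q \<le> (mean \<rho> - k) * ?q" using mean q by (intro mult_right_mono) auto
    ultimately have c: "(\<Sum>x\<in>X. m x * (\<rho> x * (g x)^2)) \<ge> (\<rho>0 + \<epsilon> - \<delta>) * ?q" by linarith
    have "(\<Sum>x\<in>X. m x * ((\<rho> x - \<eta>) * (g x)^2)) = (\<Sum>x\<in>X. m x * (\<rho> x * (g x)^2)) - \<eta> * ?q"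
      by (simp add: sum_distrib_left sum_subtractf[symmetric] algebra_simps)
    then have "h^2 * ((\<rho>0 + \<epsilon> - \<delta>) * ?q - \<eta> * ?q) \<le> h^2 * (\<Sum>x\<in>X. m x * ((\<rho> x - \<eta>) * (g x)^2))"
      using c by (intro mult_left_mono) auto
    moreover have "(1 - \<eta>) * en g g \<ge> 0" using eta e by simp
    moreover have "\<eta> * \<epsilon> * (h^2 * ?q) \<ge> 0" using eta \<epsilon> q by simp
    ultimately show ?thesis by (simp add: algebra_simps)
  qed
qed

text \<open>After rescaling \<open>g\<close> to mass 1 for the probability weights
  \<open>m / Z\<close>, the quantity \<open>1 - A^2\<close> is its variance, which
  \<open>poincare_lichnerowicz\<close> bounds in terms of the energy. The 2 in
  \<open>small_eta\<close> absorbs every occurrence of \<open>\<eta>\<close>, and the resulting loss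
  is \<open>sqrt (2 * K * \<epsilon>)\<close> for \<open>K = \<omega>^2 / \<rho>0\<close>.\<close>

lemma covariance_osc:
  assumes osc: "\<And>x. x \<in> X \<Longrightarrow> a \<le> \<rho> x" "\<And>x. x \<in> X \<Longrightarrow> \<rho> x \<le> a + \<omega>" and \<omega>: "\<omega> \<ge> 0" and \<epsilon>: "\<epsilon> \<ge> 0"
    and small_eta: "(1 + \<eta>) / ((1 - \<eta>) * (\<rho>0 - \<eta>)) \<le> 2 / \<rho>0"
  shows "covariance_control \<epsilon> (\<omega> * sqrt (2 * \<epsilon> / \<rho>0))"
  unfolding covariance_control_def
proof (intro allI impI)
  fix g :: "'a \<Rightarrow> real"
  assume q': "0 < (wsq g)" and small: "en g g \<le> \<epsilon> * h^2 * (wsq g)"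
  define q where "q = (wsq g)"
  have q: "q > 0" using q' by (simp add: q_def)
  define s where "s = sqrt (Z / q)"
  have s2: "s^2 = Z / q" using q Z_pos by (simp add: s_def)
  define A where "A = (\<Sum>x\<in>X. m x / Z * (s * g x))"
  have A: "A = s * mean g"
    by (simp add: A_def mean_def sum_distrib_left sum_divide_distrib mult_ac)
  have var: "(\<Sum>x\<in>X. m x * (g x - mean g)^2) = q - Z * (mean g)^2"
    by (simp add: sum_centered_square q_def)
  have "1 - A^2 = (q - Z * (mean g)^2) / q"
    using q by (simp add: A power_mult_distrib s2 field_simps)
  also have "\<dots> \<le> 2 * \<epsilon> / \<rho>0"
  proof -
    let ?v = "q - Z * (mean g)^2" and ?G = "wsq_grd g"
    have "(1 - \<eta>) * ((\<rho>0 - \<eta>) * h^2 * ?v) \<le> (1 - \<eta>) * ((1 + \<eta>) * ?G)"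
      using poincare_lichnerowicz[of g] eta unfolding var by (intro mult_left_mono) auto
    also have "\<dots> = (1 + \<eta>) * ((1 - \<eta>) * ?G)" by simp
    also have "\<dots> \<le> (1 + \<eta>) * (\<epsilon> * h^2 * q)"
      using en_ge[of g] small eta unfolding q_def by (intro mult_left_mono) auto
    finally have "h^2 * ((1 - \<eta>) * (\<rho>0 - \<eta>) * ?v) \<le> h^2 * ((1 + \<eta>) * \<epsilon> * q)" by (simp add: mult_ac)
    then have "(1 - \<eta>) * (\<rho>0 - \<eta>) * ?v \<le> (1 + \<eta>) * \<epsilon> * q" using h_pos by simp
    moreover have "(1 - \<eta>) * (\<rho>0 - \<eta>) > 0" using eta by simp
    moreover have "v / q \<le> (1 + \<eta>) / D * \<epsilon>" if "D * v \<le> (1 + \<eta>) * \<epsilon> * q" "D > 0" for D v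
      using q that by (simp add: field_simps)
    ultimately have "?v / q \<le> (1 + \<eta>) / ((1 - \<eta>) * (\<rho>0 - \<eta>)) * \<epsilon>" by blast
    also have "\<dots> \<le> 2 / \<rho>0 * \<epsilon>" using small_eta \<epsilon> by (rule mult_right_mono)
    finally show ?thesis by simp
  qed
  finally have A_le: "1 - A^2 \<le> 2 * \<epsilon> / \<rho>0" .
  have "(\<Sum>x\<in>X. m x / Z * \<rho> x) - (\<Sum>x\<in>X. m x / Z * \<rho> x * (s * g x)^2) \<le> \<omega> * sqrt (1 - A^2)"
    unfolding A_def
  proof (rule covariance_square_le_osc[OF _ _ _ osc \<omega>])
    show "(\<Sum>x\<in>X. m x / Z) = 1" using Z_pos by (simp add: Z_def sum_divide_distrib[symmetric])
    have "(\<Sum>x\<in>X. m x / Z * (s * g x)^2) = s^2 / Z * q"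
      by (simp add: q_def power_mult_distrib sum_distrib_left mult_ac)
    then show "(\<Sum>x\<in>X. m x / Z * (s * g x)^2) = 1" using q Z_pos by (simp add: s2)
  qed (use Z_pos m_pos in \<open>auto simp: less_imp_le\<close>)
  also have "\<dots> \<le> \<omega> * sqrt (2 * \<epsilon> / \<rho>0)" using A_le \<omega> by (intro mult_left_mono) auto
  also have "(\<Sum>x\<in>X. m x / Z * \<rho> x) = mean \<rho>" by (simp add: mean_def sum_divide_distrib)
  also have "(\<Sum>x\<in>X. m x / Z * \<rho> x * (s * g x)^2) = (\<Sum>x\<in>X. m x * (\<rho> x * (g x)^2)) / q"
    using q Z_pos by (simp add: power_mult_distrib s2 sum_divide_distrib mult_ac)
  finally show "(mean \<rho> - \<omega> * sqrt (2 * \<epsilon> / \<rho>0)) * (wsq g) \<le> (\<Sum>x\<in>X. m x * (\<rho> x * (g x)^2))"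
    using q by (simp add: field_simps q_def[symmetric])
qed

text \<open>Maximum principle: evaluate the Bochner inequality where \<open>norm (grd u x)\<close> is largest.\<close>
lemma gradient_bound:
  assumes B: "\<And>x. x \<in> X \<Longrightarrow> norm (grd (lap u) x) \<le> h^2 * (\<rho>0 - \<eta>) * B" and x: "x \<in> X"
  shows "norm (grd u x) \<le> B"
proof -
  let ?g = "\<lambda>y. norm (grd u y)"
  obtain z where z: "z \<in> X" and max: "\<And>y. y \<in> X \<Longrightarrow> ?g y \<le> ?g z"
  proof -
    have "finite (?g ` X)" "?g ` X \<noteq> {}" using finite_grid grid_nonempty by auto
    then have "Max (?g ` X) \<in> ?g ` X" by (rule Max_in)
    then obtain z where "z \<in> X" "?g z = Max (?g ` X)" by auto
    then show ?thesis using that finite_grid by (metis Max_ge finite_imageI imageI)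
  qed
  \<comment> \<open>At a maximum both differences have a sign, and across a face they are 0, so a
    maximum on the boundary needs no separate treatment.\<close>
  have lap0: "lap (\<lambda>y. (?g y)^2) z \<ge> 0"
    unfolding lap_def
  proof (intro sum_nonneg)
    fix b :: 'a assume "b \<in> Basis"
    have "fd (\<lambda>y. (?g y)^2) b (bwd b z) \<ge> 0" "fd (\<lambda>y. (?g y)^2) b z \<le> 0"
      using max z by (auto simp: fd_def intro!: power_mono)
    then show "0 \<le> be b z * fd (\<lambda>y. (?g y)^2) b (bwd b z) - al b z * fd (\<lambda>y. (?g y)^2) b z"
      using be_pos[of b z] al_pos[of b z] by (simp add: mult_nonneg_nonpos order_trans[OF mult_nonneg_nonpos])
  qed
  have "h^2 * (\<rho>0 - \<eta>) * (?g z)^2 \<le> h^2 * (\<rho> z - \<eta>) * (?g z)^2"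
    using rho_ge[OF z] by (intro mult_right_mono mult_left_mono) auto
  also have "\<dots> \<le> grd u z \<bullet> grd (lap u) z"
    using bochner_grid[OF z, of u] lap0 gam_nonneg[of ?g z] eta
    by (smt (verit) divide_nonneg_nonneg mult_nonneg_nonneg)
  also have "\<dots> \<le> ?g z * norm (grd (lap u) z)" by (rule norm_cauchy_schwarz)
  also have "\<dots> \<le> ?g z * (h^2 * (\<rho>0 - \<eta>) * B)" by (intro mult_left_mono B z) simp
  finally have "h^2 * (\<rho>0 - \<eta>) * (?g z * ?g z) \<le> h^2 * (\<rho>0 - \<eta>) * (?g z * B)"
    by (simp add: power2_eq_square mult_ac)
  then have "?g z * ?g z \<le> ?g z * B" using h_pos eta by simp
  moreover have "0 \<le> B"
  proof -
    have "0 \<le> h^2 * (\<rho>0 - \<eta>) * B" using B[OF z] norm_ge_zero order_trans by blast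
    moreover have "h^2 * (\<rho>0 - \<eta>) > 0" using h_pos eta by simp
    ultimately show ?thesis by (simp only: zero_le_mult_iff) linarith
  qed
  ultimately have "?g z \<le> B" by (cases "?g z = 0") auto
  then show ?thesis using max[OF x] by linarith
qed

text \<open>With \<open>lap u = s - mean s\<close>, summation by parts turns the covariance of
  \<open>s\<close> and the square of \<open>g\<close> into an energy pairing with \<open>u\<close>,
  and \<open>gradient_bound\<close> controls \<open>grd u\<close> uniformly. The function
  \<open>s\<close> stands for a smoothing of \<open>\<rho>\<close>; its distance
  \<open>\<sigma>\<close> is paid once in the sum and once in the mean. The term
  \<open>h * \<epsilon>\<close> is the defect of the discrete chain rule.\<close>

lemma covariance_lip:
  assumes \<epsilon>: "\<epsilon> \<ge> 0" and L: "\<And>x. x \<in> X \<Longrightarrow> norm (grd s x) \<le> h * L" "L \<ge> 0"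
    and s: "\<And>x. x \<in> X \<Longrightarrow> \<bar>\<rho> x - s x\<bar> \<le> \<sigma>"
  shows "covariance_control \<epsilon> (2 * \<sigma> + L / (\<rho>0 - \<eta>) * (2 * sqrt ((1 + \<eta>) * \<epsilon>) + h * \<epsilon>))"
  unfolding covariance_control_def
proof (intro allI impI)
  fix g :: "'a \<Rightarrow> real"
  assume q': "0 < (wsq g)" and small: "en g g \<le> \<epsilon> * h^2 * (wsq g)"
  define q where "q = (wsq g)"
  have q: "q > 0" using q' by (simp add: q_def)
  obtain u where u: "\<And>x. x \<in> X \<Longrightarrow> lap u x = s x - mean s"
    using poisson_solvable[OF sum_centered[of s]] by blast
  have grd_lap: "grd (lap u) x = grd s x" for x
  proof -
    have "grd (lap u) x = grd (\<lambda>y. s y - mean s) x" by (rule grd_cong) (rule u)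
    then show ?thesis by (simp add: grd_def fd_const)
  qed
  \<comment> \<open>\<open>grd s\<close> has size \<open>h * L\<close> whereas \<open>lap\<close>
    scales like \<open>h^2\<close>, hence the \<open>h\<close> in the denominator.\<close>
  define B where "B = L / (h * (\<rho>0 - \<eta>))"
  have B0: "B \<ge> 0" using L(2) h_pos eta by (simp add: B_def)
  have gu: "norm (grd u x) \<le> B" if "x \<in> X" for x
  proof (rule gradient_bound[OF _ that])
    fix y assume y: "y \<in> X"
    have "h^2 * (\<rho>0 - \<eta>) * B = h * L" using h_pos eta by (simp add: B_def power2_eq_square)
    then show "norm (grd (lap u) y) \<le> h^2 * (\<rho>0 - \<eta>) * B" using L(1)[OF y] by (simp add: grd_lap)
  qed
  define T where "T = (\<Sum>x\<in>X. m x * (s x - mean s) * (g x)^2)"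
  have T_eq: "T = en u (\<lambda>y. (g y)^2)"
    unfolding T_def sum_by_parts[symmetric] by (intro sum.cong refl) (simp add: u)
  define C where "C = (\<Sum>x\<in>X. \<Sum>b\<in>Basis. w b x * (\<bar>fd u b x\<bar> * \<bar>g x\<bar>) * \<bar>fd g b x\<bar>)"
  have T_le: "\<bar>T\<bar> \<le> 2 * C + B * en g g"
  proof -
    have "\<bar>T\<bar> \<le> (\<Sum>x\<in>X. \<Sum>b\<in>Basis. \<bar>w b x * fd u b x * fd (\<lambda>y. (g y)^2) b x\<bar>)"
      unfolding T_eq en_def by (rule order_trans[OF sum_abs sum_mono]) (rule sum_abs)
    also have "\<dots> \<le> (\<Sum>x\<in>X. \<Sum>b\<in>Basis. 2 * (w b x * (\<bar>fd u b x\<bar> * \<bar>g x\<bar>) * \<bar>fd g b x\<bar>) + B * (w b x * fd g b x * fd g b x))"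
    proof (intro sum_mono)
      fix x b :: 'a assume x: "x \<in> X" and b: "b \<in> Basis"
      have 1: "fd (\<lambda>y. (g y)^2) b x = fd g b x * (2 * g x + fd g b x)"
        by (simp add: fd_def power2_eq_square algebra_simps)
      have "\<bar>2 * g x + fd g b x\<bar> \<le> 2 * \<bar>g x\<bar> + \<bar>fd g b x\<bar>" by linarith
      then have "\<bar>w b x * fd u b x * fd (\<lambda>y. (g y)^2) b x\<bar> \<le> w b x * \<bar>fd u b x\<bar> * (\<bar>fd g b x\<bar> * (2 * \<bar>g x\<bar> + \<bar>fd g b x\<bar>))"
        unfolding 1 abs_mult using w_pos[of b x] by (intro mult_mono) auto
      also have "\<dots> = 2 * (w b x * (\<bar>fd u b x\<bar> * \<bar>g x\<bar>) * \<bar>fd g b x\<bar>) + \<bar>fd u b x\<bar> * (w b x * fd g b x * fd g b x)"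
        by (simp add: algebra_simps)
      also have "\<dots> \<le> 2 * (w b x * (\<bar>fd u b x\<bar> * \<bar>g x\<bar>) * \<bar>fd g b x\<bar>) + B * (w b x * fd g b x * fd g b x)"
        using abs_fd_le_norm_grd[OF b, of u x] gu[OF x] w_pos[of b x]
        by (intro add_left_mono mult_right_mono) (auto simp: mult.assoc)
      finally show "\<bar>w b x * fd u b x * fd (\<lambda>y. (g y)^2) b x\<bar> \<le> \<dots>" .
    qed
    also have "\<dots> = 2 * C + B * en g g"
      by (simp add: C_def en_def sum.distrib sum_distrib_left)
    finally show ?thesis .
  qed
  have "C^2 \<le> ((1 + \<eta>) * B^2 * q) * (\<epsilon> * h^2 * q)"
  proof -
    \<comment> \<open>The double sum is flattened to a sum over edges so that Cauchy-Schwarz applies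
      once, to all of them.\<close>
    have "C = (\<Sum>p\<in>X \<times> Basis. w (snd p) (fst p) * (\<bar>fd u (snd p) (fst p)\<bar> * \<bar>g (fst p)\<bar>) * \<bar>fd g (snd p) (fst p)\<bar>)"
      unfolding C_def by (simp add: sum.cartesian_product case_prod_unfold)
    then have "C^2 \<le> (\<Sum>p\<in>X \<times> Basis. w (snd p) (fst p) * (\<bar>fd u (snd p) (fst p)\<bar> * \<bar>g (fst p)\<bar>)^2)
        * (\<Sum>p\<in>X \<times> Basis. w (snd p) (fst p) * \<bar>fd g (snd p) (fst p)\<bar>^2)"
      by (simp only:) (rule weighted_Cauchy_Schwarz, simp add: w_pos less_imp_le)
    also have "(\<Sum>p\<in>X \<times> Basis. w (snd p) (fst p) * \<bar>fd g (snd p) (fst p)\<bar>^2) = en g g"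
      by (simp add: en_def sum.cartesian_product case_prod_unfold power2_eq_square mult.assoc)
    also have "(\<Sum>p\<in>X \<times> Basis. w (snd p) (fst p) * (\<bar>fd u (snd p) (fst p)\<bar> * \<bar>g (fst p)\<bar>)^2)
      = (\<Sum>x\<in>X. \<Sum>b\<in>Basis. w b x * (fd u b x)^2 * (g x)^2)"
      by (simp add: sum.cartesian_product case_prod_unfold power_mult_distrib mult.assoc)
    also have "\<dots> * en g g \<le> ((1 + \<eta>) * B^2 * q) * (\<epsilon> * h^2 * q)"
    proof (rule mult_mono)
      have "(\<Sum>b\<in>Basis. w b x * (fd u b x)^2 * (g x)^2) \<le> (1 + \<eta>) * B^2 * (m x * (g x)^2)" if x: "x \<in> X" for x
      proof -
        have "(\<Sum>b\<in>Basis. w b x * (fd u b x)^2 * (g x)^2) \<le> (\<Sum>b\<in>Basis. ((1 + \<eta>) * m x) * (fd u b x)^2 * (g x)^2)"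
          unfolding m_al[symmetric] using al_le[OF x] m_pos[of x]
          by (intro sum_mono mult_right_mono) (auto simp: mult.commute)
        also have "\<dots> = (1 + \<eta>) * m x * (norm (grd u x))^2 * (g x)^2"
          unfolding grd_norm by (simp add: sum_distrib_left sum_distrib_right)
        also have "\<dots> \<le> (1 + \<eta>) * m x * B^2 * (g x)^2"
          using gu[OF x] eta m_pos[of x] by (intro mult_right_mono mult_left_mono power_mono) auto
        finally show ?thesis by (simp add: mult_ac)
      qed
      then show "(\<Sum>x\<in>X. \<Sum>b\<in>Basis. w b x * (fd u b x)^2 * (g x)^2) \<le> (1 + \<eta>) * B^2 * q"
        unfolding q_def sum_distrib_left[of _ _ X] by (rule sum_mono)
    qed (use small q_def en_nonneg eta q in \<open>auto\<close>)
    finally show ?thesis .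
  qed
  also have "\<dots> = (B * h * q)^2 * ((1 + \<eta>) * \<epsilon>)" by (simp add: power2_eq_square mult_ac)
  finally have "C \<le> sqrt ((B * h * q)^2 * ((1 + \<eta>) * \<epsilon>))" by (rule real_le_rsqrt)
  then have "C \<le> B * h * q * sqrt ((1 + \<eta>) * \<epsilon>)"
    using B0 h_pos q by (simp add: real_sqrt_mult)
  moreover have "B * en g g \<le> B * (\<epsilon> * h^2 * q)" using small B0 by (intro mult_left_mono) (auto simp: q_def)
  ultimately have "\<bar>T\<bar> \<le> 2 * (B * h * q * sqrt ((1 + \<eta>) * \<epsilon>)) + B * (\<epsilon> * h^2 * q)" using T_le by linarith
  also have "\<dots> = (B * h) * (2 * sqrt ((1 + \<eta>) * \<epsilon>) + h * \<epsilon>) * q"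
    by (simp add: algebra_simps power2_eq_square)
  also have "B * h = L / (\<rho>0 - \<eta>)" using h_pos by (simp add: B_def)
  finally have T_abs: "\<bar>T\<bar> \<le> L / (\<rho>0 - \<eta>) * (2 * sqrt ((1 + \<eta>) * \<epsilon>) + h * \<epsilon>) * q" .
  have "(\<Sum>x\<in>X. m x * (\<rho> x * (g x)^2)) \<ge> (\<Sum>x\<in>X. m x * ((s x - \<sigma>) * (g x)^2))"
  proof (intro sum_mono mult_left_mono mult_right_mono)
    show "s x - \<sigma> \<le> \<rho> x" if "x \<in> X" for x using s[OF that] by linarith
  qed (simp_all add: m_pos less_imp_le)
  moreover have "(\<Sum>x\<in>X. m x * ((s x - \<sigma>) * (g x)^2)) = T + (mean s - \<sigma>) * q"
    unfolding T_def q_def sum_distrib_left sum.distrib[symmetric]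
    by (intro sum.cong refl) (simp add: algebra_simps)
  moreover have "mean \<rho> \<le> mean s + \<sigma>"
  proof -
    have "(\<Sum>x\<in>X. m x * \<rho> x) \<le> (\<Sum>x\<in>X. m x * (s x + \<sigma>))"
    proof (intro sum_mono mult_left_mono)
      show "\<rho> x \<le> s x + \<sigma>" if "x \<in> X" for x using s[OF that] by linarith
    qed (simp add: m_pos less_imp_le)
    also have "\<dots> = (\<Sum>x\<in>X. m x * s x) + Z * \<sigma>"
      by (simp add: Z_def distrib_left sum.distrib sum_distrib_right)
    finally show ?thesis using Z_pos by (simp add: mean_def field_simps)
  qed
  then have "(mean \<rho> - 2 * \<sigma>) * q \<le> (mean s - \<sigma>) * q" using q by (intro mult_right_mono) auto
  ultimately show "(mean \<rho> - (2 * \<sigma> + L / (\<rho>0 - \<eta>) * (2 * sqrt ((1 + \<eta>) * \<epsilon>) + h * \<epsilon>))) * (wsq g)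
      \<le> (\<Sum>x\<in>X. m x * (\<rho> x * (g x)^2))"
    using T_abs unfolding q_def[symmetric] by (simp add: left_diff_distrib distrib_right abs_le_iff)
qed

end

section \<open>Cubic grids and Riemann sums\<close>

text \<open>The points are the lower corners of the cells tiling the half-open
  \<open>cube R\<close>; hence \<open>k = - N\<close> is included and \<open>k = N\<close> is
  not.\<close>

definition cube_grid :: "real \<Rightarrow> nat \<Rightarrow> 'a::euclidean_space set" where
  "cube_grid R N = {x. \<forall>b\<in>Basis. \<exists>k::int. - int N \<le> k \<and> k < int N \<and> x \<bullet> b = R / N * k}"

lemma cube_grid_eq_image:
  "cube_grid R N = (\<lambda>k. \<Sum>b\<in>Basis. (R / N * of_int (k b)) *\<^sub>R b) ` (Basis \<rightarrow>\<^sub>E {- int N..<int N})"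
proof (intro equalityI subsetI)
  fix x :: 'a assume "x \<in> cube_grid R N"
  then have "\<forall>b\<in>Basis. \<exists>k::int. - int N \<le> k \<and> k < int N \<and> x \<bullet> b = R / N * k"
    by (simp add: cube_grid_def)
  then obtain k :: "'a \<Rightarrow> int" where k: "\<And>b. b \<in> Basis \<Longrightarrow> - int N \<le> k b \<and> k b < int N \<and> x \<bullet> b = R / N * k b"
    by (metis (no_types))
  have "x = (\<Sum>b\<in>Basis. (x \<bullet> b) *\<^sub>R b)" by (simp add: euclidean_representation)
  also have "\<dots> = (\<Sum>b\<in>Basis. (R / N * of_int (restrict k Basis b)) *\<^sub>R b)"
    by (intro sum.cong refl) (simp add: k)
  finally show "x \<in> (\<lambda>k. \<Sum>b\<in>Basis. (R / N * of_int (k b)) *\<^sub>R b) ` (Basis \<rightarrow>\<^sub>E {- int N..<int N})"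
    using k by (intro image_eqI[where x = "restrict k Basis"]) auto
next
  fix x :: 'a assume "x \<in> (\<lambda>k. \<Sum>b\<in>Basis. (R / N * of_int (k b)) *\<^sub>R b) ` (Basis \<rightarrow>\<^sub>E {- int N..<int N})"
  then obtain k where k: "k \<in> Basis \<rightarrow>\<^sub>E {- int N..<int N}" and x: "x = (\<Sum>b\<in>Basis. (R / N * of_int (k b)) *\<^sub>R b)" by blast
  have "x \<bullet> b = R / N * of_int (k b)" if "b \<in> Basis" for b
    using that unfolding x by simp
  moreover have "- int N \<le> k b \<and> k b < int N" if "b \<in> Basis" for b
    using k that by (auto simp: PiE_iff)
  ultimately show "x \<in> cube_grid R N" unfolding cube_grid_def by blast
qed

lemma finite_cube_grid: "finite (cube_grid R N :: 'a::euclidean_space set)"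
  unfolding cube_grid_eq_image by (intro finite_imageI finite_PiE) auto

lemma cube_grid_shift_iff:
  fixes x i j :: "'a::euclidean_space"
  assumes "i \<in> Basis" "j \<in> Basis" "i \<noteq> j" "x \<in> cube_grid R N" "x + t *\<^sub>R j \<in> cube_grid R N"
  shows "x + t *\<^sub>R j + s *\<^sub>R i \<in> cube_grid R N \<longleftrightarrow> x + s *\<^sub>R i \<in> cube_grid R N"
proof -
  define C where "C = (\<lambda>t::real. \<exists>k::int. - int N \<le> k \<and> k < int N \<and> t = R / N * k)"
  have mem: "y \<in> cube_grid R N \<longleftrightarrow> (\<forall>b\<in>Basis. C (y \<bullet> b))" for y :: 'a
    by (simp add: cube_grid_def C_def)
  have "y + s *\<^sub>R i \<in> cube_grid R N \<longleftrightarrow> C (y \<bullet> i + s)" if "y \<in> cube_grid R N" for y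
  proof -
    have "(y + s *\<^sub>R i) \<bullet> b = (if b = i then y \<bullet> i + s else y \<bullet> b)" if "b \<in> Basis" for b
      using that assms(1) by (auto simp: inner_add_left inner_Basis)
    then show ?thesis using that assms(1) unfolding mem by auto
  qed
  moreover have "(x + t *\<^sub>R j) \<bullet> i = x \<bullet> i"
    using assms(1-3) by (simp add: inner_add_left inner_Basis)
  ultimately show ?thesis using assms(4,5) by simp
qed

lemma box_grid_cube_grid:
  assumes R: "R > 0" and N: "N > 0"
  shows "box_grid (cube_grid R N :: 'a::euclidean_space set) (R / N)"
proof
  show "finite (cube_grid R N :: 'a set)" by (rule finite_cube_grid)
  show "cube_grid R N \<noteq> ({} :: 'a set)"
    using N by (auto simp: cube_grid_eq_image PiE_eq_empty_iff)
  show "0 < R / N" using R N by simp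
next
  fix x i j :: 'a
  assume *: "i \<in> Basis" "j \<in> Basis" "i \<noteq> j" "x \<in> cube_grid R N" "x + (R / N) *\<^sub>R j \<in> cube_grid R N"
  show "x + (R / N) *\<^sub>R j + (R / N) *\<^sub>R i \<in> cube_grid R N \<longleftrightarrow> x + (R / N) *\<^sub>R i \<in> cube_grid R N"
    by (rule cube_grid_shift_iff[OF *])
  show "x + (R / N) *\<^sub>R j - (R / N) *\<^sub>R i \<in> cube_grid R N \<longleftrightarrow> x - (R / N) *\<^sub>R i \<in> cube_grid R N"
    using cube_grid_shift_iff[OF *, of "- (R / N)"] by simp
next
  fix u :: "'a \<Rightarrow> real" and x y :: 'a
  assume const: "\<And>b z. b \<in> Basis \<Longrightarrow> z \<in> cube_grid R N \<Longrightarrow> z + (R / N) *\<^sub>R b \<in> cube_grid R N \<Longrightarrow> u (z + (R / N) *\<^sub>R b) = u z"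
    and xy: "x \<in> cube_grid R N" "y \<in> cube_grid R N"
  define pt :: "('a \<Rightarrow> int) \<Rightarrow> 'a" where "pt = (\<lambda>k. \<Sum>b\<in>Basis. (R / N * of_int (k b)) *\<^sub>R b)"
  have pt_in: "pt k \<in> cube_grid R N" if "\<And>b. b \<in> Basis \<Longrightarrow> - int N \<le> k b \<and> k b < int N" for k
  proof -
    have "pt k = pt (restrict k Basis)" by (simp add: pt_def)
    then show ?thesis unfolding cube_grid_eq_image pt_def using that
      by (intro image_eqI[where x = "restrict k Basis"]) auto
  qed
  \<comment> \<open>Each point is joined to the lowest corner by decreasing one coordinate at a
    time; the induction is on the number of such moves.\<close>
  have base: "u (pt k) = u (pt (\<lambda>_. - int N))" if "\<And>b. b \<in> Basis \<Longrightarrow> - int N \<le> k b \<and> k b < int N" for k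
    using that
  proof (induction "\<Sum>b\<in>Basis. nat (k b + int N)" arbitrary: k rule: less_induct)
    case less
    show ?case
    proof (cases "\<forall>b\<in>Basis. k b = - int N")
      case True
      then show ?thesis by (simp add: pt_def)
    next
      case False
      then obtain b where b: "b \<in> Basis" "k b \<noteq> - int N" by blast
      define k' where "k' = k(b := k b - 1)"
      have k': "- int N \<le> k' c \<and> k' c < int N" if "c \<in> Basis" for c
        using less.prems[OF that] b(2) by (auto simp: k'_def)
      have "(\<Sum>c\<in>Basis. nat (k' c + int N)) < (\<Sum>c\<in>Basis. nat (k c + int N))"
      proof (rule sum_strict_mono_ex1)
        show "\<exists>a\<in>Basis. nat (k' a + int N) < nat (k a + int N)"
          using b less.prems[OF b(1)] by (intro bexI[of _ b]) (auto simp: k'_def)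
      qed (auto simp: k'_def)
      then have IH: "u (pt k') = u (pt (\<lambda>_. - int N))" using less.hyps k' by blast
      have "pt k = pt k' + (R / N) *\<^sub>R b"
      proof -
        have "(a * of_int i) *\<^sub>R b - (a * of_int (i - 1)) *\<^sub>R b = a *\<^sub>R b" for a :: real and i :: int
          unfolding scaleR_left_diff_distrib[symmetric] by (simp add: right_diff_distrib)
        then have "pt k - pt k' = (\<Sum>c\<in>Basis. (if c = b then (R / N) *\<^sub>R b else 0))"
          unfolding pt_def sum_subtractf[symmetric]
          by (intro sum.cong refl) (auto simp: k'_def simp del: times_divide_eq_left)
        then show ?thesis using b(1) by (simp add: algebra_simps)
      qed
      then have "u (pt k) = u (pt k')"
      proof -
        have "pt k' \<in> cube_grid R N" by (rule pt_in) (rule k')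
        moreover have "pt k \<in> cube_grid R N" by (rule pt_in) (rule less.prems)
        ultimately show ?thesis using const[OF b(1)] \<open>pt k = pt k' + (R / N) *\<^sub>R b\<close> by metis
      qed
      then show ?thesis using IH by simp
    qed
  qed
  have "u z = u (pt (\<lambda>_. - int N))" if z: "z \<in> cube_grid R N" for z
  proof -
    obtain k where k: "k \<in> Basis \<rightarrow>\<^sub>E {- int N..<int N}" "z = pt k"
      using z unfolding cube_grid_eq_image pt_def by blast
    show ?thesis unfolding k(2) by (rule base) (use k(1) in \<open>auto simp: PiE_iff\<close>)
  qed
  then show "u x = u y" using xy by simp
qed

lemma norm_cube_grid:
  fixes x :: "'a::euclidean_space" and R :: real
  assumes "x \<in> cube_grid R N" "R \<ge> 0" shows "norm x \<le> DIM('a) * R"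
proof -
  have "\<bar>x \<bullet> b\<bar> \<le> R" if b: "b \<in> Basis" for b
  proof -
    obtain k :: int where k: "- int N \<le> k" "k < int N" "x \<bullet> b = R / N * k"
      using assms b unfolding cube_grid_def by blast
    have "\<bar>x \<bullet> b\<bar> = R * (\<bar>of_int k\<bar> / N)" using assms(2) unfolding k(3) by (simp add: abs_mult)
    also have "\<bar>real_of_int k\<bar> \<le> real N" using k by linarith
    then have "R * (\<bar>of_int k\<bar> / N) \<le> R * 1" using assms(2) k by (intro mult_left_mono) (auto simp: field_simps)
    finally show ?thesis by simp
  qed
  then have "(\<Sum>b\<in>Basis. \<bar>x \<bullet> b\<bar>) \<le> (\<Sum>b\<in>(Basis::'a set). R)" by (intro sum_mono)
  then show ?thesis using norm_le_l1[of x] by simp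
qed

section \<open>Half-open cubes and convergence of Riemann sums\<close>

definition cube :: "real \<Rightarrow> 'a::euclidean_space set" where
  "cube R = {y. \<forall>b\<in>Basis. - R \<le> y \<bullet> b \<and> y \<bullet> b < R}"

lemma cube_borel [measurable]: "cube R \<in> sets (borel :: 'a::euclidean_space measure)"
  unfolding cube_def by measurable

lemma half_open_box_measure:
  fixes x :: "'a::euclidean_space"
  assumes h: "h \<ge> 0"
  defines "C \<equiv> {y. \<forall>b\<in>Basis. x \<bullet> b \<le> y \<bullet> b \<and> y \<bullet> b < x \<bullet> b + h}"
  shows "C \<in> sets borel" "emeasure lborel C = ennreal (h ^ DIM('a))"
proof -
  show C: "C \<in> sets borel" unfolding C_def by measurable
  have "ennreal (\<Prod>b\<in>(Basis::'a set). ((x + h *\<^sub>R One) - x) \<bullet> b) = ennreal (h ^ DIM('a))" by (simp add: inner_Basis)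
  moreover have "emeasure lborel (box x (x + h *\<^sub>R One)) = ennreal (\<Prod>b\<in>(Basis::'a set). ((x + h *\<^sub>R One) - x) \<bullet> b)"
    by (rule emeasure_lborel_box) (use h in \<open>simp add: inner_add_left\<close>)
  moreover have "emeasure lborel (cbox x (x + h *\<^sub>R One)) = ennreal (\<Prod>b\<in>(Basis::'a set). ((x + h *\<^sub>R One) - x) \<bullet> b)"
    by (rule emeasure_lborel_cbox) (use h in \<open>simp add: inner_add_left\<close>)
  moreover have "emeasure lborel (box x (x + h *\<^sub>R One)) \<le> emeasure lborel C"
    by (rule emeasure_mono) (use C in \<open>auto simp: C_def box_def inner_add_left less_imp_le\<close>)
  moreover have "emeasure lborel C \<le> emeasure lborel (cbox x (x + h *\<^sub>R One))"
    by (rule emeasure_mono) (auto simp: C_def cbox_def inner_add_left less_imp_le)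
  ultimately show "emeasure lborel C = ennreal (h ^ DIM('a))" by simp
qed

text \<open>The Riemann sum is the integral of \<open>\<phi>\<close> composed with
  \<open>p N\<close>, which rounds every coordinate down to the grid. Rounding converges pointwise
  and \<open>\<phi>\<close> is bounded on a ball containing all the grids, so dominated convergence
  applies.\<close>

lemma riemann_sum_tendsto:
  fixes \<phi> :: "'a::euclidean_space \<Rightarrow> real"
  assumes cont: "continuous_on UNIV \<phi>" and R: "R > 0"
  shows "(\<lambda>N. (R / N) ^ DIM('a) * (\<Sum>x\<in>cube_grid R N. \<phi> x)) \<longlonglongrightarrow> (\<integral>y. indicator (cube R) y * \<phi> y \<partial>lborel)"
proof -
  define p :: "nat \<Rightarrow> 'a \<Rightarrow> 'a" where "p = (\<lambda>N y. \<Sum>b\<in>Basis. (R / N * of_int \<lfloor>(y \<bullet> b) / (R / N)\<rfloor>) *\<^sub>R b)"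
  define cell :: "nat \<Rightarrow> 'a \<Rightarrow> 'a set" where
    "cell = (\<lambda>N x. {y. \<forall>b\<in>Basis. x \<bullet> b \<le> y \<bullet> b \<and> y \<bullet> b < x \<bullet> b + R / N})"
  have p_inner: "p N y \<bullet> b = R / N * of_int \<lfloor>(y \<bullet> b) / (R / N)\<rfloor>" if "b \<in> Basis" for N y b
    using that by (simp add: p_def)
  have p_bounds: "p N y \<bullet> b \<le> y \<bullet> b" "y \<bullet> b < p N y \<bullet> b + R / N" if N: "N > 0" and b: "b \<in> Basis" for N y b
  proof -
    let ?h = "R / N"
    have h: "?h > 0" using R N by simp
    have "of_int \<lfloor>(y \<bullet> b) / ?h\<rfloor> * ?h \<le> y \<bullet> b"
      using of_int_floor_le[of "(y \<bullet> b) / ?h"] by (simp only: pos_le_divide_eq[OF h])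
    then show "p N y \<bullet> b \<le> y \<bullet> b" unfolding p_inner[OF b] by (simp only: mult.commute)
    have "y \<bullet> b / ?h < of_int \<lfloor>(y \<bullet> b) / ?h\<rfloor> + 1" by linarith
    then have "y \<bullet> b < (of_int \<lfloor>(y \<bullet> b) / ?h\<rfloor> + 1) * ?h" by (simp only: pos_divide_less_eq[OF h])
    then show "y \<bullet> b < p N y \<bullet> b + ?h" unfolding p_inner[OF b] by (simp only: mult.commute[of _ "?h"] distrib_left mult_1_right)
  qed
  have p_grid: "p N y \<in> cube_grid R N" if N: "N > 0" and y: "y \<in> cube R" for N y
    unfolding cube_grid_def
  proof (intro CollectI ballI exI conjI)
    fix b :: 'a assume b: "b \<in> Basis"
    show "p N y \<bullet> b = R / N * of_int \<lfloor>(y \<bullet> b) / (R / N)\<rfloor>" by (rule p_inner[OF b])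
    have "- R \<le> y \<bullet> b" "y \<bullet> b < R" using y b by (auto simp: cube_def)
    moreover have h: "R / N > 0" using R N by simp
    ultimately have "- real N \<le> y \<bullet> b / (R / N)" "y \<bullet> b / (R / N) < real N"
      using N by (simp_all only: pos_le_divide_eq[OF h] pos_divide_less_eq[OF h]) simp_all
    then show "- int N \<le> \<lfloor>(y \<bullet> b) / (R / N)\<rfloor>" "\<lfloor>(y \<bullet> b) / (R / N)\<rfloor> < int N"
      by (simp_all add: le_floor_iff floor_less_iff)
  qed
  have cell_cube: "y \<in> cube R" if N: "N > 0" and x: "x \<in> cube_grid R N" and yc: "y \<in> cell N x" for N x y
    unfolding cube_def
  proof (intro CollectI ballI)
    fix b :: 'a assume b: "b \<in> Basis"
    obtain k :: int where k: "- int N \<le> k" "k < int N" "x \<bullet> b = R / N * k" using x b unfolding cube_grid_def by blast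
    have y: "x \<bullet> b \<le> y \<bullet> b" "y \<bullet> b < x \<bullet> b + R / N" using yc b by (auto simp: cell_def)
    have "- real N \<le> of_int k" "of_int k + 1 \<le> real N" using k by linarith+
    then have "R / N * (- real N) \<le> R / N * of_int k" "R / N * (of_int k + 1) \<le> R / N * real N"
      using R by (simp_all only: mult_left_mono[OF _ divide_nonneg_nonneg[OF less_imp_le of_nat_0_le_iff]])
    then show "- R \<le> y \<bullet> b \<and> y \<bullet> b < R" using y k(3) N by (auto simp: distrib_left)
  qed
  have cell_unique: "x = p N y" if N: "N > 0" and x: "x \<in> cube_grid R N" and y: "y \<in> cell N x" for N x y
  proof (rule euclidean_eqI)
    fix b :: 'a assume b: "b \<in> Basis"
    obtain k :: int where k: "x \<bullet> b = R / N * k" using x b unfolding cube_grid_def by blast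
    have y: "x \<bullet> b \<le> y \<bullet> b" "y \<bullet> b < x \<bullet> b + R / N" using y b by (auto simp: cell_def)
    have "\<lfloor>(y \<bullet> b) / (R / N)\<rfloor> = k"
      using y R N unfolding k by (intro floor_unique) (simp_all add: field_simps)
    then show "x \<bullet> b = p N y \<bullet> b" using k b by (simp add: p_inner)
  qed
  have sum_eq: "(\<Sum>x\<in>cube_grid R N. \<phi> x * indicator (cell N x) y) = indicator (cube R) y * \<phi> (p N y)" if N: "N > 0" for N y
  proof (cases "y \<in> cube R")
    case True
    have "(\<Sum>x\<in>cube_grid R N. \<phi> x * indicator (cell N x) y) = (\<Sum>x\<in>cube_grid R N. if x = p N y then \<phi> x else 0)"
    proof (intro sum.cong refl)
      fix x :: 'a assume "x \<in> cube_grid R N"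
      then show "\<phi> x * indicator (cell N x) y = (if x = p N y then \<phi> x else 0)"
      proof (cases "y \<in> cell N x")
        case False
        have "y \<in> cell N (p N y)" using p_bounds[OF N] by (simp add: cell_def)
        then show ?thesis using False by auto
      qed (use cell_unique[OF N] \<open>x \<in> cube_grid R N\<close> in simp)
    qed
    then show ?thesis using p_grid[OF N True] True by (simp add: finite_cube_grid)
  next
    case False
    then have "\<phi> x * indicator (cell N x) y = 0" if "x \<in> cube_grid R N" for x
      using cell_cube[OF N that] by (auto simp: indicator_def)
    then have "(\<Sum>x\<in>cube_grid R N. \<phi> x * indicator (cell N x) y) = 0" by (intro sum.neutral ballI)
    then show ?thesis using False by simp
  qed
  have int_eq: "(\<integral>y. indicator (cube R) y * \<phi> (p N y) \<partial>lborel) = (R / N) ^ DIM('a) * (\<Sum>x\<in>cube_grid R N. \<phi> x)" 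
    and meas: "(\<lambda>y. indicator (cube R) y * \<phi> (p N y)) \<in> borel_measurable lborel" if N: "N > 0" for N
  proof -
    have h: "R / N \<ge> 0" using R by simp
    have cb: "cell N x \<in> sets borel" and ce: "emeasure lborel (cell N x) = ennreal ((R / N) ^ DIM('a))" for x :: 'a
      unfolding cell_def by (rule half_open_box_measure[OF h])+
    have int1: "integrable lborel (\<lambda>y. \<phi> x * indicator (cell N x) y)" for x
      by (intro integrable_mult_right integrable_real_indicator) (simp_all add: cb ce)
    have "(\<integral>y. (\<Sum>x\<in>cube_grid R N. \<phi> x * indicator (cell N x) y) \<partial>lborel) = (\<Sum>x\<in>cube_grid R N. \<integral>y. \<phi> x * indicator (cell N x) y \<partial>lborel)"
      by (rule Bochner_Integration.integral_sum) (rule int1)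
    also have "\<dots> = (\<Sum>x\<in>cube_grid R N. \<phi> x * (R / N) ^ DIM('a))"
      using R by (intro sum.cong refl) (simp add: cb measure_def ce)
    finally show "(\<integral>y. indicator (cube R) y * \<phi> (p N y) \<partial>lborel) = (R / N) ^ DIM('a) * (\<Sum>x\<in>cube_grid R N. \<phi> x)"
      unfolding sum_eq[OF N] sum_distrib_right[symmetric] by (simp only: mult.commute)
    have "(\<lambda>y. \<Sum>x\<in>cube_grid R N. \<phi> x * indicator (cell N x) y) \<in> borel_measurable lborel"
      by (intro borel_measurable_sum borel_measurable_integrable int1)
    then show "(\<lambda>y. indicator (cube R) y * \<phi> (p N y)) \<in> borel_measurable lborel" unfolding sum_eq[OF N] .
  qed
  have p_lim: "(\<lambda>N. p N y) \<longlonglongrightarrow> y" for y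
  proof (rule Lim_null_comparison[THEN LIM_zero_cancel])
    show "\<forall>\<^sub>F N in sequentially. norm (p N y - y) \<le> DIM('a) * (R / real N)"
      using eventually_gt_at_top[of 0]
    proof eventually_elim
      case (elim N)
      have "norm (p N y - y) \<le> (\<Sum>b\<in>Basis. \<bar>(p N y - y) \<bullet> b\<bar>)" by (rule norm_le_l1)
      also have "\<dots> \<le> (\<Sum>b\<in>(Basis::'a set). R / N)"
      proof (intro sum_mono)
        fix b :: 'a assume "b \<in> Basis"
        then show "\<bar>(p N y - y) \<bullet> b\<bar> \<le> R / N"
          using p_bounds[OF elim, of b y] by (simp add: inner_diff_left)
      qed
      finally show ?case by simp
    qed
    show "(\<lambda>N. DIM('a) * (R / real N)) \<longlonglongrightarrow> 0"
      using tendsto_mult_right_zero[OF lim_const_over_n[of R], of "real DIM('a)"] by simp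
  qed
  obtain B where B: "\<And>z. z \<in> cball 0 (DIM('a) * R) \<Longrightarrow> norm (\<phi> z) \<le> B"
    using compact_imp_bounded[OF compact_continuous_image[OF continuous_on_subset[OF cont] compact_cball]]
    unfolding bounded_iff by (metis imageI subset_UNIV)
  have cube_int: "integrable lborel (\<lambda>y::'a. B * indicator (cube R) y :: real)"
  proof (intro integrable_mult_right integrable_real_indicator)
    have "cube R = {y::'a. \<forall>b\<in>Basis. (- R *\<^sub>R One) \<bullet> b \<le> y \<bullet> b \<and> y \<bullet> b < (- R *\<^sub>R One) \<bullet> b + 2 * R}"
      by (auto simp: cube_def)
    then show "emeasure lborel (cube R :: 'a set) < \<infinity>"
      using half_open_box_measure(2)[of "2 * R" "- R *\<^sub>R One :: 'a"] R by (simp add: less_top[symmetric])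
  qed simp
  \<comment> \<open>Dominated convergence asks for measurability and the bound at every
    \<open>N\<close>; the guard covers \<open>N = 0\<close>, where the mesh \<open>R / N\<close>
    degenerates to 0.\<close>
  have "(\<lambda>N. \<integral>y. (if N = 0 then 0 else indicator (cube R) y * \<phi> (p N y)) \<partial>lborel) \<longlonglongrightarrow> (\<integral>y. indicator (cube R) y * \<phi> y \<partial>lborel)"
  proof (rule integral_dominated_convergence[where w = "\<lambda>y. B * indicator (cube R) y"])
    show "(\<lambda>y. indicator (cube R) y * \<phi> y) \<in> borel_measurable lborel"
      using borel_measurable_continuous_onI[OF cont] by simp
    show "(\<lambda>y. if N = 0 then 0 else indicator (cube R) y * \<phi> (p N y)) \<in> borel_measurable lborel" for N
      using meas[of N] by (cases "N = 0") auto
    show "AE y in lborel. (\<lambda>N. if N = 0 then 0 else indicator (cube R) y * \<phi> (p N y)) \<longlonglongrightarrow> indicator (cube R) y * \<phi> y"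
    proof (rule AE_I2)
      fix y :: 'a
      have "isCont \<phi> y" using cont by (simp add: continuous_on_eq_continuous_at)
      then have "(\<lambda>N. indicator (cube R) y * \<phi> (p N y)) \<longlonglongrightarrow> indicator (cube R) y * \<phi> y"
        by (intro tendsto_mult_left isCont_tendsto_compose[OF _ p_lim])
      then show "(\<lambda>N. if N = 0 then 0 else indicator (cube R) y * \<phi> (p N y)) \<longlonglongrightarrow> indicator (cube R) y * \<phi> y"
        by (rule Lim_transform_eventually) (use eventually_gt_at_top[of 0] in eventually_elim, auto)
    qed
    show "AE y in lborel. norm (if N = 0 then 0 else indicator (cube R) y * \<phi> (p N y)) \<le> B * indicator (cube R) y" for N
    proof (rule AE_I2)
      fix y :: 'a
      have "B \<ge> 0" using B[of 0] R by (auto intro: order_trans[OF norm_ge_zero])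
      moreover have "norm (\<phi> (p N y)) \<le> B" if "N > 0" "y \<in> cube R"
        using norm_cube_grid[OF p_grid[OF that]] R by (intro B) simp
      ultimately show "norm (if N = 0 then 0 else indicator (cube R) y * \<phi> (p N y)) \<le> B * indicator (cube R) y"
        by (auto simp: indicator_def)
    qed
  qed (rule cube_int)
  then show ?thesis
  proof (rule Lim_transform_eventually)
    show "\<forall>\<^sub>F N in sequentially. (\<integral>y. (if N = 0 then 0 else indicator (cube R) y * \<phi> (p N y)) \<partial>lborel) = (R / N) ^ DIM('a) * (\<Sum>x\<in>cube_grid R N. \<phi> x)"
      using eventually_gt_at_top[of 0] by eventually_elim (simp add: int_eq)
  qed
qed

section \<open>Asymptotics of the grid coefficients\<close>

lemma abs_exp_minus_one_minus_le:
  fixes t :: real assumes "\<bar>t\<bar> \<le> 1" shows "\<bar>exp t - 1 - t\<bar> \<le> t^2"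
proof -
  have lo: "exp t - 1 - t \<ge> 0" using exp_ge_add_one_self[of t] by linarith
  have "exp t \<le> 1 + t + t^2"
  proof (cases "t \<ge> 0")
    case True
    then show ?thesis using exp_bound[of t] assms by simp
  next
    case False
    define s where "s = - t"
    have s: "0 < s" "s \<le> 1" using False assms by (auto simp: s_def)
    have pos: "1 - s + s^2 > 0" using s by (simp add: add_pos_nonneg add_nonneg_pos)
    have e: "1 + s + s^2 / 2 \<le> exp s" using exp_lower_Taylor_quadratic[of s] s by simp
    have "1 \<le> (1 - s + s^2) * (1 + s + s^2 / 2)"
    proof -
      have "(1 - s + s^2) * (1 + s + s^2 / 2) - 1 = s^2 / 2 * (1 + s + s^2)"
        by (simp add: power2_eq_square field_simps)
      moreover have "s^2 / 2 * (1 + s + s^2) \<ge> 0" using s by simp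
      ultimately show ?thesis by linarith
    qed
    also have "\<dots> \<le> (1 - s + s^2) * exp s" using e pos by (intro mult_left_mono) auto
    finally have "exp (- s) \<le> 1 - s + s^2" by (simp add: exp_minus field_simps)
    then show ?thesis by (simp add: s_def)
  qed
  then show ?thesis using lo by linarith
qed

lemma abs_exp_minus_one_le:
  fixes t :: real assumes "\<bar>t\<bar> \<le> 1" shows "\<bar>exp t - 1\<bar> \<le> 2 * \<bar>t\<bar>"
proof -
  have "t^2 \<le> \<bar>t\<bar>" using assms mult_left_mono[of "\<bar>t\<bar>" 1 "\<bar>t\<bar>"] by (simp add: power2_eq_square)
  then show ?thesis using abs_exp_minus_one_minus_le[OF assms] by linarith
qed

lemma has_derivative_imp_continuous_on:
  assumes "\<And>x. (f has_derivative f' x) (at x)" shows "continuous_on UNIV f"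
  by (intro continuous_at_imp_continuous_on ballI has_derivative_continuous[OF assms])

lemma mean_value_line:
  fixes f :: "'a::euclidean_space \<Rightarrow> real"
  assumes f: "\<And>x. (f has_derivative (\<lambda>u. g x \<bullet> u)) (at x)" and h: "h > 0"
  obtains \<xi> where "0 < \<xi>" "\<xi> < h" "f (x + h *\<^sub>R b) - f x = h * (g (x + \<xi> *\<^sub>R b) \<bullet> b)"
proof -
  have "((\<lambda>t. f (x + t *\<^sub>R b)) has_derivative (\<lambda>t. g (x + t0 *\<^sub>R b) \<bullet> (t *\<^sub>R b))) (at t0 within {0..h})" for t0 :: real
    by (rule has_derivative_compose[OF _ f]) (auto intro!: derivative_eq_intros)
  from mvt_simple[OF h this] obtain \<xi> where "\<xi> \<in> {0<..<h}"
    "f (x + h *\<^sub>R b) - f (x + 0 *\<^sub>R b) = g (x + \<xi> *\<^sub>R b) \<bullet> ((h - 0) *\<^sub>R b)" by blast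
  then show ?thesis using that[of \<xi>] by auto
qed

section \<open>Second differences of the potential and the commutator coefficients\<close>

definition second_diff :: "('a::real_vector \<Rightarrow> real) \<Rightarrow> real \<Rightarrow> 'a \<Rightarrow> 'a \<Rightarrow> 'a \<Rightarrow> real" where
  "second_diff V h i j x = V (x + h *\<^sub>R j + h *\<^sub>R i) - V (x + h *\<^sub>R j) - V (x + h *\<^sub>R i) + V x"

text \<open>\<open>comm_plus\<close> and \<open>comm_minus\<close> are \<open>cP\<close> and
  \<open>cM\<close> freed from the grid, so that they can be estimated uniformly on a ball for all
  small \<open>h\<close>.\<close>

definition comm_plus :: "('a::real_vector \<Rightarrow> real) \<Rightarrow> real \<Rightarrow> 'a \<Rightarrow> 'a \<Rightarrow> 'a \<Rightarrow> real" where
  "comm_plus V h i j x = exp ((V x - V (x + h *\<^sub>R i)) / 2) - exp ((V (x + h *\<^sub>R j) - V (x + h *\<^sub>R j + h *\<^sub>R i)) / 2)"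

definition comm_minus :: "('a::real_vector \<Rightarrow> real) \<Rightarrow> real \<Rightarrow> 'a \<Rightarrow> 'a \<Rightarrow> 'a \<Rightarrow> real" where
  "comm_minus V h i j x = exp ((V (x + h *\<^sub>R j) - V (x + h *\<^sub>R j - h *\<^sub>R i)) / 2) - exp ((V x - V (x - h *\<^sub>R i)) / 2)"

locale C2_potential =
  fixes V :: "'a::euclidean_space \<Rightarrow> real" and DV :: "'a \<Rightarrow> 'a" and HV :: "'a \<Rightarrow> 'a \<Rightarrow>\<^sub>L 'a"
  assumes V_deriv: "\<And>x. (V has_derivative (\<lambda>u. DV x \<bullet> u)) (at x)"
    and DV_deriv: "\<And>x. (DV has_derivative blinfun_apply (HV x)) (at x)"
    and HV_cont: "continuous_on UNIV HV"
begin

lemma V_cont: "continuous_on UNIV V"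
  by (rule has_derivative_imp_continuous_on[OF V_deriv])

lemma second_diff_mean_value:
  assumes h: "h > 0" and ij: "norm i = 1" "norm j = 1"
  obtains z where "norm (z - x) \<le> 2 * h" "second_diff V h i j x = h^2 * (i \<bullet> HV z j)"
proof -
  \<comment> \<open>The mean value theorem is used along \<open>i\<close> for this difference and
    then along \<open>j\<close> for a component of \<open>DV\<close>, which avoids any Taylor
    remainder.\<close>
  define W where "W = (\<lambda>y. V (y + h *\<^sub>R j) - V y)"
  have W: "(W has_derivative (\<lambda>u. (DV (y + h *\<^sub>R j) - DV y) \<bullet> u)) (at y)" for y
  proof -
    have "((\<lambda>y. V (y + h *\<^sub>R j)) has_derivative (\<lambda>u. DV (y + h *\<^sub>R j) \<bullet> u)) (at y)"
      by (rule has_derivative_compose[OF _ V_deriv]) (auto intro!: derivative_eq_intros)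
    then show ?thesis unfolding W_def using V_deriv[of y] by (auto intro!: derivative_eq_intros simp: inner_diff_left)
  qed
  obtain \<xi> where xi: "0 < \<xi>" "\<xi> < h"
    and 1: "W (x + h *\<^sub>R i) - W x = h * ((DV (x + \<xi> *\<^sub>R i + h *\<^sub>R j) - DV (x + \<xi> *\<^sub>R i)) \<bullet> i)"
    using mean_value_line[of W "\<lambda>y. DV (y + h *\<^sub>R j) - DV y", OF W h] by blast
  define y where "y = x + \<xi> *\<^sub>R i"
  have "((\<lambda>t. DV (y + t *\<^sub>R j) \<bullet> i) has_derivative (\<lambda>t. HV (y + t0 *\<^sub>R j) (t *\<^sub>R j) \<bullet> i)) (at t0 within {0..h})" for t0 :: real
  proof -
    have "((\<lambda>t. DV (y + t *\<^sub>R j)) has_derivative (\<lambda>t. HV (y + t0 *\<^sub>R j) (t *\<^sub>R j))) (at t0 within {0..h})"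
      by (rule has_derivative_compose[OF _ DV_deriv]) (auto intro!: derivative_eq_intros)
    then show ?thesis by (rule has_derivative_inner_left)
  qed
  from mvt_simple[OF h this] obtain \<zeta> where z: "\<zeta> \<in> {0<..<h}"
    "DV (y + h *\<^sub>R j) \<bullet> i - DV (y + 0 *\<^sub>R j) \<bullet> i = HV (y + \<zeta> *\<^sub>R j) ((h - 0) *\<^sub>R j) \<bullet> i" by blast
  define p where "p = y + \<zeta> *\<^sub>R j"
  have "second_diff V h i j x = W (x + h *\<^sub>R i) - W x"
    by (simp add: second_diff_def W_def algebra_simps)
  also have "\<dots> = h * (h * (HV p j \<bullet> i))"
    unfolding 1 using z(2) by (simp add: y_def[symmetric] p_def[symmetric] inner_diff_left blinfun.scaleR_right)
  finally have "second_diff V h i j x = h^2 * (i \<bullet> HV p j)"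
    by (simp add: power2_eq_square inner_commute)
  moreover have "norm (p - x) \<le> 2 * h"
  proof -
    have "norm (\<xi> *\<^sub>R i + \<zeta> *\<^sub>R j) \<le> norm (\<xi> *\<^sub>R i) + norm (\<zeta> *\<^sub>R j)" by (rule norm_triangle_ineq)
    also have "\<dots> \<le> h + h" using xi z(1) ij by (intro add_mono) auto
    finally show ?thesis by (simp add: p_def y_def)
  qed
  ultimately show ?thesis using that by blast
qed

text \<open>Up to signs, each commutator is a rate times \<open>exp (d / 2) - 1\<close> with a
  second difference \<open>d\<close> of \<open>V\<close>, taken at \<open>x\<close> for
  \<open>comm_plus\<close> and at \<open>x - h *\<^sub>R i\<close> for \<open>comm_minus\<close>.
  Each contributes half of the Hessian entry. Uniform continuity of \<open>HV\<close> on a compact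
  ball stands in for third derivatives, which \<open>V\<close> need not have.\<close>

lemma grid_coefficient_estimates:
  assumes \<delta>: "\<delta> > 0" and S: "S \<ge> 0"
  obtains C h0 where "C \<ge> 0" "h0 > 0"
    "\<And>h x i. \<lbrakk>0 < h; h < h0; norm x \<le> S; i \<in> Basis\<rbrakk> \<Longrightarrow>
      \<bar>exp ((V x - V (x + h *\<^sub>R i)) / 2) - 1\<bar> \<le> \<delta> \<and> \<bar>exp ((V x - V (x - h *\<^sub>R i)) / 2) - 1\<bar> \<le> \<delta>"
    "\<And>h x i j. \<lbrakk>0 < h; h < h0; norm x \<le> S; i \<in> Basis; j \<in> Basis\<rbrakk> \<Longrightarrow>
      \<bar>comm_plus V h i j x\<bar> \<le> C * h^2 \<and> \<bar>comm_minus V h i j x\<bar> \<le> C * h^2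
      \<and> \<bar>comm_plus V h i j x + comm_minus V h i j x - h^2 * (i \<bullet> HV x j)\<bar> \<le> h^2 * \<delta>"
proof -
  \<comment> \<open>For \<open>h < 1\<close> all points at which \<open>DV\<close> and
    \<open>HV\<close> are evaluated lie within distance 4 of \<open>x\<close>.\<close>
  define K where "K = cball (0::'a) (S + 4)"
  have K: "compact K" by (simp add: K_def)
  have "bounded (HV ` K)" by (rule compact_imp_bounded[OF compact_continuous_image[OF continuous_on_subset[OF HV_cont] K]]) simp
  then obtain C1 where C1: "C1 > 0" "\<And>x. x \<in> K \<Longrightarrow> norm (HV x) \<le> C1"
    unfolding bounded_pos by auto
  have "continuous_on UNIV DV"
    by (rule has_derivative_imp_continuous_on[OF DV_deriv])
  then have "bounded (DV ` K)" by (intro compact_imp_bounded[OF compact_continuous_image[OF continuous_on_subset K]]) auto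
  then obtain C2 where C2: "C2 > 0" "\<And>x. x \<in> K \<Longrightarrow> norm (DV x) \<le> C2"
    unfolding bounded_pos by auto
  have "uniformly_continuous_on K HV"
    by (rule compact_uniformly_continuous[OF continuous_on_subset[OF HV_cont] K]) simp
  then obtain r where r: "r > 0" "\<And>x y. x \<in> K \<Longrightarrow> y \<in> K \<Longrightarrow> dist y x < r \<Longrightarrow> dist (HV y) (HV x) < \<delta> / 2"
    unfolding uniformly_continuous_on_def using \<delta> by (metis half_gt_zero)
  \<comment> \<open>In order: evaluation points stay in \<open>K\<close>; points at distance
    \<open>3 * h\<close> lie within the modulus of continuity; rates are
    \<open>\<delta>\<close>-close to 1; exponents are at most 1; the quadratic errors of both
    commutators together stay below \<open>h^2 * (\<delta> / 2)\<close>.\<close>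
  define h0 where "h0 = Min {1, r / 4, min 1 \<delta> / C2, 1 / C1, \<delta> / (4 * C2 * C1 + 4 * C1^2)}"
  have h0: "h0 > 0" using C1 C2 r \<delta> by (simp add: h0_def add_pos_pos)
  have hb: "h < 1" "4 * h < r" "C2 * h < min 1 \<delta>" "C1 * h < 1" "h * (4 * C2 * C1 + 4 * C1^2) < \<delta>" if "h < h0" for h
  proof -
    have D: "4 * C2 * C1 + 4 * C1^2 > 0" using C1 C2 by (simp add: add_pos_pos)
    have *: "h < 1" "h < r / 4" "h < min 1 \<delta> / C2" "h < 1 / C1" "h < \<delta> / (4 * C2 * C1 + 4 * C1^2)"
      using that by (simp_all add: h0_def)
    show "h < 1" "4 * h < r" using * by auto
    show "C2 * h < min 1 \<delta>" using *(3) by (simp only: pos_less_divide_eq[OF C2(1)] mult.commute)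
    show "C1 * h < 1" using *(4) by (simp only: pos_less_divide_eq[OF C1(1)] mult.commute)
    show "h * (4 * C2 * C1 + 4 * C1^2) < \<delta>" using *(5) by (simp only: pos_less_divide_eq[OF D])
  qed
  have in_K: "y \<in> K" if "norm x \<le> S" "norm (y - x) \<le> 4" for x y
    using that norm_triangle_ineq[of x "y - x"] by (simp add: K_def)
  have first: "\<bar>V (y + h *\<^sub>R i) - V y\<bar> \<le> C2 * h"
    if h: "0 < h" "h < h0" and x: "norm x \<le> S" and y: "norm (y - x) \<le> 1" and i: "i \<in> Basis" for h x y i
  proof -
    obtain \<xi> where xi: "0 < \<xi>" "\<xi> < h" "V (y + h *\<^sub>R i) - V y = h * (DV (y + \<xi> *\<^sub>R i) \<bullet> i)"
      using mean_value_line[OF V_deriv h(1)] by blast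
    have "y + \<xi> *\<^sub>R i \<in> K"
      using norm_triangle_ineq[of "y - x" "\<xi> *\<^sub>R i"] y xi hb(1)[OF h(2)] i
      by (intro in_K[OF x]) (simp add: algebra_simps)
    then have "norm (DV (y + \<xi> *\<^sub>R i)) \<le> C2" by (rule C2)
    moreover have "\<bar>DV (y + \<xi> *\<^sub>R i) \<bullet> i\<bar> \<le> norm (DV (y + \<xi> *\<^sub>R i))" using i by (rule Basis_le_norm)
    ultimately show ?thesis using h by (simp add: xi(3) abs_mult mult.commute)
  qed
  have second: "\<bar>second_diff V h i j y\<bar> \<le> C1 * h^2" "\<bar>second_diff V h i j y - h^2 * (i \<bullet> HV x j)\<bar> \<le> h^2 * (\<delta> / 2)"
    if h: "0 < h" "h < h0" and x: "norm x \<le> S" and y: "norm (y - x) \<le> h" and ij: "i \<in> Basis" "j \<in> Basis" for h x y i j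
  proof -
    have n1: "norm i = 1" "norm j = 1" using ij by auto
    obtain z where z: "norm (z - y) \<le> 2 * h" "second_diff V h i j y = h^2 * (i \<bullet> HV z j)"
      using second_diff_mean_value[OF h(1) n1] by blast
    have zx: "norm (z - x) \<le> 3 * h" using norm_triangle_ineq[of "z - y" "y - x"] z y by simp
    then have zK: "z \<in> K" using hb(1)[OF h(2)] by (intro in_K[OF x]) simp
    have xK: "x \<in> K" by (rule in_K[OF x]) simp
    have "\<bar>i \<bullet> HV z j\<bar> \<le> norm i * norm (HV z j)" by (rule Cauchy_Schwarz_ineq2)
    also have "\<dots> \<le> norm (HV z)" using norm_blinfun[of "HV z" j] n1 by simp
    also have "\<dots> \<le> C1" by (rule C1(2)[OF zK])
    finally show "\<bar>second_diff V h i j y\<bar> \<le> C1 * h^2" using mult_left_mono[of "\<bar>i \<bullet> HV z j\<bar>" C1 "h^2"] by (simp add: z(2) abs_mult mult.commute)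
    have "\<bar>i \<bullet> (HV z - HV x) j\<bar> \<le> norm i * norm ((HV z - HV x) j)" by (rule Cauchy_Schwarz_ineq2)
    also have "\<dots> \<le> norm (HV z - HV x)" using norm_blinfun[of "HV z - HV x" j] n1 by simp
    also have "\<dots> \<le> \<delta> / 2"
      using r(2)[OF xK zK] zx hb(2)[OF h(2)] h by (simp add: dist_norm)
    finally have "h^2 * \<bar>i \<bullet> (HV z - HV x) j\<bar> \<le> h^2 * (\<delta> / 2)" by (intro mult_left_mono) auto
    then show "\<bar>second_diff V h i j y - h^2 * (i \<bullet> HV x j)\<bar> \<le> h^2 * (\<delta> / 2)"
      unfolding z(2) right_diff_distrib[symmetric] abs_mult
      by (simp add: blinfun.diff_left inner_diff_right)
  qed
  have exps: "\<bar>exp ((V x - V (x + h *\<^sub>R i)) / 2) - 1\<bar> \<le> C2 * h" "\<bar>exp ((V x - V (x - h *\<^sub>R i)) / 2) - 1\<bar> \<le> C2 * h"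
    if h: "0 < h" "h < h0" and x: "norm x \<le> S" and i: "i \<in> Basis" for h x i
  proof -
    have a: "\<bar>V (x + h *\<^sub>R i) - V x\<bar> \<le> C2 * h" by (rule first[OF h x _ i]) simp
    have "\<bar>V (x - h *\<^sub>R i + h *\<^sub>R i) - V (x - h *\<^sub>R i)\<bar> \<le> C2 * h"
      by (rule first[OF h x _ i]) (use h hb(1) i in \<open>simp add: less_imp_le\<close>)
    then have b: "\<bar>V x - V (x - h *\<^sub>R i)\<bar> \<le> C2 * h" by simp
    have c: "C2 * h \<le> 1" using hb(3)[OF h(2)] by simp
    have "\<bar>exp (t / 2) - 1\<bar> \<le> C2 * h" if "\<bar>t\<bar> \<le> C2 * h" for t
      using abs_exp_minus_one_le[of "t / 2"] that c by simp
    then show "\<bar>exp ((V x - V (x + h *\<^sub>R i)) / 2) - 1\<bar> \<le> C2 * h" "\<bar>exp ((V x - V (x - h *\<^sub>R i)) / 2) - 1\<bar> \<le> C2 * h"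
      using a b by (auto simp: abs_minus_commute)
  qed
  have prod_est: "\<bar>a * (exp (t / 2) - 1) - t / 2\<bar> \<le> (C2 * C1 * h + C1^2 * h^2) * h^2" "\<bar>a * (exp (t / 2) - 1)\<bar> \<le> 2 * C1 * h^2"
    if h: "0 < h" "h < h0" and a: "\<bar>a - 1\<bar> \<le> C2 * h" and t: "\<bar>t\<bar> \<le> C1 * h^2" for h a t
  proof -
    have C1h: "C1 * h^2 \<le> 1"
    proof -
      have "C1 * h^2 = (C1 * h) * h" by (simp add: power2_eq_square)
      also have "\<dots> \<le> 1 * 1" using hb(1,4)[OF h(2)] h C1 by (intro mult_mono) auto
      finally show ?thesis by simp
    qed
    then have t1: "\<bar>t / 2\<bar> \<le> 1" using t by simp
    have e1: "\<bar>exp (t / 2) - 1\<bar> \<le> C1 * h^2" using abs_exp_minus_one_le[OF t1] t by simp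
    have "(t / 2)^2 \<le> (C1 * h^2)^2" using t by (intro abs_le_square_iff[THEN iffD1]) auto
    then have e2: "\<bar>exp (t / 2) - 1 - t / 2\<bar> \<le> (C1 * h^2)^2" using abs_exp_minus_one_minus_le[OF t1] by linarith
    have e3: "\<bar>(a - 1) * (exp (t / 2) - 1)\<bar> \<le> C2 * h * (C1 * h^2)"
      unfolding abs_mult using a e1 C2 h by (intro mult_mono) auto
    have "a * (exp (t / 2) - 1) - t / 2 = (a - 1) * (exp (t / 2) - 1) + (exp (t / 2) - 1 - t / 2)" by (simp add: algebra_simps)
    then have "\<bar>a * (exp (t / 2) - 1) - t / 2\<bar> \<le> C2 * h * (C1 * h^2) + (C1 * h^2)^2" using e2 e3 by linarith
    then show "\<bar>a * (exp (t / 2) - 1) - t / 2\<bar> \<le> (C2 * C1 * h + C1^2 * h^2) * h^2"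
      by (simp add: algebra_simps power2_eq_square)
    have "\<bar>a\<bar> \<le> 2" using a hb(3)[OF h(2)] by linarith
    then have "\<bar>a\<bar> * \<bar>exp (t / 2) - 1\<bar> \<le> 2 * (C1 * h^2)" using e1 by (intro mult_mono) auto
    then show "\<bar>a * (exp (t / 2) - 1)\<bar> \<le> 2 * C1 * h^2" by (simp add: abs_mult)
  qed
  show ?thesis
  proof (rule that[of "2 * C1" h0])
    show "\<bar>exp ((V x - V (x + h *\<^sub>R i)) / 2) - 1\<bar> \<le> \<delta> \<and> \<bar>exp ((V x - V (x - h *\<^sub>R i)) / 2) - 1\<bar> \<le> \<delta>"
      if "0 < h" "h < h0" "norm x \<le> S" "i \<in> Basis" for h x i
      using exps[OF that] hb(3)[OF that(2)] by simp
    fix h :: real and x i j :: 'a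
    assume h: "0 < h" "h < h0" and x: "norm x \<le> S" and ij: "i \<in> Basis" "j \<in> Basis"
    define a where "a = exp ((V x - V (x + h *\<^sub>R i)) / 2)"
    define b where "b = exp ((V x - V (x - h *\<^sub>R i)) / 2)"
    define d where "d = second_diff V h i j x"
    define d' where "d' = second_diff V h i j (x - h *\<^sub>R i)"
    have P: "comm_plus V h i j x = - (a * (exp ((- d) / 2) - 1))"
    proof -
      have "exp ((V (x + h *\<^sub>R j) - V (x + h *\<^sub>R j + h *\<^sub>R i)) / 2) = a * exp ((- d) / 2)"
        unfolding a_def d_def second_diff_def mult_exp_exp by (rule arg_cong[of _ _ exp]) (simp add: field_simps)
      then show ?thesis unfolding comm_plus_def a_def by (simp add: algebra_simps)
    qed
    have M: "comm_minus V h i j x = b * (exp (d' / 2) - 1)"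
    proof -
      have e: "x - h *\<^sub>R i + h *\<^sub>R j + h *\<^sub>R i = x + h *\<^sub>R j" "x - h *\<^sub>R i + h *\<^sub>R j = x + h *\<^sub>R j - h *\<^sub>R i" by simp_all
      then have d': "d' = V (x + h *\<^sub>R j) - V (x + h *\<^sub>R j - h *\<^sub>R i) - V x + V (x - h *\<^sub>R i)"
        unfolding d'_def second_diff_def e by simp
      have "exp ((V (x + h *\<^sub>R j) - V (x + h *\<^sub>R j - h *\<^sub>R i)) / 2) = b * exp (d' / 2)"
        unfolding b_def d' mult_exp_exp by (rule arg_cong[of _ _ exp]) (simp add: field_simps)
      then show ?thesis unfolding comm_minus_def b_def by (simp add: algebra_simps)
    qed
    have ab: "\<bar>a - 1\<bar> \<le> C2 * h" "\<bar>b - 1\<bar> \<le> C2 * h"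
      using exps[OF h x ij(1)] by (simp_all add: a_def b_def)
    have d: "\<bar>- d\<bar> \<le> C1 * h^2" "\<bar>d - h^2 * (i \<bullet> HV x j)\<bar> \<le> h^2 * (\<delta> / 2)"
      using second[OF h x _ ij, of x] h by (simp_all add: d_def)
    have d': "\<bar>d'\<bar> \<le> C1 * h^2" "\<bar>d' - h^2 * (i \<bullet> HV x j)\<bar> \<le> h^2 * (\<delta> / 2)"
      using second[OF h x _ ij, of "x - h *\<^sub>R i"] h ij by (simp_all add: d'_def)
    note e = prod_est[OF h ab(1) d(1)] prod_est[OF h ab(2) d'(1)]
    have "C1^2 * h^2 \<le> C1^2 * h"
      using hb(1)[OF h(2)] h mult_left_mono[of h 1 h] by (intro mult_left_mono) (auto simp: power2_eq_square)
    then have "2 * (C2 * C1 * h + C1^2 * h^2) \<le> \<delta> / 2"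
      using hb(5)[OF h(2)] by (simp add: algebra_simps)
    then have err: "2 * ((C2 * C1 * h + C1^2 * h^2) * h^2) \<le> h^2 * (\<delta> / 2)"
      using mult_right_mono[of "2 * (C2 * C1 * h + C1^2 * h^2)" "\<delta> / 2" "h^2"] by (simp only: mult.assoc mult.commute[of "h^2"] zero_le_power2)
    have comb: "\<bar>- p + q - H\<bar> \<le> 2 * t"
      if "\<bar>p - (- d) / 2\<bar> \<le> E" "\<bar>q - d' / 2\<bar> \<le> E" "\<bar>d - H\<bar> \<le> t" "\<bar>d' - H\<bar> \<le> t" "2 * E \<le> t" for p q E H t :: real
      using that unfolding abs_le_iff by argo
    have "\<bar>comm_plus V h i j x + comm_minus V h i j x - h^2 * (i \<bullet> HV x j)\<bar> \<le> 2 * (h^2 * (\<delta> / 2))"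
      unfolding P M by (rule comb[OF e(1,3) d(2) d'(2) err])
    then have "\<bar>comm_plus V h i j x + comm_minus V h i j x - h^2 * (i \<bullet> HV x j)\<bar> \<le> h^2 * \<delta>" by simp
    then show "\<bar>comm_plus V h i j x\<bar> \<le> 2 * C1 * h^2 \<and> \<bar>comm_minus V h i j x\<bar> \<le> 2 * C1 * h^2
      \<and> \<bar>comm_plus V h i j x + comm_minus V h i j x - h^2 * (i \<bullet> HV x j)\<bar> \<le> h^2 * \<delta>"
      using e(2,4) unfolding P M by simp
  qed (use C1 h0 in auto)
qed

end

locale convex_potential = C2_potential V DV HV
  for V :: "'a::euclidean_space \<Rightarrow> real" and DV :: "'a \<Rightarrow> 'a" and HV :: "'a \<Rightarrow> 'a \<Rightarrow>\<^sub>L 'a" +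
  fixes \<rho> :: "'a \<Rightarrow> real" and \<rho>0 :: real
  assumes hess: "\<And>x u. u \<bullet> HV x u \<ge> \<rho> x * (norm u)^2"
    and \<rho>_lower: "\<And>x. \<rho> x \<ge> \<rho>0" and \<rho>0_pos: "\<rho>0 > 0"

lemma eventually_mesh_small: "h0 > 0 \<Longrightarrow> \<forall>\<^sub>F N in sequentially. R / real N < h0"
  by (rule order_tendstoD(2)[OF lim_const_over_n])

lemma (in convex_potential) eventually_curved_grid:
  assumes R: "R > 0" and \<eta>: "0 < \<eta>" "\<eta> < 1" "\<eta> < \<rho>0"
  shows "\<forall>\<^sub>F N in sequentially. curved_grid (cube_grid R N) (R / N) V \<rho> \<rho>0 \<eta>"
proof -
  define n where "n = real DIM('a)"
  have n: "n \<ge> 1" by (simp add: n_def Suc_leI)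
  \<comment> \<open>Half of \<open>\<eta>\<close> is reserved for the \<open>n^2\<close> Hessian
    entries, the other half for the commutator errors.\<close>
  define \<delta> where "\<delta> = \<eta> / (2 * n^2)"
  have \<delta>: "\<delta> > 0" "\<delta> \<le> \<eta>" "\<delta> \<le> 1/2" "n^2 * \<delta> = \<eta> / 2"
  proof -
    have "1 \<le> n^2" using n by simp
    then have 2: "2 * n^2 \<ge> 2" by linarith
    show "\<delta> > 0" "n^2 * \<delta> = \<eta> / 2" using \<eta> n by (simp_all add: \<delta>_def)
    have "\<delta> \<le> \<eta> / 2" unfolding \<delta>_def using \<eta> 2 by (intro divide_left_mono) auto
    then show "\<delta> \<le> \<eta>" "\<delta> \<le> 1/2" using \<eta> by linarith+
  qed
  have S0: "0 \<le> n * R" using n R by simp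
  obtain C h0 where C: "C \<ge> 0" and h0: "h0 > 0"
    and exps: "\<And>h x i. \<lbrakk>0 < h; h < h0; norm x \<le> n * R; i \<in> Basis\<rbrakk> \<Longrightarrow>
      \<bar>exp ((V x - V (x + h *\<^sub>R i)) / 2) - 1\<bar> \<le> \<delta> \<and> \<bar>exp ((V x - V (x - h *\<^sub>R i)) / 2) - 1\<bar> \<le> \<delta>"
    and comm: "\<And>h x i j. \<lbrakk>0 < h; h < h0; norm x \<le> n * R; i \<in> Basis; j \<in> Basis\<rbrakk> \<Longrightarrow>
      \<bar>comm_plus V h i j x\<bar> \<le> C * h^2 \<and> \<bar>comm_minus V h i j x\<bar> \<le> C * h^2
      \<and> \<bar>comm_plus V h i j x + comm_minus V h i j x - h^2 * (i \<bullet> HV x j)\<bar> \<le> h^2 * \<delta>"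
    using grid_coefficient_estimates[OF \<delta>(1) S0] by blast
  \<comment> \<open>The last entry forces
    \<open>8 * n ^ 3 * (C * h^2)^2 / \<eta> \<le> h^2 * (\<eta> / 2)\<close>; the summand 1 keeps
    the denominator positive when \<open>C = 0\<close>.\<close>
  define h1 where "h1 = Min {h0, 1, \<eta>^2 / (16 * n ^ 3 * C^2 + 1)}"
  have "16 * n ^ 3 * C^2 + 1 > 0" using n by (simp add: add_nonneg_pos)
  then have h1: "h1 > 0" using h0 \<eta> by (simp add: h1_def)
  show ?thesis
    using eventually_mesh_small[OF h1, of R] eventually_gt_at_top[of 0]
  proof eventually_elim
    case (elim N)
    define h where "h = R / N"
    have h: "0 < h" "h < h0" "h < 1" "h < \<eta>^2 / (16 * n ^ 3 * C^2 + 1)" using R elim by (auto simp: h_def h1_def)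
    interpret box_grid "cube_grid R N :: 'a set" h V
      unfolding h_def by (rule box_grid_cube_grid) (use R elim in auto)
    have nx: "norm x \<le> n * R" if "x \<in> cube_grid R N" for x :: 'a
      using norm_cube_grid[OF that] R by (simp add: n_def)
    show "curved_grid (cube_grid R N) (R / N) V \<rho> \<rho>0 \<eta>"
      unfolding h_def[symmetric]
    proof
      show "0 < \<eta>" "\<eta> < 1" "\<eta> < \<rho>0" by fact+
      show "\<rho>0 \<le> \<rho> x" for x by (rule \<rho>_lower)
      fix x :: 'a assume x: "x \<in> cube_grid R N"
      have al: "\<bar>al i x - 1\<bar> \<le> \<delta>" and be: "\<bar>be i x - 1\<bar> \<le> \<delta>" if "i \<in> Basis" for i
        using exps[OF h(1,2) nx[OF x] that] by (simp_all add: al_def be_def)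
      show "1 - \<eta> \<le> al i x" "al i x \<le> 1 + \<eta>" if "i \<in> Basis" for i
        using al[OF that] \<delta>(2) by linarith+
      have cP: "cP i j x = comm_plus V h i j x" and cM: "cM i j x = comm_minus V h i j x" for i j
        by (simp_all add: cP_def cM_def al_def be_def comm_plus_def comm_minus_def)
      fix u :: "'a \<Rightarrow> real"
      let ?A = "lap (\<lambda>y. (norm (grd u y))^2) x / 2 + (1 - \<eta>) / 2 * gam (\<lambda>y. norm (grd u y)) x"
      have "?A + (h^2 * (\<rho> x - (real DIM('a))^2 * \<delta>) - 8 * real DIM('a) ^ 3 * (C * h^2)^2 / \<eta>) * (norm (grd u x))^2
        \<le> grd u x \<bullet> grd (lap u) x"
      proof (rule bochner[where H = "blinfun_apply (HV x)"])
        show "1/2 \<le> al i x" "1/2 \<le> be i x" if "i \<in> Basis" for i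
          using al[OF that] be[OF that] \<delta>(3) by linarith+
        show "linear (blinfun_apply (HV x))" by (simp add: blinfun.bounded_linear_right bounded_linear.linear)
        show "\<bar>cP i j x\<bar> \<le> C * h^2" "\<bar>cM i j x\<bar> \<le> C * h^2"
          "\<bar>cP i j x + cM i j x - h^2 * (i \<bullet> HV x j)\<bar> \<le> h^2 * \<delta>" if "i \<in> Basis" "j \<in> Basis" for i j
          using comm[OF h(1,2) nx[OF x] that] unfolding cP cM by auto
      qed (use x \<eta> C hess in auto)
      moreover have "h^2 * (\<rho> x - \<eta>) \<le> h^2 * (\<rho> x - n^2 * \<delta>) - 8 * n ^ 3 * (C * h^2)^2 / \<eta>"
      proof -
        have "16 * n ^ 3 * C^2 * h^2 \<le> 16 * n ^ 3 * C^2 * h"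
          using h n mult_left_mono[of h 1 h] by (intro mult_left_mono) (auto simp: power2_eq_square)
        also have "\<dots> \<le> h * (16 * n ^ 3 * C^2 + 1)" using h by (simp add: algebra_simps)
        also have "\<dots> \<le> \<eta>^2" using h(4) \<open>16 * n ^ 3 * C^2 + 1 > 0\<close> by (simp only: pos_less_divide_eq less_imp_le)
        finally have "8 * n ^ 3 * C^2 * h^2 / \<eta> \<le> \<eta> / 2" using \<eta> by (simp add: power2_eq_square field_simps)
        then have "h^2 * (8 * n ^ 3 * C^2 * h^2 / \<eta>) \<le> h^2 * (\<eta> / 2)" by (intro mult_left_mono) auto
        then show ?thesis unfolding \<delta>(4) by (simp add: power_mult_distrib algebra_simps power2_eq_square)
      qed
      then have "h^2 * (\<rho> x - \<eta>) * (norm (grd u x))^2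
          \<le> (h^2 * (\<rho> x - n^2 * \<delta>) - 8 * n ^ 3 * (C * h^2)^2 / \<eta>) * (norm (grd u x))^2"
        by (rule mult_right_mono) simp
      ultimately show "?A + h^2 * (\<rho> x - \<eta>) * (norm (grd u x))^2 \<le> grd u x \<bullet> grd (lap u) x"
        unfolding n_def by linarith
    qed
  qed
qed

text \<open>Each component is \<open>h\<close> times a derivative at an intermediate point depending
  on \<open>b\<close>, so uniform continuity is needed; errors \<open>\<delta> / n\<close> per
  component add up to at most \<open>\<delta>\<close>. Only an upper bound can be expected, since
  differences across the faces are 0.\<close>

lemma eventually_grd_le:
  fixes f :: "'a::euclidean_space \<Rightarrow> real" and V :: "'a \<Rightarrow> real"
  assumes f: "\<And>x. (f has_derivative (\<lambda>u. g x \<bullet> u)) (at x)" and g: "continuous_on UNIV g"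
    and R: "R > 0" and \<delta>: "\<delta> > 0"
  shows "\<forall>\<^sub>F N in sequentially. \<forall>x\<in>cube_grid R N.
    norm (box_grid.grd (cube_grid R N) (R / N) f x) \<le> R / N * (norm (g x) + \<delta>)"
proof -
  define n where "n = real DIM('a)"
  have n: "n \<ge> 1" by (simp add: n_def Suc_leI)
  define K where "K = cball (0::'a) (n * R + 1)"
  have "uniformly_continuous_on K g"
    by (rule compact_uniformly_continuous[OF continuous_on_subset[OF g]]) (simp_all add: K_def)
  moreover have "\<delta> / n > 0" using n \<delta> by simp
  ultimately obtain r where r: "r > 0" "\<And>x y. x \<in> K \<Longrightarrow> y \<in> K \<Longrightarrow> dist y x < r \<Longrightarrow> dist (g y) (g x) < \<delta> / n"
    unfolding uniformly_continuous_on_def by metis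
  have "min r 1 > 0" using r by simp
  from eventually_mesh_small[OF this, of R] eventually_gt_at_top[of 0] show ?thesis
  proof eventually_elim
    case (elim N)
    define h where "h = R / N"
    have h: "0 < h" "h < r" "h < 1" using R elim by (auto simp: h_def)
    interpret box_grid "cube_grid R N :: 'a set" h V
      unfolding h_def by (rule box_grid_cube_grid) (use R elim in auto)
    show "\<forall>x\<in>cube_grid R N. norm (box_grid.grd (cube_grid R N) (R / N) f x) \<le> R / N * (norm (g x) + \<delta>)"
      unfolding h_def[symmetric]
    proof
      fix x :: 'a assume x: "x \<in> cube_grid R N"
      have nx: "norm x \<le> n * R" using norm_cube_grid[OF x] R by (simp add: n_def)
      have fd: "\<bar>fd f b x\<bar> \<le> h * (\<bar>g x \<bullet> b\<bar> + \<delta> / n)" if b: "b \<in> Basis" for b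
      proof (cases "x + h *\<^sub>R b \<in> cube_grid R N")
        case True
        obtain \<xi> where xi: "0 < \<xi>" "\<xi> < h" "f (x + h *\<^sub>R b) - f x = h * (g (x + \<xi> *\<^sub>R b) \<bullet> b)"
          using mean_value_line[OF f h(1)] by blast
        have nb: "norm (\<xi> *\<^sub>R b) < h" using xi b by simp
        have "norm (x + \<xi> *\<^sub>R b) \<le> norm x + norm (\<xi> *\<^sub>R b)" by (rule norm_triangle_ineq)
        then have "x + \<xi> *\<^sub>R b \<in> K" "x \<in> K" using nb h nx by (auto simp: K_def)
        then have "norm (g (x + \<xi> *\<^sub>R b) - g x) \<le> \<delta> / n"
          using r(2)[of x "x + \<xi> *\<^sub>R b"] nb h by (simp add: dist_norm)
        moreover have "\<bar>(g (x + \<xi> *\<^sub>R b) - g x) \<bullet> b\<bar> \<le> norm (g (x + \<xi> *\<^sub>R b) - g x)" using b by (rule Basis_le_norm)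
        ultimately have "\<bar>g (x + \<xi> *\<^sub>R b) \<bullet> b\<bar> \<le> \<bar>g x \<bullet> b\<bar> + \<delta> / n" by (simp add: inner_diff_left)
        then have "h * \<bar>g (x + \<xi> *\<^sub>R b) \<bullet> b\<bar> \<le> h * (\<bar>g x \<bullet> b\<bar> + \<delta> / n)" using h by (intro mult_left_mono) auto
        then show ?thesis using True x xi(3) h by (simp add: fd_def abs_mult)
      next
        case False
        then show ?thesis using h \<delta> n by (simp add: fd_outside)
      qed
      \<comment> \<open>Componentwise absolute values leave the norm unchanged and let
        \<open>\<delta> / n\<close> be added with the right sign in every coordinate.\<close>
      define a where "a = (\<Sum>b\<in>Basis. \<bar>g x \<bullet> b\<bar> *\<^sub>R b)"
      have "norm (grd f x) \<le> norm (h *\<^sub>R (a + (\<delta> / n) *\<^sub>R One))"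
      proof (rule norm_le_componentwise)
        fix b :: 'a assume b: "b \<in> Basis"
        have "(h *\<^sub>R (a + (\<delta> / n) *\<^sub>R One)) \<bullet> b = h * (\<bar>g x \<bullet> b\<bar> + \<delta> / n)"
          using b unfolding inner_scaleR_left inner_add_left by (simp add: a_def)
        moreover have "0 \<le> h * (\<bar>g x \<bullet> b\<bar> + \<delta> / n)" using h \<delta> n by simp
        ultimately show "\<bar>grd f x \<bullet> b\<bar> \<le> \<bar>(h *\<^sub>R (a + (\<delta> / n) *\<^sub>R One)) \<bullet> b\<bar>"
          using fd[OF b] unfolding grd_inner[OF b] by (simp only: abs_of_nonneg)
      qed
      also have "\<dots> = h * norm (a + (\<delta> / n) *\<^sub>R One)" using h by simp
      also have "\<dots> \<le> h * (norm a + norm ((\<delta> / n) *\<^sub>R (One::'a)))"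
        using h by (intro mult_left_mono norm_triangle_ineq) auto
      also have "\<dots> \<le> h * (norm (g x) + \<delta>)"
      proof (intro mult_left_mono add_mono)
        show "norm a \<le> norm (g x)"
          by (rule norm_le_componentwise) (simp add: a_def)
        have "norm (One::'a) \<le> (\<Sum>b\<in>(Basis::'a set). norm b)" by (rule norm_sum)
        then have "norm (One::'a) \<le> n" by (simp add: n_def)
        then have "\<delta> / n * norm (One::'a) \<le> \<delta> / n * n" using \<delta> n by (intro mult_left_mono) auto
        then show "norm ((\<delta> / n) *\<^sub>R (One::'a)) \<le> \<delta>" using \<delta> n by simp
      qed (use h in simp)
      finally show "norm (grd f x) \<le> h * (norm (g x) + \<delta>)" .
    qed
  qed
qed

section \<open>Weighted integrals over growing cubes\<close>

definition cube_int :: "('a::euclidean_space \<Rightarrow> real) \<Rightarrow> real \<Rightarrow> ('a \<Rightarrow> real) \<Rightarrow> real" where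
  "cube_int V R \<phi> = (\<integral>y. indicator (cube R) y * (exp (- V y) * \<phi> y) \<partial>lborel)"

lemma weighted_riemann_sum_tendsto:
  fixes \<phi> V :: "'a::euclidean_space \<Rightarrow> real"
  assumes "continuous_on UNIV V" "continuous_on UNIV \<phi>" "R > 0"
  shows "(\<lambda>N. (R / N) ^ DIM('a) * (\<Sum>x\<in>cube_grid R N. exp (- V x) * \<phi> x)) \<longlonglongrightarrow> cube_int V R \<phi>"
  unfolding cube_int_def by (rule riemann_sum_tendsto) (auto intro!: continuous_intros assms)

lemma cube_int_tendsto:
  fixes \<phi> V :: "'a::euclidean_space \<Rightarrow> real"
  assumes int: "integrable lborel (\<lambda>y. exp (- V y) * \<phi> y)"
  shows "(\<lambda>k. cube_int V (real k) \<phi>) \<longlonglongrightarrow> (\<integral>y. exp (- V y) * \<phi> y \<partial>lborel)"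
  unfolding cube_int_def
proof (rule integral_dominated_convergence[where w = "\<lambda>y. norm (exp (- V y) * \<phi> y)"])
  show "AE y in lborel. (\<lambda>k. indicator (cube (real k)) y * (exp (- V y) * \<phi> y)) \<longlonglongrightarrow> exp (- V y) * \<phi> y"
  proof (rule AE_I2)
    fix y :: 'a
    obtain k0 :: nat where k0: "norm y < real k0" using reals_Archimedean2 by blast
    have "y \<in> cube (real k)" if "k \<ge> k0" for k
      unfolding cube_def
    proof (intro CollectI ballI)
      fix b :: 'a assume "b \<in> Basis"
      then have "\<bar>y \<bullet> b\<bar> \<le> norm y" by (rule Basis_le_norm)
      then show "- real k \<le> y \<bullet> b \<and> y \<bullet> b < real k" using k0 that by linarith
    qed
    then have "\<forall>\<^sub>F k in sequentially. exp (- V y) * \<phi> y = indicator (cube (real k)) y * (exp (- V y) * \<phi> y)"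
      by (auto intro!: eventually_mono[OF eventually_ge_at_top[of k0]])
    then show "(\<lambda>k. indicator (cube (real k)) y * (exp (- V y) * \<phi> y)) \<longlonglongrightarrow> exp (- V y) * \<phi> y"
      by (rule Lim_transform_eventually[OF tendsto_const])
  qed
qed (use int in \<open>auto simp: indicator_def\<close>)

section \<open>Passage to the limit\<close>

text \<open>The loss \<open>3 * \<delta>\<close> has three sources: the grid tolerance, the slack in
  the covariance control, and the slack in the mean of \<open>\<rho>\<close> over the cube.\<close>

lemma (in convex_potential) poincare_cube:
  assumes \<rho>_cont: "continuous_on UNIV \<rho>"
    and R: "R > 0" and \<delta>: "0 < \<delta>" "\<delta> < 1" "\<delta> < \<rho>0"
    and f: "\<And>x. (f has_derivative (\<lambda>u. g x \<bullet> u)) (at x)" and g: "continuous_on UNIV g"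
    and cov: "\<forall>\<^sub>F N in sequentially. curved_grid.covariance_control (cube_grid R N) (R / N) V \<rho> \<epsilon> (\<kappa> + \<delta>)"
    and \<epsilon>: "\<epsilon> \<ge> 0" and \<kappa>: "\<kappa> \<ge> 0" and pos: "\<rho>0 + (1 - \<delta>) * \<epsilon> - 3 * \<delta> > 0"
    and mean_large: "cube_int V R \<rho> / cube_int V R (\<lambda>_. 1) > \<rho>0 + \<epsilon> + \<kappa> - \<delta>"
  shows "(\<rho>0 + (1 - \<delta>) * \<epsilon> - 3 * \<delta>) * (cube_int V R (\<lambda>x. (f x)^2) - (cube_int V R f)^2 / cube_int V R (\<lambda>_. 1))
    \<le> (1 + \<delta>) * cube_int V R (\<lambda>x. (norm (g x) + \<delta>)^2)"
proof -
  let ?\<Lambda> = "\<rho>0 + (1 - \<delta>) * \<epsilon> - 3 * \<delta>"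
  define S where "S = (\<lambda>N (\<phi> :: 'a \<Rightarrow> real). \<Sum>x\<in>cube_grid R N. exp (- V x) * \<phi> x)"
  define a where "a = (\<lambda>N. (R / real N) ^ DIM('a))"
  have f_cont: "continuous_on UNIV f" by (rule has_derivative_imp_continuous_on[OF f])
  have lim: "(\<lambda>N. a N * S N \<phi>) \<longlonglongrightarrow> cube_int V R \<phi>" if "continuous_on UNIV \<phi>" for \<phi>
    unfolding a_def S_def by (rule weighted_riemann_sum_tendsto[OF V_cont that R])
  have l1: "(\<lambda>N. a N * S N (\<lambda>_. 1)) \<longlonglongrightarrow> cube_int V R (\<lambda>_. 1)" by (rule lim) simp
  \<comment> \<open>Division by zero gives 0, which \<open>mean_large\<close> excludes because
    \<open>\<delta> < \<rho>0\<close>.\<close>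
  have nz: "cube_int V R (\<lambda>_. 1) \<noteq> 0" using mean_large \<delta> \<epsilon> \<kappa> by auto
  have a_pos: "a N > 0" if "N > 0" for N using R that by (simp add: a_def)
  have "(\<lambda>N. (a N * S N \<rho>) / (a N * S N (\<lambda>_. 1))) \<longlonglongrightarrow> cube_int V R \<rho> / cube_int V R (\<lambda>_. 1)"
    by (rule tendsto_divide[OF lim[OF \<rho>_cont] l1 nz])
  then have ev_mean: "\<forall>\<^sub>F N in sequentially. \<rho>0 + \<epsilon> + \<kappa> - \<delta> < (a N * S N \<rho>) / (a N * S N (\<lambda>_. 1))"
    by (rule order_tendstoD(1)[OF _ mean_large])
  have "\<forall>\<^sub>F N in sequentially. ?\<Lambda> * (a N * S N (\<lambda>x. (f x)^2) - (a N * S N f)^2 / (a N * S N (\<lambda>_. 1)))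
      \<le> (1 + \<delta>) * (a N * S N (\<lambda>x. (norm (g x) + \<delta>)^2))"
    using ev_mean cov eventually_curved_grid[OF R \<delta>] eventually_grd_le[OF f g R \<delta>(1)] eventually_gt_at_top[of 0]
  proof eventually_elim
    case (elim N)
    define h where "h = R / real N"
    interpret curved_grid "cube_grid R N :: 'a set" h V \<rho> \<rho>0 \<delta>
      using elim(3) by (simp add: h_def)
    have aN: "a N > 0" by (rule a_pos) (use elim in simp)
    have Z: "Z = S N (\<lambda>_. 1)" by (simp add: Z_def S_def m_def)
    have mean: "mean \<phi> = S N \<phi> / S N (\<lambda>_. 1)" for \<phi> by (simp add: mean_def Z) (simp add: S_def m_def)
    have ml: "\<rho>0 + \<epsilon> + \<kappa> - \<delta> < mean \<rho>" using elim(1) aN by (simp add: mean)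
    have main: "(\<rho>0 + (1 - \<delta>) * \<epsilon> - \<delta> - 2 * \<delta>) * h^2 * (\<Sum>x\<in>cube_grid R N. m x * (f x - mean f)^2)
      \<le> (1 + \<delta>) * (\<Sum>x\<in>cube_grid R N. m x * (norm (grd f x))^2)"
      by (rule poincare_improved[OF elim(2)[folded h_def]]) (use ml \<epsilon> \<delta> pos in auto)
    have var: "(\<Sum>x\<in>cube_grid R N. m x * (f x - mean f)^2) = S N (\<lambda>x. (f x)^2) - (S N f)^2 / S N (\<lambda>_. 1)"
    proof -
      have "Z * (mean f)^2 = (S N f)^2 / S N (\<lambda>_. 1)" using Z_pos unfolding mean Z by (simp add: power2_eq_square)
      then show ?thesis unfolding sum_centered_square by (simp add: S_def m_def)
    qed
    have "(\<Sum>x\<in>cube_grid R N. m x * (norm (grd f x))^2) \<le> (\<Sum>x\<in>cube_grid R N. m x * (h^2 * (norm (g x) + \<delta>)^2))"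
    proof (intro sum_mono mult_left_mono)
      fix x :: 'a assume "x \<in> cube_grid R N"
      then have "norm (grd f x) \<le> h * (norm (g x) + \<delta>)" using elim(4) by (simp add: h_def)
      then have "(norm (grd f x))^2 \<le> (h * (norm (g x) + \<delta>))^2" by (rule power_mono) simp
      then show "(norm (grd f x))^2 \<le> h^2 * (norm (g x) + \<delta>)^2" by (simp only: power_mult_distrib)
    qed (simp add: m_pos less_imp_le)
    also have "\<dots> = h^2 * S N (\<lambda>x. (norm (g x) + \<delta>)^2)"
      unfolding S_def sum_distrib_left by (intro sum.cong refl) (simp add: m_def mult_ac)
    finally have "(1 + \<delta>) * (\<Sum>x\<in>cube_grid R N. m x * (norm (grd f x))^2) \<le> (1 + \<delta>) * (h^2 * S N (\<lambda>x. (norm (g x) + \<delta>)^2))"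
      using \<delta> by (intro mult_left_mono) auto
    with main have "h^2 * (?\<Lambda> * (S N (\<lambda>x. (f x)^2) - (S N f)^2 / S N (\<lambda>_. 1))) \<le> h^2 * ((1 + \<delta>) * S N (\<lambda>x. (norm (g x) + \<delta>)^2))"
      unfolding var by (simp add: mult_ac)
    then have "?\<Lambda> * (S N (\<lambda>x. (f x)^2) - (S N f)^2 / S N (\<lambda>_. 1)) \<le> (1 + \<delta>) * S N (\<lambda>x. (norm (g x) + \<delta>)^2)"
      using h_pos by simp
    \<comment> \<open>Both sides are homogeneous of degree one in the sums, so the cell volume
      \<open>a N\<close> can be distributed to make each of them a Riemann sum.\<close>
    then have "a N * (?\<Lambda> * (S N (\<lambda>x. (f x)^2) - (S N f)^2 / S N (\<lambda>_. 1))) \<le> a N * ((1 + \<delta>) * S N (\<lambda>x. (norm (g x) + \<delta>)^2))"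
      using aN by simp
    moreover have "a N * (?\<Lambda> * (s - t^2 / z)) = ?\<Lambda> * (a N * s - (a N * t)^2 / (a N * z))" for s t z
    proof -
      have e: "(a N * t)^2 / (a N * z) = a N * (t^2 / z)" using aN by (simp add: power2_eq_square)
      show ?thesis unfolding e right_diff_distrib[symmetric] by (simp only: mult.left_commute)
    qed
    ultimately show ?case by (simp only: mult.left_commute[of "a N"])
  qed
  then show ?thesis
    by (intro tendsto_le[OF sequentially_bot _ _]) (auto intro!: tendsto_intros lim l1 nz continuous_intros f_cont g)
qed

text \<open>The order of limits matters: the mesh tends to zero for a fixed cube and
  \<open>\<delta>\<close>, then the cube exhausts the space, and \<open>\<delta>\<close> tends to 0
  last. Integrability of \<open>norm (g y)\<close> serves the mixed term of
  \<open>(norm (g y) + \<delta>)^2\<close>.\<close>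

lemma (in convex_potential) poincare_gibbs:
  defines "I \<equiv> \<lambda>\<phi>. \<integral>y. exp (- V y) * \<phi> y \<partial>lborel"
  assumes \<rho>_cont: "continuous_on UNIV \<rho>"
    and f: "\<And>x. (f has_derivative (\<lambda>u. g x \<bullet> u)) (at x)" and g: "continuous_on UNIV g"
    and cov: "\<And>R \<delta>. R > 0 \<Longrightarrow> \<delta> > 0 \<Longrightarrow> \<forall>\<^sub>F N in sequentially. curved_grid.covariance_control (cube_grid R N) (R / N) V \<rho> \<epsilon> (\<kappa> + \<delta>)"
    and \<epsilon>: "\<epsilon> \<ge> 0" and \<kappa>: "\<kappa> \<ge> 0"
    and int_V: "integrable lborel (\<lambda>y. exp (- V y))"
    and int_\<rho>: "integrable lborel (\<lambda>y. exp (- V y) * \<rho> y)"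
    and int_f: "integrable lborel (\<lambda>y. exp (- V y) * (f y)^2)"
    and int_f1: "integrable lborel (\<lambda>y. exp (- V y) * f y)"
    and int_g1: "integrable lborel (\<lambda>y. exp (- V y) * norm (g y))"
    and int_g: "integrable lborel (\<lambda>y. exp (- V y) * (norm (g y))^2)"
    and I1: "I (\<lambda>_. 1) > 0"
    and mean_large: "I \<rho> / I (\<lambda>_. 1) \<ge> \<rho>0 + \<epsilon> + \<kappa>"
  shows "(\<rho>0 + \<epsilon>) * (I (\<lambda>x. (f x)^2) - (I f)^2 / I (\<lambda>_. 1)) \<le> I (\<lambda>x. (norm (g x))^2)"
proof -
  have f_cont: "continuous_on UNIV f" by (rule has_derivative_imp_continuous_on[OF f])
  let ?W = "I (\<lambda>x. (f x)^2) - (I f)^2 / I (\<lambda>_. 1)"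
  let ?G = "\<lambda>\<delta>. I (\<lambda>x. (norm (g x))^2) + 2 * \<delta> * I (\<lambda>x. norm (g x)) + \<delta>^2 * I (\<lambda>_. 1)"
  have expand: "(\<lambda>y. exp (- V y) * (norm (g y) + \<delta>)^2) = (\<lambda>y. exp (- V y) * (norm (g y))^2 + 2 * \<delta> * (exp (- V y) * norm (g y)) + \<delta>^2 * exp (- V y))" for \<delta>
    by (rule ext) (simp add: power2_eq_square algebra_simps)
  have int_gd: "integrable lborel (\<lambda>y. exp (- V y) * (norm (g y) + \<delta>)^2)" for \<delta>
    unfolding expand by (intro Bochner_Integration.integrable_add integrable_mult_right int_g int_g1 int_V)
  have I_gd: "I (\<lambda>x. (norm (g x) + \<delta>)^2) = ?G \<delta>" for \<delta>
    unfolding I_def expand using int_g int_g1 int_V by simp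
  have lim: "(\<lambda>k. cube_int V (real k) \<phi>) \<longlonglongrightarrow> I \<phi>" if "integrable lborel (\<lambda>y. exp (- V y) * \<phi> y)" for \<phi>
    unfolding I_def by (rule cube_int_tendsto[OF that])
  have l1: "(\<lambda>k. cube_int V (real k) (\<lambda>_. 1)) \<longlonglongrightarrow> I (\<lambda>_. 1)" by (rule lim) (use int_V in simp)
  have nz: "I (\<lambda>_. 1) \<noteq> 0" using I1 by simp
  have step: "(\<rho>0 + (1 - \<delta>) * \<epsilon> - 3 * \<delta>) * ?W \<le> (1 + \<delta>) * ?G \<delta>"
    if \<delta>: "0 < \<delta>" "\<delta> < 1" "3 * \<delta> < \<rho>0" for \<delta>
  proof -
    have "(\<lambda>k. cube_int V (real k) \<rho> / cube_int V (real k) (\<lambda>_. 1)) \<longlonglongrightarrow> I \<rho> / I (\<lambda>_. 1)"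
      by (rule tendsto_divide[OF lim[OF int_\<rho>] l1 nz])
    moreover have "\<rho>0 + \<epsilon> + \<kappa> - \<delta> < I \<rho> / I (\<lambda>_. 1)" using mean_large \<delta> by linarith
    ultimately have "\<forall>\<^sub>F k in sequentially. \<rho>0 + \<epsilon> + \<kappa> - \<delta> < cube_int V (real k) \<rho> / cube_int V (real k) (\<lambda>_. 1)"
      by (rule order_tendstoD(1))
    then have "\<forall>\<^sub>F k in sequentially. (\<rho>0 + (1 - \<delta>) * \<epsilon> - 3 * \<delta>) * (cube_int V (real k) (\<lambda>x. (f x)^2) - (cube_int V (real k) f)^2 / cube_int V (real k) (\<lambda>_. 1))
      \<le> (1 + \<delta>) * cube_int V (real k) (\<lambda>x. (norm (g x) + \<delta>)^2)"
      using eventually_gt_at_top[of 0]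
    proof eventually_elim
      case (elim k)
      have "(1 - \<delta>) * \<epsilon> \<ge> 0" using \<delta> \<epsilon> by simp
      then show ?case
        by (intro poincare_cube[OF \<rho>_cont _ \<delta>(1,2) _ f g cov \<epsilon> \<kappa> _ elim(1)]) (use \<delta> elim in auto)
    qed
    then have "(\<rho>0 + (1 - \<delta>) * \<epsilon> - 3 * \<delta>) * ?W \<le> (1 + \<delta>) * I (\<lambda>x. (norm (g x) + \<delta>)^2)"
      by (intro tendsto_le[OF sequentially_bot _ _]) (auto intro!: tendsto_intros lim l1 nz int_f int_f1 int_gd)
    then show ?thesis unfolding I_gd .
  qed
  have "((\<lambda>\<delta>. (\<rho>0 + (1 - \<delta>) * \<epsilon> - 3 * \<delta>) * ?W) \<longlongrightarrow> (\<rho>0 + (1 - 0) * \<epsilon> - 3 * 0) * ?W) (at_right 0)"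
    by (intro tendsto_intros)
  moreover have "((\<lambda>\<delta>. (1 + \<delta>) * ?G \<delta>) \<longlongrightarrow> (1 + 0) * ?G 0) (at_right 0)"
    by (intro tendsto_intros)
  moreover have "\<forall>\<^sub>F \<delta> in at_right 0. (\<rho>0 + (1 - \<delta>) * \<epsilon> - 3 * \<delta>) * ?W \<le> (1 + \<delta>) * ?G \<delta>"
  proof -
    have "\<forall>\<^sub>F \<delta> in at_right (0::real). \<delta> \<in> {0<..<min 1 (\<rho>0 / 3)}"
      by (rule eventually_at_right_real) (use \<rho>0_pos in simp)
    then show ?thesis by eventually_elim (rule step, auto)
  qed
  ultimately have "(\<rho>0 + (1 - 0) * \<epsilon> - 3 * 0) * ?W \<le> (1 + 0) * ?G 0"
    by (intro tendsto_le[of "at_right (0::real)"]) auto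
  then show ?thesis by simp
qed

section \<open>Smoothing Lipschitz functions\<close>

text \<open>Squaring removes the kink of the positive part; this makes the smoothing kernel
  continuously differentiable.\<close>

lemma max0_square_has_derivative:
  "((\<lambda>t::real. (max 0 t)^2) has_field_derivative 2 * max 0 t) (at t)"
proof (cases t "0::real" rule: linorder_cases)
  case less
  have "((\<lambda>t::real. 0) has_field_derivative 0) (at t)" by simp
  then have "((\<lambda>t::real. (max 0 t)^2) has_field_derivative 0) (at t)"
    by (rule has_field_derivative_transform_within_open[of _ _ _ "{..<0}"]) (use less in auto)
  then show ?thesis using less by simp
next
  case equal
  have "((\<lambda>h::real. (max 0 h)^2 / h) \<longlongrightarrow> 0) (at 0)"
  proof (rule Lim_null_comparison)
    show "\<forall>\<^sub>F h in at 0. norm ((max 0 h)^2 / h) \<le> \<bar>h\<bar>" for h :: real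
      by (rule always_eventually) (auto simp: max_def power2_eq_square)
    show "((\<lambda>h::real. \<bar>h\<bar>) \<longlongrightarrow> 0) (at 0)" by (rule tendsto_rabs_zero) simp
  qed
  then show ?thesis using equal by (simp add: DERIV_def)
next
  case greater
  have "((\<lambda>t::real. t^2) has_field_derivative 2 * t) (at t)" by (auto intro!: derivative_eq_intros)
  then have "((\<lambda>t::real. (max 0 t)^2) has_field_derivative 2 * t) (at t)"
    by (rule has_field_derivative_transform_within_open[of _ _ _ "{0<..}"]) (use greater in auto)
  then show ?thesis using greater by simp
qed

text \<open>Convolution with the \<open>C\<^sup>1\<close> bump \<open>(max 0 (\<tau>^2 - |y|^2))^2\<close>; cutting the domain of integration
  to a large cube keeps the smoothing \<open>C\<^sup>1\<close> everywhere, and exact on the ball of radius \<open>S\<close>.\<close>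
lemma lipschitz_smoothing:
  fixes \<rho> :: "'a::euclidean_space \<Rightarrow> real"
  assumes lip: "L-lipschitz_on UNIV \<rho>" and \<sigma>: "\<sigma> > 0" and S: "S \<ge> 0"
  obtains s g where "\<And>x. (s has_derivative (\<lambda>u. g x \<bullet> u)) (at x)" "continuous_on UNIV g"
    "\<And>x. norm x \<le> S \<Longrightarrow> norm (g x) \<le> L" "\<And>x. norm x \<le> S \<Longrightarrow> \<bar>\<rho> x - s x\<bar> \<le> \<sigma>"
proof -
  have L: "L \<ge> 0" using lip by (rule lipschitz_on_nonneg)
  have lipD: "\<bar>\<rho> x - \<rho> y\<bar> \<le> L * norm (x - y)" for x y
    using lipschitz_onD[OF lip, of x y] by (simp add: dist_norm)
  have \<rho>_cont: "continuous_on A \<rho>" for A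
    using lipschitz_on_continuous_on[OF lip] continuous_on_subset by blast
  \<comment> \<open>\<open>L + 1\<close> rather than \<open>L\<close>, which may be 0; points within
    distance \<open>\<tau>\<close> have values of \<open>\<rho>\<close> within
    \<open>\<sigma>\<close>.\<close>
  define \<tau> where "\<tau> = \<sigma> / (L + 1)"
  have \<tau>: "\<tau> > 0" "L * \<tau> \<le> \<sigma>" using \<sigma> L by (auto simp: \<tau>_def field_simps)
  define k :: "'a \<Rightarrow> real" where "k = (\<lambda>y. (max 0 (\<tau>^2 - y \<bullet> y))^2)"
  have k_cont: "continuous_on A k" for A unfolding k_def by (intro continuous_intros)
  have k_nonneg: "k y \<ge> 0" for y by (simp add: k_def)
  have k_zero: "k y = 0" if "norm y \<ge> \<tau>" for y
  proof -
    have "\<tau>^2 \<le> (norm y)^2" using that \<tau> by (intro power_mono) auto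
    then show ?thesis by (simp add: k_def power2_norm_eq_inner[symmetric])
  qed
  \<comment> \<open>The extra 1 leaves room for the difference quotients in \<open>g_le\<close>,
    which may leave the ball of radius \<open>S\<close>.\<close>
  define M where "M = S + 1 + \<tau>"
  define B :: "'a set" where "B = cbox (- M *\<^sub>R One) (M *\<^sub>R One)"
  have in_B: "z \<in> B" if "norm z \<le> M" for z
    unfolding B_def mem_box
  proof
    fix b :: 'a assume b: "b \<in> Basis"
    then have "\<bar>z \<bullet> b\<bar> \<le> M" using Basis_le_norm[OF b, of z] that by linarith
    then show "(- M *\<^sub>R One) \<bullet> b \<le> z \<bullet> b \<and> z \<bullet> b \<le> (M *\<^sub>R One) \<bullet> b" using b by (simp add: abs_le_iff)
  qed
  have supp: "k (z - x) = 0" if "norm x \<le> S + 1" "z \<notin> B" for x z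
  proof (rule k_zero)
    have "norm z > M" using in_B that(2) by force
    then show "\<tau> \<le> norm (z - x)" using norm_triangle_ineq2[of z x] that(1) by (simp add: M_def)
  qed
  have meas_supp: "integrable lborel f" and int_supp: "(\<integral>z. f z \<partial>lborel) = integral B f"
    if c: "continuous_on UNIV f" and z: "\<And>z. z \<notin> B \<Longrightarrow> f z = 0" for f :: "'a \<Rightarrow> real"
  proof -
    have eq: "(\<lambda>z. indicator B z *\<^sub>R f z) = f" by (rule ext) (use z in \<open>auto simp: indicator_def\<close>)
    have si: "set_integrable lborel B f"
      unfolding set_integrable_def by (rule borel_integrable_compact) (auto simp: B_def intro: continuous_on_subset[OF c])
    then show "integrable lborel f" unfolding set_integrable_def eq .
    show "(\<integral>z. f z \<partial>lborel) = integral B f"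
      using set_borel_integral_eq_integral(2)[OF si] unfolding set_lebesgue_integral_def eq .
  qed
  have k_int: "integrable lborel k"
    by (rule meas_supp[OF k_cont]) (use supp[of 0] S in auto)
  define c where "c = (\<integral>y. k y \<partial>lborel)"
  have c: "c > 0"
  proof -
    have "(\<integral>y. (3 * \<tau>^2 / 4)^2 * indicator (ball (0::'a) (\<tau> / 2)) y \<partial>lborel) \<le> c"
      unfolding c_def
    proof (rule Bochner_Integration.integral_mono)
      show "integrable lborel (\<lambda>y::'a. (3 * \<tau>^2 / 4)^2 * indicator (ball 0 (\<tau> / 2)) y)"
        by (intro integrable_mult_right integrable_real_indicator emeasure_bounded_finite) auto
      show "(3 * \<tau>^2 / 4)^2 * indicator (ball 0 (\<tau> / 2)) y \<le> k y" for y :: 'a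
      proof (cases "y \<in> ball 0 (\<tau> / 2)")
        case True
        then have "(norm y)^2 \<le> (\<tau> / 2)^2" by (intro power_mono) auto
        then have "3 * \<tau>^2 / 4 \<le> \<tau>^2 - y \<bullet> y" by (simp add: power2_norm_eq_inner[symmetric] power_divide)
        then have "3 * \<tau>^2 / 4 \<le> max 0 (\<tau>^2 - y \<bullet> y)" by (rule max.coboundedI2)
        then have "(3 * \<tau>^2 / 4)^2 \<le> (max 0 (\<tau>^2 - y \<bullet> y))^2" by (rule power_mono) simp
        then show ?thesis using True by (simp add: k_def)
      qed (simp add: k_nonneg)
    qed (rule k_int)
    moreover have "(\<integral>y. (3 * \<tau>^2 / 4)^2 * indicator (ball (0::'a) (\<tau> / 2)) y \<partial>lborel) > 0"
      using \<tau> content_ball_pos[of "\<tau> / 2" "0::'a"] by simp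
    ultimately show ?thesis by linarith
  qed
  \<comment> \<open>\<open>x\<close> occurs only in the kernel and the domain is fixed, so one can
    differentiate under the integral although \<open>\<rho>\<close> is merely Lipschitz.\<close>
  define F where "F = (\<lambda>x. integral B (\<lambda>z. \<rho> z * k (z - x)))"
  define fx :: "'a \<Rightarrow> 'a \<Rightarrow> 'a \<Rightarrow>\<^sub>L real" where
    "fx = (\<lambda>x z. blinfun_inner_right ((\<rho> z * (2 * max 0 (\<tau>^2 - (z - x) \<bullet> (z - x))) * 2) *\<^sub>R (z - x)))"
  have kd: "((\<lambda>x. \<rho> z * k (z - x)) has_derivative blinfun_apply (fx x z)) (at x within UNIV)" for x z
  proof -
    have inner: "((\<lambda>x. \<tau>^2 - (z - x) \<bullet> (z - x)) has_derivative (\<lambda>u. 2 * ((z - x) \<bullet> u))) (at x)"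
      by (auto intro!: derivative_eq_intros simp: inner_commute)
    have outer: "((\<lambda>t. (max 0 t)^2) has_derivative (\<lambda>s. 2 * max 0 t * s)) (at t)" for t :: real
      using max0_square_has_derivative[of t] by (simp add: has_field_derivative_def)
    have "((\<lambda>x. k (z - x)) has_derivative (\<lambda>u. 2 * max 0 (\<tau>^2 - (z - x) \<bullet> (z - x)) * (2 * ((z - x) \<bullet> u)))) (at x)"
      unfolding k_def by (rule has_derivative_compose[OF inner outer])
    then have "((\<lambda>x. \<rho> z * k (z - x)) has_derivative (\<lambda>u. \<rho> z * (2 * max 0 (\<tau>^2 - (z - x) \<bullet> (z - x)) * (2 * ((z - x) \<bullet> u))))) (at x)"
      by (rule has_derivative_mult_right)
    moreover have "blinfun_apply (fx x z) = (\<lambda>u. \<rho> z * (2 * max 0 (\<tau>^2 - (z - x) \<bullet> (z - x)) * (2 * ((z - x) \<bullet> u))))"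
      unfolding fx_def by (rule ext) (simp add: blinfun_inner_right.rep_eq)
    ultimately show ?thesis by simp
  qed
  have fx_cont: "continuous_on (UNIV \<times> cbox (- M *\<^sub>R One) (M *\<^sub>R One)) (\<lambda>(x, z). fx x z)"
    unfolding fx_def case_prod_unfold
    by (intro bounded_linear.continuous_on[OF bounded_linear_blinfun_inner_right] continuous_intros
        continuous_on_compose2[OF \<rho>_cont[of UNIV]]) auto
  define D where "D = (\<lambda>x. integral B (fx x))"
  have F_deriv: "(F has_derivative blinfun_apply (D x)) (at x)" for x
    unfolding F_def D_def B_def
    by (rule leibniz_rule[where U = UNIV, OF kd _ fx_cont])
      (auto intro!: integrable_continuous continuous_intros \<rho>_cont continuous_on_compose2[OF k_cont[of UNIV]])
  have D_cont: "continuous_on UNIV D"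
    unfolding D_def B_def by (rule integral_continuous_on_param[OF fx_cont])
  define s where "s = (\<lambda>x. F x / c)"
  define g where "g = (\<lambda>x. (\<Sum>b\<in>Basis. (D x b / c) *\<^sub>R b))"
  have g_inner: "g x \<bullet> u = D x u / c" for x u
  proof -
    have "D x u = D x (\<Sum>b\<in>Basis. (u \<bullet> b) *\<^sub>R b)" by (simp add: euclidean_representation)
    also have "\<dots> = (\<Sum>b\<in>Basis. (u \<bullet> b) * D x b)" by (simp add: blinfun.sum_right blinfun.scaleR_right)
    finally have "D x u / c = (\<Sum>b\<in>Basis. (D x b / c) * (b \<bullet> u))"
      by (simp add: sum_divide_distrib inner_commute mult.commute)
    then show ?thesis unfolding g_def inner_sum_left inner_scaleR_left by simp
  qed
  have s_deriv: "(s has_derivative (\<lambda>u. g x \<bullet> u)) (at x)" for x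
    unfolding s_def g_inner by (rule bounded_linear.has_derivative[OF bounded_linear_divide F_deriv])
  have g_cont: "continuous_on UNIV g"
    unfolding g_def by (intro continuous_intros D_cont) (use c in auto)
  \<comment> \<open>For these \<open>x\<close> the kernel vanishes outside \<open>B\<close>, so the
    cut is invisible, and translation invariance moves \<open>x\<close> into \<open>\<rho>\<close>,
    where the Lipschitz bound acts.\<close>
  have conv: "F x = (\<integral>y. \<rho> (x + y) * k y \<partial>lborel)" and conv_int: "integrable lborel (\<lambda>y. \<rho> (x + y) * k y)"
    if x: "norm x \<le> S + 1" for x
  proof -
    have cont: "continuous_on UNIV (\<lambda>z. \<rho> z * k (z - x))"
      by (intro continuous_intros \<rho>_cont continuous_on_compose2[OF k_cont[of UNIV]]) auto
    have i: "integrable lborel (\<lambda>z. \<rho> z * k (z - x))"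
      by (rule meas_supp[OF cont]) (simp add: supp[OF x])
    have "F x = (\<integral>z. \<rho> z * k (z - x) \<partial>lborel)"
      unfolding F_def by (rule int_supp[OF cont, symmetric]) (simp add: supp[OF x])
    also have "\<dots> = (\<integral>z. \<rho> z * k (z - x) \<partial>distr lborel borel ((+) x))" by (simp add: lborel_distr_plus)
    also have "\<dots> = (\<integral>y. \<rho> (x + y) * k (x + y - x) \<partial>lborel)"
      by (rule integral_distr) (use borel_measurable_integrable[OF i] in auto)
    finally show "F x = (\<integral>y. \<rho> (x + y) * k y \<partial>lborel)" by simp
    have "integrable (distr lborel borel ((+) x)) (\<lambda>z. \<rho> z * k (z - x))" using i by (simp add: lborel_distr_plus)
    then have "integrable lborel (\<lambda>y. \<rho> (x + y) * k (x + y - x))"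
      by (subst (asm) integrable_distr_eq) (use borel_measurable_integrable[OF i] in auto)
    then show "integrable lborel (\<lambda>y. \<rho> (x + y) * k y)" by simp
  qed
  have near: "\<bar>\<rho> x - s x\<bar> \<le> \<sigma>" if x: "norm x \<le> S" for x
  proof -
    have x1: "norm x \<le> S + 1" using x by simp
    have "c * \<rho> x - F x = (\<integral>y. \<rho> x * k y - \<rho> (x + y) * k y \<partial>lborel)"
      unfolding c_def conv[OF x1] using k_int conv_int[OF x1] by simp
    also have "norm \<dots> \<le> (\<integral>y. \<sigma> * k y \<partial>lborel)"
    proof (rule Bochner_Integration.integral_norm_bound_integral)
      show "norm (\<rho> x * k y - \<rho> (x + y) * k y) \<le> \<sigma> * k y" for y
      proof (cases "norm y \<ge> \<tau>")
        case False
        have "\<bar>\<rho> x - \<rho> (x + y)\<bar> \<le> L * norm y" using lipD[of x "x + y"] by simp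
        also have "\<dots> \<le> L * \<tau>" using False L by (intro mult_left_mono) auto
        finally have "\<bar>\<rho> x - \<rho> (x + y)\<bar> * k y \<le> \<sigma> * k y" using \<tau> k_nonneg by (intro mult_right_mono) auto
        then show ?thesis using k_nonneg[of y] by (simp add: left_diff_distrib[symmetric] abs_mult)
      qed (simp add: k_zero)
    qed (use k_int conv_int[OF x1] in auto)
    also have "\<dots> = \<sigma> * c" by (simp add: c_def)
    finally have "\<bar>c * \<rho> x - F x\<bar> \<le> \<sigma> * c" by simp
    moreover have "c * \<rho> x - F x = c * (\<rho> x - s x)" using c by (simp add: s_def right_diff_distrib)
    ultimately show ?thesis using c by (simp add: abs_mult mult.commute)
  qed
  have s_lip: "\<bar>s x - s y\<bar> \<le> L * norm (x - y)" if x: "norm x \<le> S + 1" and y: "norm y \<le> S + 1" for x y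
  proof -
    have "F x - F y = (\<integral>z. \<rho> (x + z) * k z - \<rho> (y + z) * k z \<partial>lborel)"
      unfolding conv[OF x] conv[OF y] using conv_int[OF x] conv_int[OF y] by simp
    also have "norm \<dots> \<le> (\<integral>z. (L * norm (x - y)) * k z \<partial>lborel)"
    proof (rule Bochner_Integration.integral_norm_bound_integral)
      show "norm (\<rho> (x + z) * k z - \<rho> (y + z) * k z) \<le> (L * norm (x - y)) * k z" for z
        using mult_right_mono[OF lipD[of "x + z" "y + z"] k_nonneg[of z]] k_nonneg[of z]
        by (simp add: left_diff_distrib[symmetric] abs_mult)
    qed (use k_int conv_int[OF x] conv_int[OF y] in auto)
    also have "\<dots> = L * norm (x - y) * c" by (simp add: c_def)
    finally have "\<bar>F x - F y\<bar> \<le> L * norm (x - y) * c" by simp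
    moreover have "F x - F y = c * (s x - s y)" using c by (simp add: s_def right_diff_distrib)
    ultimately show ?thesis using c by (simp add: abs_mult mult.commute)
  qed
  \<comment> \<open>The norm of a gradient is the derivative in its own direction, a limit of
    difference quotients that \<open>s_lip\<close> bounds.\<close>
  have g_le: "norm (g x) \<le> L" if x: "norm x \<le> S" for x
  proof (cases "g x = 0")
    case False
    define v where "v = g x /\<^sub>R norm (g x)"
    have v: "norm v = 1" using False by (simp add: v_def)
    have gv: "g x \<bullet> v = norm (g x)" using False by (simp add: v_def power2_norm_eq_inner[symmetric] power2_eq_square)
    have line: "((\<lambda>t. s (x + t *\<^sub>R v)) has_derivative (\<lambda>t. g x \<bullet> (t *\<^sub>R v))) (at 0)"
    proof -
      have "((\<lambda>t. x + t *\<^sub>R v) has_derivative (\<lambda>t. t *\<^sub>R v)) (at 0)" by (auto intro!: derivative_eq_intros)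
      moreover have "(s has_derivative (\<lambda>u. g x \<bullet> u)) (at (x + 0 *\<^sub>R v))" using s_deriv by simp
      ultimately show ?thesis by (rule has_derivative_compose)
    qed
    moreover have "(\<lambda>t. g x \<bullet> (t *\<^sub>R v)) = (*) (norm (g x))"
      by (rule ext) (simp add: gv mult.commute)
    ultimately have "((\<lambda>t. s (x + t *\<^sub>R v)) has_field_derivative norm (g x)) (at 0)"
      by (simp add: has_field_derivative_def)
    then have "((\<lambda>t. (s (x + t *\<^sub>R v) - s x) / t) \<longlongrightarrow> norm (g x)) (at 0)"
      by (simp add: DERIV_def)
    then have "((\<lambda>t. (s (x + t *\<^sub>R v) - s x) / t) \<longlongrightarrow> norm (g x)) (at_right 0)"
      by (rule filterlim_mono) (auto simp: at_le)
    moreover have "\<forall>\<^sub>F t in at_right 0. (s (x + t *\<^sub>R v) - s x) / t \<le> L"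
    proof -
      have "\<forall>\<^sub>F t in at_right (0::real). t \<in> {0<..<1}" by (rule eventually_at_right_real) simp
      then show ?thesis
      proof eventually_elim
        case (elim t)
        have "norm (x + t *\<^sub>R v) \<le> S + 1"
          using norm_triangle_ineq[of x "t *\<^sub>R v"] x v elim by simp
        then have "\<bar>s (x + t *\<^sub>R v) - s x\<bar> \<le> L * norm (x + t *\<^sub>R v - x)" using x by (intro s_lip) auto
        also have "\<dots> = L * t" using v elim by simp
        finally show ?case using elim by (simp add: divide_le_eq)
      qed
    qed
    ultimately show ?thesis by (intro tendsto_upperbound) auto
  qed (simp add: L)
  show ?thesis using that[OF s_deriv g_cont g_le near] .
qed

section \<open>Covariance control and the smallest eigenvalue\<close>

lemma (in convex_potential) covariance_control_osc:
  assumes osc: "\<And>x. a \<le> \<rho> x" "\<And>x. \<rho> x \<le> a + \<omega>" and \<epsilon>: "\<epsilon> \<ge> 0" and R: "R > 0" and \<delta>: "\<delta> > 0"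
  shows "\<forall>\<^sub>F N in sequentially. curved_grid.covariance_control (cube_grid R N) (R / N) V \<rho> \<epsilon> (\<omega> * sqrt (2 * \<epsilon> / \<rho>0) + \<delta>)"
proof -
  have \<omega>: "\<omega> \<ge> 0" using osc[of 0] by linarith
  \<comment> \<open>A tenth of 1 and of \<open>\<rho>0\<close> gives at most
    \<open>(11/10) / (81/100) < 2\<close> for the ratio times \<open>\<rho>0\<close>. This tolerance
    stays fixed as the mesh shrinks.\<close>
  define \<eta> where "\<eta> = min (1/10) (\<rho>0 / 10)"
  have \<eta>: "0 < \<eta>" "\<eta> < 1" "\<eta> < \<rho>0" "\<eta> \<le> 1/10" "\<eta> \<le> \<rho>0 / 10" using \<rho>0_pos by (auto simp: \<eta>_def)
  have ratio: "(1 + \<eta>) / ((1 - \<eta>) * (\<rho>0 - \<eta>)) \<le> 2 / \<rho>0"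
  proof -
    have "(9/10) * (9/10 * \<rho>0) \<le> (1 - \<eta>) * (\<rho>0 - \<eta>)" using \<eta> \<rho>0_pos by (intro mult_mono) auto
    then have "(1 + \<eta>) / ((1 - \<eta>) * (\<rho>0 - \<eta>)) \<le> (11/10) / ((9/10) * (9/10 * \<rho>0))"
      using \<eta> \<rho>0_pos by (intro frac_le) auto
    also have "\<dots> \<le> 2 / \<rho>0" using \<rho>0_pos by (simp add: field_simps)
    finally show ?thesis .
  qed
  show ?thesis
    using eventually_curved_grid[OF R \<eta>(1-3)]
  proof eventually_elim
    case (elim N)
    interpret curved_grid "cube_grid R N :: 'a set" "R / N" V \<rho> \<rho>0 \<eta> by (rule elim)
    show ?case
      by (rule covariance_control_mono[OF covariance_osc[OF osc \<omega> \<epsilon> ratio]]) (use \<delta> in simp)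
  qed
qed

lemma (in convex_potential) covariance_control_lip:
  assumes lip: "L-lipschitz_on UNIV \<rho>" and \<epsilon>: "\<epsilon> \<ge> 0" and R: "R > 0" and \<delta>: "\<delta> > 0"
  shows "\<forall>\<^sub>F N in sequentially. curved_grid.covariance_control (cube_grid R N) (R / N) V \<rho> \<epsilon> (2 * L / \<rho>0 * sqrt \<epsilon> + \<delta>)"
proof -
  have L: "L \<ge> 0" using lip by (rule lipschitz_on_nonneg)
  \<comment> \<open>Its value at 0 is the desired bound. One small \<open>\<eta>\<close> then serves
    as curvature tolerance, as tolerance for the gradient of the smoothed \<open>\<rho>\<close>, and
    as a bound for the mesh.\<close>
  let ?\<Phi> = "\<lambda>\<eta>. (L + \<eta>) / (\<rho>0 - \<eta>) * (2 * sqrt ((1 + \<eta>) * \<epsilon>) + \<eta> * \<epsilon>)"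
  have "(?\<Phi> \<longlongrightarrow> (L + 0) / (\<rho>0 - 0) * (2 * sqrt ((1 + 0) * \<epsilon>) + 0 * \<epsilon>)) (at_right 0)"
    by (intro tendsto_intros) (use \<rho>0_pos in auto)
  then have "\<forall>\<^sub>F \<eta> in at_right 0. ?\<Phi> \<eta> < 2 * L / \<rho>0 * sqrt \<epsilon> + \<delta> / 2"
    by (rule order_tendstoD(2)) (use \<delta> in simp)
  moreover have "\<forall>\<^sub>F \<eta> in at_right (0::real). \<eta> \<in> {0<..<min 1 \<rho>0}"
    by (rule eventually_at_right_real) (use \<rho>0_pos in simp)
  ultimately have "\<forall>\<^sub>F \<eta> in at_right (0::real). ?\<Phi> \<eta> < 2 * L / \<rho>0 * sqrt \<epsilon> + \<delta> / 2 \<and> \<eta> \<in> {0<..<min 1 \<rho>0}"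
    by (rule eventually_conj)
  then obtain \<eta> where \<Phi>: "?\<Phi> \<eta> < 2 * L / \<rho>0 * sqrt \<epsilon> + \<delta> / 2" and \<eta>: "0 < \<eta>" "\<eta> < 1" "\<eta> < \<rho>0"
    using eventually_happens[of _ "at_right (0::real)"] by auto
  have "DIM('a) * R \<ge> 0" using R by simp
  \<comment> \<open>The smoothing error \<open>\<delta> / 4\<close> enters twice; the other
    \<open>\<delta> / 2\<close> is the room left by the choice of \<open>\<eta>\<close>.\<close>
  then obtain s gs where s: "\<And>x. (s has_derivative (\<lambda>u. gs x \<bullet> u)) (at x)" and gs: "continuous_on UNIV gs"
    and gs_le: "\<And>x. norm x \<le> DIM('a) * R \<Longrightarrow> norm (gs x) \<le> L"
    and near: "\<And>x. norm x \<le> DIM('a) * R \<Longrightarrow> \<bar>\<rho> x - s x\<bar> \<le> \<delta> / 4"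
    using lipschitz_smoothing[OF lip, of "\<delta> / 4" "DIM('a) * R"] \<delta> by (metis divide_pos_pos zero_less_numeral)
  show ?thesis
    using eventually_curved_grid[OF R \<eta>] eventually_grd_le[OF s gs R \<eta>(1)]
      eventually_mesh_small[OF \<eta>(1), of R]
  proof eventually_elim
    case (elim N)
    interpret curved_grid "cube_grid R N :: 'a set" "R / N" V \<rho> \<rho>0 \<eta> by (rule elim)
    have nx: "norm x \<le> DIM('a) * R" if "x \<in> cube_grid R N" for x :: 'a
      using norm_cube_grid[OF that] R by simp
    have grd_s: "norm (grd s x) \<le> R / N * (L + \<eta>)" if "x \<in> cube_grid R N" for x
    proof -
      have "norm (grd s x) \<le> R / N * (norm (gs x) + \<eta>)" using elim(2) that by blast
      also have "\<dots> \<le> R / N * (L + \<eta>)" using gs_le[OF nx[OF that]] R by (intro mult_left_mono) auto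
      finally show ?thesis .
    qed
    show ?case
    proof (rule covariance_control_mono[OF covariance_lip[OF \<epsilon> grd_s _ near[OF nx]]])
      have "(L + \<eta>) / (\<rho>0 - \<eta>) * (2 * sqrt ((1 + \<eta>) * \<epsilon>) + R / N * \<epsilon>) \<le> ?\<Phi> \<eta>"
        using elim(3) \<epsilon> L \<eta> by (intro mult_left_mono add_left_mono mult_right_mono) auto
      then show "2 * (\<delta> / 4) + (L + \<eta>) / (\<rho>0 - \<eta>) * (2 * sqrt ((1 + \<eta>) * \<epsilon>) + R / N * \<epsilon>)
          \<le> 2 * L / \<rho>0 * sqrt \<epsilon> + \<delta>" using \<Phi> by linarith
    qed (use L \<eta> in auto)
  qed
qed

text \<open>\<open>eps_prime m K\<close> is the smaller root of
  \<open>e^2 - 2 * (m + K) * e + m^2 = 0\<close>, equivalently of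
  \<open>(m - e)^2 = 2 * K * e\<close>. From \<open>K \<le> t\<close> one gets
  \<open>e \<le> m\<close>, which selects the nonnegative square root.\<close>

lemma eps_prime_root:
  assumes m: "m \<ge> 0" and K: "K \<ge> 0"
  shows "eps_prime m K \<ge> 0" "eps_prime m K + sqrt (2 * K * eps_prime m K) = m"
proof -
  define s where "s = m + K"
  define e where "e = eps_prime m K"
  define t where "t = sqrt (s^2 - m^2)"
  have sm: "m \<le> s" "s \<ge> 0" using m K by (auto simp: s_def)
  have "m^2 \<le> s^2" using m sm by (intro power_mono) auto
  then have t2: "t^2 = s^2 - m^2" by (simp add: t_def)
  have e: "e = s - t"
  proof (cases "s = 0")
    \<comment> \<open>Here \<open>m = K = 0\<close>; the quotient in \<open>eps_prime\<close> is a
      division by 0, and its prefactor is 0.\<close>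
    case True
    then have "m = 0" using m K by (simp add: s_def)
    then show ?thesis using True by (simp add: e_def eps_prime_def s_def[symmetric] t_def)
  next
    case False
    then have "s > 0" using sm by simp
    then have "s * sqrt (1 - m^2 / s^2) = sqrt (s^2 * (1 - m^2 / s^2))" by (simp add: real_sqrt_mult)
    also have "s^2 * (1 - m^2 / s^2) = s^2 - m^2" using False by (simp add: right_diff_distrib)
    finally have "s * sqrt (1 - m^2 / s^2) = t" by (simp add: t_def)
    then show ?thesis by (simp add: e_def eps_prime_def s_def[symmetric] right_diff_distrib)
  qed
  have t_le: "t \<le> s" unfolding t_def using sm by (intro real_le_lsqrt) auto
  then show "eps_prime m K \<ge> 0" using e by (simp add: e_def)
  have "K^2 \<le> s^2 - m^2" using m K by (simp add: s_def power2_eq_square algebra_simps)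
  then have t_ge: "K \<le> t" unfolding t_def by (rule real_le_rsqrt)
  have "2 * K * e = (m - e)^2" unfolding e using t2 by (simp add: s_def power2_eq_square algebra_simps)
  moreover have "m - e \<ge> 0" unfolding e using t_ge by (simp add: s_def)
  ultimately have "sqrt (2 * K * e) = m - e" by (simp add: real_sqrt_unique)
  then show "eps_prime m K + sqrt (2 * K * eps_prime m K) = m" by (simp add: e_def)
qed

text \<open>Two unfoldings of the coinductive predicate suffice: directional derivatives are again
  differentiable, hence continuous. The vector \<open>g x\<close> represents the derivative, and the
  operator norm of an inner product functional is the norm of its vector.\<close>

lemma smooth_fun_gradient:
  fixes f :: "'a::euclidean_space \<Rightarrow> real"
  assumes "smooth_fun f"
  obtains g where "\<And>x. (f has_derivative (\<lambda>u. g x \<bullet> u)) (at x)" "continuous_on UNIV g" "\<And>x. grad_norm f x = norm (g x)"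
proof -
  have fd: "f differentiable (at x)" and fs: "smooth_fun (\<lambda>x. frechet_derivative f (at x) u)" for x u
    using assms by (auto elim: smooth_fun.cases)
  define g where "g = (\<lambda>x. \<Sum>b\<in>Basis. frechet_derivative f (at x) b *\<^sub>R b)"
  have der: "(f has_derivative frechet_derivative f (at x)) (at x)" for x
    using fd frechet_derivative_works by blast
  have eq: "frechet_derivative f (at x) u = g x \<bullet> u" for x u
  proof -
    have lin: "linear (frechet_derivative f (at x))" using der has_derivative_linear by blast
    have "frechet_derivative f (at x) u = frechet_derivative f (at x) (\<Sum>b\<in>Basis. (u \<bullet> b) *\<^sub>R b)"
      by (simp add: euclidean_representation)
    also have "\<dots> = (\<Sum>b\<in>Basis. (u \<bullet> b) * frechet_derivative f (at x) b)"
      using lin by (simp add: linear_sum linear_scale)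
    finally have "frechet_derivative f (at x) u = (\<Sum>b\<in>Basis. frechet_derivative f (at x) b * (b \<bullet> u))"
      by (simp add: inner_commute mult.commute)
    then show ?thesis unfolding g_def inner_sum_left inner_scaleR_left .
  qed
  then have ext: "frechet_derivative f (at x) = (\<lambda>u. g x \<bullet> u)" for x by blast
  have "continuous_on UNIV (\<lambda>x. frechet_derivative f (at x) u)" for u
  proof -
    have "(\<lambda>x. frechet_derivative f (at x) u) differentiable (at x)" for x
      using fs[of u] by (auto elim: smooth_fun.cases)
    then show ?thesis
      by (intro continuous_at_imp_continuous_on ballI differentiable_imp_continuous_within)
  qed
  then have "continuous_on UNIV g" unfolding g_def by (intro continuous_intros)
  moreover have "grad_norm f x = norm (g x)" for x
    unfolding grad_norm_def ext
  proof (rule antisym)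
    show "onorm (\<lambda>u. g x \<bullet> u) \<le> norm (g x)"
      by (rule onorm_le) (simp add: Cauchy_Schwarz_ineq2)
    have "norm (g x \<bullet> g x) \<le> onorm (\<lambda>u. g x \<bullet> u) * norm (g x)"
      by (rule onorm) (rule bounded_linear_inner_right)
    then show "norm (g x) \<le> onorm (\<lambda>u. g x \<bullet> u)"
      by (cases "g x = 0") (auto simp: power2_norm_eq_inner[symmetric] power2_eq_square onorm_pos_le bounded_linear_inner_right)
  qed
  ultimately show ?thesis using that der ext by metis
qed

text \<open>The infimum of the quadratic form over the unit sphere varies by at most the operator
  norm of the change in \<open>HV\<close>, hence continuously, and it is the largest lower bound
  that the form admits.\<close>

lemma smallest_eigenvalue:
  fixes HV :: "'a::euclidean_space \<Rightarrow> 'a \<Rightarrow>\<^sub>L 'a"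
  assumes HV: "continuous_on UNIV HV"
  obtains l where "continuous_on UNIV l" "\<And>x u. u \<bullet> HV x u \<ge> l x * (norm u)^2"
    "\<And>x r. (\<And>u. u \<bullet> HV x u \<ge> r * (norm u)^2) \<Longrightarrow> r \<le> l x"
proof -
  define l where "l = (\<lambda>x. INF u\<in>sphere 0 1. u \<bullet> HV x u)"
  have ne: "sphere (0::'a) 1 \<noteq> {}" by simp
  have bd: "bdd_below ((\<lambda>u. u \<bullet> HV x u) ` sphere 0 1)" for x
  proof (rule bdd_belowI2)
    fix u :: 'a assume "u \<in> sphere 0 1"
    then show "- norm (HV x) \<le> u \<bullet> HV x u"
      using Cauchy_Schwarz_ineq2[of u "HV x u"] norm_blinfun[of "HV x" u] by simp
  qed
  have le: "l x \<le> l y + norm (HV x - HV y)" for x y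
  proof -
    have "l x - norm (HV x - HV y) \<le> l y"
      unfolding l_def
    proof (rule cINF_greatest[OF ne])
      fix u :: 'a assume u: "u \<in> sphere 0 1"
      have "(INF u\<in>sphere 0 1. u \<bullet> HV x u) \<le> u \<bullet> HV x u" by (rule cINF_lower[OF bd u])
      moreover have "\<bar>u \<bullet> (HV x - HV y) u\<bar> \<le> norm (HV x - HV y)"
        using u Cauchy_Schwarz_ineq2[of u "(HV x - HV y) u"] norm_blinfun[of "HV x - HV y" u] by simp
      ultimately show "(INF u\<in>sphere 0 1. u \<bullet> HV x u) - norm (HV x - HV y) \<le> u \<bullet> HV y u"
        by (simp add: blinfun.diff_left inner_diff_right abs_le_iff)
    qed
    then show ?thesis by simp
  qed
  have cont: "continuous_on UNIV l"
  proof (intro continuous_at_imp_continuous_on ballI)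
    fix x
    have "isCont HV x" using HV by (simp add: continuous_on_eq_continuous_at)
    then have "((\<lambda>y. norm (HV y - HV x)) \<longlongrightarrow> 0) (at x)"
      by (simp add: isCont_def LIM_zero_iff tendsto_norm_zero_iff)
    moreover have "\<forall>\<^sub>F y in at x. norm (l y - l x) \<le> norm (HV y - HV x)"
    proof (rule always_eventually, rule allI)
      fix y show "norm (l y - l x) \<le> norm (HV y - HV x)"
        using le[of x y] le[of y x] by (simp add: norm_minus_commute abs_le_iff)
    qed
    ultimately have "((\<lambda>y. l y - l x) \<longlongrightarrow> 0) (at x)" by (rule Lim_null_comparison[rotated])
    then show "isCont l x" by (simp add: isCont_def LIM_zero_iff)
  qed
  have quad: "u \<bullet> HV x u \<ge> l x * (norm u)^2" for x u
  proof (cases "u = 0")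
    case False
    define v where "v = u /\<^sub>R norm u"
    have "v \<in> sphere 0 1" using False by (simp add: v_def)
    then have "l x \<le> v \<bullet> HV x v" unfolding l_def by (rule cINF_lower[OF bd])
    also have "\<dots> = (u \<bullet> HV x u) / (norm u)^2"
      by (simp add: v_def blinfun.scaleR_right power2_eq_square field_simps)
    finally show ?thesis using False by (simp add: pos_le_divide_eq)
  qed simp
  have great: "r \<le> l x" if "\<And>u. u \<bullet> HV x u \<ge> r * (norm u)^2" for x r
    unfolding l_def
  proof (rule cINF_greatest[OF ne])
    fix u :: 'a assume "u \<in> sphere 0 1"
    then show "r \<le> u \<bullet> HV x u" using that[of u] by simp
  qed
  show ?thesis using that[OF cont quad great] .
qed

section \<open>The Poincare constant of the Gibbs measure\<close>

text \<open>The first equation also covers a vanishing normalising integral, where both sides are 0;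
  a positive mean of some function then rules that case out.\<close>

lemma gibbs_integral:
  fixes V \<phi> :: "'a::euclidean_space \<Rightarrow> real"
  assumes V: "V \<in> borel_measurable borel" and \<phi>: "\<phi> \<in> borel_measurable borel"
  shows "(\<integral>x. \<phi> x \<partial>gibbs V) = (\<integral>y. exp (- V y) * \<phi> y \<partial>lborel) / (\<integral>y. exp (- V y) \<partial>lborel)"
    and "(\<integral>y. exp (- V y) \<partial>lborel) \<noteq> 0 \<Longrightarrow> integrable (gibbs V) \<phi> \<longleftrightarrow> integrable lborel (\<lambda>y. exp (- V y) * \<phi> y)"
proof -
  define Z where "Z = (\<integral>y. exp (- V y) \<partial>lborel)"
  have Z: "Z \<ge> 0" unfolding Z_def by (rule integral_nonneg_AE) simp
  have dens: "(\<lambda>x. exp (- V x) / Z) \<in> borel_measurable lborel" using V by simp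
  have "(\<integral>x. \<phi> x \<partial>gibbs V) = (\<integral>x. (exp (- V x) / Z) *\<^sub>R \<phi> x \<partial>lborel)"
    unfolding gibbs_def Z_def[symmetric] by (rule integral_density) (use \<phi> dens Z in auto)
  then show "(\<integral>x. \<phi> x \<partial>gibbs V) = (\<integral>y. exp (- V y) * \<phi> y \<partial>lborel) / (\<integral>y. exp (- V y) \<partial>lborel)"
    by (simp add: Z_def[symmetric])
  assume "(\<integral>y. exp (- V y) \<partial>lborel) \<noteq> 0"
  then have nz: "Z \<noteq> 0" by (simp add: Z_def)
  have "integrable (gibbs V) \<phi> \<longleftrightarrow> integrable lborel (\<lambda>x. (exp (- V x) / Z) *\<^sub>R \<phi> x)"
    unfolding gibbs_def Z_def[symmetric] by (rule integrable_density) (use \<phi> dens Z in auto)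
  also have "(\<lambda>x. (exp (- V x) / Z) *\<^sub>R \<phi> x) = (\<lambda>x. (1 / Z) * (exp (- V x) * \<phi> x))" by auto
  finally show "integrable (gibbs V) \<phi> \<longleftrightarrow> integrable lborel (\<lambda>y. exp (- V y) * \<phi> y)"
    unfolding integrable_mult_left_iff using nz by simp
qed

lemma (in convex_potential) poincare_const_gibbs_le:
  assumes int_V: "integrable lborel (\<lambda>y. exp (- V y))"
    and \<rho>_cont: "continuous_on UNIV \<rho>"
    and int_\<rho>: "integrable (gibbs V) \<rho>"
    and cov: "\<And>R \<delta>. R > 0 \<Longrightarrow> \<delta> > 0 \<Longrightarrow> \<forall>\<^sub>F N in sequentially. curved_grid.covariance_control (cube_grid R N) (R / N) V \<rho> \<epsilon> (\<kappa> + \<delta>)"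
    and \<epsilon>: "\<epsilon> \<ge> 0" and \<kappa>: "\<kappa> \<ge> 0" and mean_large: "(\<integral>x. \<rho> x \<partial>gibbs V) \<ge> \<rho>0 + \<epsilon> + \<kappa>"
  shows "poincare_const (gibbs V) \<le> 1 / (\<rho>0 + \<epsilon>)"
proof -
  define I where "I = (\<lambda>\<phi>. \<integral>y. exp (- V y) * \<phi> y \<partial>lborel)"
  define Z where "Z = (\<integral>y. exp (- V y) \<partial>lborel)"
  have V_meas: "V \<in> borel_measurable borel"
    by (rule borel_measurable_continuous_onI[OF V_cont])
  have \<rho>_meas: "\<rho> \<in> borel_measurable borel" by (rule borel_measurable_continuous_onI[OF \<rho>_cont])
  have Z0: "Z \<ge> 0" unfolding Z_def by (rule integral_nonneg_AE) simp
  \<comment> \<open>With \<open>Z = 0\<close> the Gibbs measure would be the null measure, and the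
    mean of \<open>\<rho>\<close> would be 0.\<close>
  have "Z \<noteq> 0"
  proof
    assume "Z = 0"
    then have "(\<integral>x. \<rho> x \<partial>gibbs V) = 0" using gibbs_integral(1)[OF V_meas \<rho>_meas] by (simp add: Z_def)
    then show False using mean_large \<rho>0_pos \<epsilon> \<kappa> by simp
  qed
  then have Z: "Z > 0" using Z0 by simp
  have gint: "(\<integral>x. \<phi> x \<partial>gibbs V) = I \<phi> / Z" and gintb: "integrable (gibbs V) \<phi> \<longleftrightarrow> integrable lborel (\<lambda>y. exp (- V y) * \<phi> y)"
    if "\<phi> \<in> borel_measurable borel" for \<phi>
    using gibbs_integral[OF V_meas that] Z by (simp_all add: I_def Z_def)
  have I1: "I (\<lambda>_. 1) = Z" by (simp add: I_def Z_def)
  have gibbs_1: "integrable (gibbs V) (\<lambda>_. 1 :: real)" using gintb[of "\<lambda>_. 1"] int_V by simp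
  interpret prob_space "gibbs V"
  proof
    have "emeasure (gibbs V) (space (gibbs V)) = (\<integral>\<^sup>+x. ennreal 1 \<partial>gibbs V)" by simp
    also have "\<dots> = ennreal (\<integral>x. 1 \<partial>gibbs V)" by (rule nn_integral_eq_integral[OF gibbs_1]) simp
    also have "(\<integral>x. 1 \<partial>gibbs V) = (1::real)" using gint[of "\<lambda>_. 1"] Z I1 by simp
    finally show "emeasure (gibbs V) (space (gibbs V)) = 1" by simp
  qed
  have "poincare_ok (gibbs V) (1 / (\<rho>0 + \<epsilon>))"
    unfolding poincare_ok_def
  proof (intro allI impI, elim conjE)
    fix f :: "'a \<Rightarrow> real"
    assume smooth: "smooth_fun f" and f2: "integrable (gibbs V) (\<lambda>x. (f x)^2)"
      and g2: "integrable (gibbs V) (\<lambda>x. (grad_norm f x)^2)"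
    obtain g where f: "\<And>x. (f has_derivative (\<lambda>u. g x \<bullet> u)) (at x)" and g: "continuous_on UNIV g"
      and gn: "\<And>x. grad_norm f x = norm (g x)" using smooth_fun_gradient[OF smooth] by blast
    have f_meas: "f \<in> borel_measurable borel"
      by (rule borel_measurable_continuous_onI[OF has_derivative_imp_continuous_on[OF f]])
    have g_meas: "(\<lambda>x. (norm (g x))^2) \<in> borel_measurable borel"
      using borel_measurable_continuous_onI[OF g] by simp
    have f2_meas: "(\<lambda>x. (f x)^2) \<in> borel_measurable borel" using f_meas by simp
    have sets: "sets (gibbs V) = sets borel" by (simp add: gibbs_def)
    have ng_meas: "(\<lambda>x. norm (g x)) \<in> borel_measurable borel"
      using borel_measurable_continuous_onI[OF g] by simp
    have f1: "integrable (gibbs V) f" and g1: "integrable (gibbs V) (\<lambda>x. norm (g x))"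
      using square_integrable_imp_integrable[OF _ f2] square_integrable_imp_integrable[of "\<lambda>x. norm (g x)"] g2
        f_meas ng_meas measurable_cong_sets[OF sets refl, of "borel :: real measure"] by (simp_all add: gn)
    have "(\<rho>0 + \<epsilon>) * (I (\<lambda>x. (f x)^2) - (I f)^2 / I (\<lambda>_. 1)) \<le> I (\<lambda>x. (norm (g x))^2)"
      unfolding I_def
    proof (rule poincare_gibbs[OF \<rho>_cont f g cov \<epsilon> \<kappa> int_V])
      show "integrable lborel (\<lambda>y. exp (- V y) * \<rho> y)" using int_\<rho> gintb[OF \<rho>_meas] by simp
      show "integrable lborel (\<lambda>y. exp (- V y) * (f y)^2)" using f2 gintb[OF f2_meas] by simp
      show "integrable lborel (\<lambda>y. exp (- V y) * f y)" using f1 gintb[OF f_meas] by simp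
      show "integrable lborel (\<lambda>y. exp (- V y) * norm (g y))" using g1 gintb[OF ng_meas] by simp
      show "integrable lborel (\<lambda>y. exp (- V y) * (norm (g y))^2)" using g2 gintb[OF g_meas] by (simp add: gn)
      show "0 < (\<integral>y. exp (- V y) * 1 \<partial>lborel)" using Z by (simp add: Z_def)
      show "\<rho>0 + \<epsilon> + \<kappa> \<le> (\<integral>y. exp (- V y) * \<rho> y \<partial>lborel) / (\<integral>y. exp (- V y) * 1 \<partial>lborel)"
        using mean_large gint[OF \<rho>_meas] by (simp add: I_def Z_def)
    qed
    then have "(\<rho>0 + \<epsilon>) * (I (\<lambda>x. (f x)^2) - (I f)^2 / Z) / Z \<le> I (\<lambda>x. (norm (g x))^2) / Z"
      unfolding I1 using Z by (intro divide_right_mono) auto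
    moreover have "I (\<lambda>x. (f x)^2) / Z - (I f / Z)^2 = (I (\<lambda>x. (f x)^2) - (I f)^2 / Z) / Z"
      by (simp add: diff_divide_distrib power2_eq_square)
    ultimately have main: "(\<rho>0 + \<epsilon>) * (I (\<lambda>x. (f x)^2) / Z - (I f / Z)^2) \<le> I (\<lambda>x. (norm (g x))^2) / Z"
      by simp
    have var: "var_meas (gibbs V) f = I (\<lambda>x. (f x)^2) / Z - (I f / Z)^2"
      using variance_eq[OF f1 f2] unfolding var_meas_def gint[OF f_meas] gint[OF f2_meas] .
    have "(\<rho>0 + \<epsilon>) * var_meas (gibbs V) f \<le> (\<integral>x. (grad_norm f x)^2 \<partial>gibbs V)"
      using main unfolding var gn gint[OF g_meas] .
    then show "var_meas (gibbs V) f \<le> 1 / (\<rho>0 + \<epsilon>) * (\<integral>x. (grad_norm f x)^2 \<partial>gibbs V)"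
      using \<rho>0_pos \<epsilon> by (simp add: pos_le_divide_eq mult.commute)
  qed
  then show ?thesis
    unfolding poincare_const_def using \<rho>0_pos \<epsilon> by (intro cInf_lower) (auto intro!: bdd_belowI[of _ 0])
qed

section \<open>Oscillation and Lipschitz bounds read off from their suprema, and the
  conclusion\<close>

lemma abs_diff_le_osc:
  assumes "osc u < \<infinity>" shows "\<bar>u x - u y\<bar> \<le> real_of_ereal (osc u)"
proof -
  have "ereal \<bar>u x - u y\<bar> \<le> osc u"
    unfolding osc_def by (rule SUP_upper2[of "(x, y)"]) auto
  then show ?thesis using assms by (cases "osc u") auto
qed

lemma lipschitz_lip_const:
  fixes u :: "'a::euclidean_space \<Rightarrow> real"
  assumes "\<exists>L. L-lipschitz_on UNIV u"
  shows "lipschitz_on (real_of_ereal (lip_const u)) UNIV u"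
proof -
  obtain L where L: "L-lipschitz_on UNIV u" using assms by blast
  have "lip_const u \<le> ereal L"
    unfolding lip_const_def
  proof (rule SUP_least)
    fix p :: "'a \<times> 'a" assume "p \<in> {p. fst p \<noteq> snd p}"
    then show "ereal (\<bar>u (fst p) - u (snd p)\<bar> / dist (fst p) (snd p)) \<le> ereal L"
      using lipschitz_onD[OF L, of "fst p" "snd p"] by (simp add: dist_real_def divide_le_eq)
  qed
  moreover have upper: "ereal (\<bar>u x - u y\<bar> / dist x y) \<le> lip_const u" if "x \<noteq> y" for x y
    unfolding lip_const_def using that by (intro SUP_upper2[of "(x, y)"]) auto
  \<comment> \<open>A basis vector and 0 are distinct, so the supremum is over a nonempty set and is
    nonnegative.\<close>
  obtain b :: 'a where b: "b \<in> Basis" using nonempty_Basis by blast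
  have "ereal 0 \<le> ereal (\<bar>u b - u 0\<bar> / dist b 0)" by simp
  then have "ereal 0 \<le> lip_const u" using upper[of b 0] b nonzero_Basis order_trans by blast
  ultimately obtain l where l: "lip_const u = ereal l" "l \<ge> 0" by (cases "lip_const u") auto
  show ?thesis unfolding l(1) real_of_ereal.simps
  proof (rule lipschitz_onI)
    fix x y show "dist (u x) (u y) \<le> l * dist x y"
      using upper[of x y] unfolding l(1) by (cases "x = y") (auto simp: dist_real_def divide_le_eq)
  qed (rule l(2))
qed

text \<open>For finite oscillation the argument is run with a continuous
  \<open>r \<ge> \<rho>\<close> in the same range, for Lipschitz \<open>\<rho>\<close> with
  \<open>\<rho>\<close> itself. By \<open>eps_prime_root\<close>, the mean of \<open>\<rho>\<close>
  exceeds \<open>\<rho>0 + \<epsilon>\<close> by exactly the permitted loss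
  \<open>sqrt (2 * K * \<epsilon>)\<close>.\<close>

theorem mainTheorem1:
  fixes V :: "'a::euclidean_space \<Rightarrow> real"
    and DV :: "'a \<Rightarrow> 'a"
    and HV :: "'a \<Rightarrow> 'a \<Rightarrow>\<^sub>L 'a"
    and \<rho> :: "'a \<Rightarrow> real"
    and \<rho>0 :: real
    and c :: "'a \<Rightarrow> 'a \<Rightarrow> real"
    and \<alpha> :: "real \<Rightarrow> real"
  assumes V_grad: "\<And>x. (V has_derivative (\<lambda>u. DV x \<bullet> u)) (at x)"
    and V_hess: "\<And>x. (DV has_derivative blinfun_apply (HV x)) (at x)"
    and V_hess_cont: "continuous_on UNIV HV"
    and V_int: "integrable lborel (\<lambda>x. exp (- V x))"
    and hess_bound: "\<And>x u. u \<bullet> blinfun_apply (HV x) u \<ge> \<rho> x * (norm u)\<^sup>2"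
    and rho0_pos: "\<rho>0 > 0"
    and rho_ge: "\<And>x. \<rho> x \<ge> \<rho>0"
    and mu_rho_pos: "(\<integral>x. \<rho> x \<partial>gibbs V) > 0"
    and regularity: "continuous_on UNIV \<rho> \<or>
        ((\<exists>H3 :: 'a \<Rightarrow> 'a \<Rightarrow>\<^sub>L ('a \<Rightarrow>\<^sub>L 'a).
            (\<forall>x. (HV has_derivative blinfun_apply (H3 x)) (at x)) \<and> continuous_on UNIV H3)
         \<and> (\<forall>x. \<exists>e>0. bounded (\<rho> ` ball x e)))"
    and cost: "cost_fun c"
    and c_norm_fin: "c_norm c \<rho> < \<infinity>"
    and alpha_cont: "continuous_on {0..} \<alpha>"
    and alpha_mono: "mono_on {0..} \<alpha>"
    and alpha_nonneg: "\<And>t. t \<ge> 0 \<Longrightarrow> \<alpha> t \<ge> 0"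
    and alpha_0: "\<alpha> 0 = 0"
    and WI_hyp: "WI (gibbs V) \<alpha> c"
  shows "(osc \<rho> < \<infinity> \<longrightarrow>
           poincare_const (gibbs V) \<le> 1 / (\<rho>0 + eps_prime ((\<integral>x. \<rho> x \<partial>gibbs V) - \<rho>0)
                                              ((real_of_ereal (osc \<rho>))\<^sup>2 / \<rho>0)))
       \<and> ((\<exists>L. lipschitz_on L UNIV \<rho>) \<longrightarrow>
           poincare_const (gibbs V) \<le> 1 / (\<rho>0 + eps_prime ((\<integral>x. \<rho> x \<partial>gibbs V) - \<rho>0)
                                              (4 / \<rho>0\<^sup>2 * (real_of_ereal (lip_const \<rho>))\<^sup>2)))"
proof -
  let ?M = "gibbs V"
  define \<mu>\<rho> where "\<mu>\<rho> = (\<integral>x. \<rho> x \<partial>?M)"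
  \<comment> \<open>The integral of a non-integrable function is 0 by convention, so a positive mean
    implies integrability.\<close>
  have int_\<rho>: "integrable ?M \<rho>" using mu_rho_pos not_integrable_integral_eq by fastforce
  have V_meas: "V \<in> borel_measurable borel"
    by (rule borel_measurable_continuous_onI[OF has_derivative_imp_continuous_on[OF V_grad]])
  define Z where "Z = (\<integral>y. exp (- V y) \<partial>lborel)"
  have sets: "sets ?M = sets borel" by (simp add: gibbs_def)
  have \<rho>_meas: "\<rho> \<in> borel_measurable borel"
    using borel_measurable_integrable[OF int_\<rho>] measurable_cong_sets[OF sets refl] by blast
  have Z: "Z \<noteq> 0" using mu_rho_pos gibbs_integral(1)[OF V_meas \<rho>_meas] by (auto simp: Z_def)
  have const: "integrable ?M (\<lambda>_. k)" "(\<integral>x. k \<partial>?M) = k" for k :: real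
    using gibbs_integral[OF V_meas, of "\<lambda>_. k"] V_int Z by (simp_all add: Z_def)
  have m: "\<mu>\<rho> - \<rho>0 \<ge> 0"
  proof -
    have "(\<integral>x. \<rho>0 \<partial>?M) \<le> \<mu>\<rho>"
      unfolding \<mu>\<rho>_def by (rule Bochner_Integration.integral_mono[OF const(1) int_\<rho>]) (rule rho_ge)
    then show ?thesis unfolding const(2) by simp
  qed
  have "poincare_const ?M \<le> 1 / (\<rho>0 + eps_prime (\<mu>\<rho> - \<rho>0) ((real_of_ereal (osc \<rho>))^2 / \<rho>0))"
    if osc: "osc \<rho> < \<infinity>"
  proof -
    define \<omega> where "\<omega> = real_of_ereal (osc \<rho>)"
    define \<epsilon> where "\<epsilon> = eps_prime (\<mu>\<rho> - \<rho>0) (\<omega>^2 / \<rho>0)"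
    have diff: "\<bar>\<rho> x - \<rho> y\<bar> \<le> \<omega>" for x y unfolding \<omega>_def by (rule abs_diff_le_osc[OF osc])
    have \<omega>: "\<omega> \<ge> 0" using diff[of 0 0] by simp
    have K: "\<omega>^2 / \<rho>0 \<ge> 0" using rho0_pos by simp
    have \<epsilon>: "\<epsilon> \<ge> 0" "\<epsilon> + \<omega> * sqrt (2 * \<epsilon> / \<rho>0) = \<mu>\<rho> - \<rho>0"
    proof -
      show "\<epsilon> \<ge> 0" using eps_prime_root(1)[OF m K] by (simp add: \<epsilon>_def)
      have "sqrt (2 * (\<omega>^2 / \<rho>0) * \<epsilon>) = sqrt (\<omega>^2 * (2 * \<epsilon> / \<rho>0))" by (simp add: mult_ac)
      also have "\<dots> = \<omega> * sqrt (2 * \<epsilon> / \<rho>0)" using \<omega> by (simp only: real_sqrt_mult real_sqrt_abs abs_of_nonneg)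
      finally show "\<epsilon> + \<omega> * sqrt (2 * \<epsilon> / \<rho>0) = \<mu>\<rho> - \<rho>0"
        using eps_prime_root(2)[OF m K] by (simp add: \<epsilon>_def)
    qed
    define a where "a = Inf (range \<rho>)"
    have bd: "bdd_below (range \<rho>)" by (rule bdd_belowI2) (rule rho_ge)
    have a_le: "a \<le> \<rho> x" for x unfolding a_def by (rule cInf_lower[OF _ bd]) simp
    have a_ge: "\<rho>0 \<le> a" unfolding a_def by (rule cInf_greatest) (use rho_ge in auto)
    have le_a: "\<rho> x \<le> a + \<omega>" for x
    proof -
      have "\<rho> x - \<omega> \<le> a"
        unfolding a_def
      proof (rule cInf_greatest)
        fix t assume "t \<in> range \<rho>"
        then obtain y where "t = \<rho> y" by blast
        then show "\<rho> x - \<omega> \<le> t" using diff[of x y] by (simp add: abs_le_iff)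
      qed simp
      then show ?thesis by simp
    qed
    \<comment> \<open>\<open>\<rho>\<close> itself may be discontinuous; the smallest eigenvalue of the Hessian, truncated at \<open>sup \<rho>\<close>, is a continuous substitute.\<close>
    obtain l where l: "continuous_on UNIV l" "\<And>x u. u \<bullet> HV x u \<ge> l x * (norm u)^2"
      "\<And>x r. (\<And>u. u \<bullet> HV x u \<ge> r * (norm u)^2) \<Longrightarrow> r \<le> l x"
      using smallest_eigenvalue[OF V_hess_cont] by blast
    define r where "r = (\<lambda>x. min (l x) (a + \<omega>))"
    have r_cont: "continuous_on UNIV r" unfolding r_def by (intro continuous_intros l(1))
    have \<rho>_r: "\<rho> x \<le> r x" for x using l(3)[OF hess_bound] le_a by (simp add: r_def)
    have r_bounds: "a \<le> r x" "r x \<le> a + \<omega>" for x using \<rho>_r[of x] a_le[of x] by (auto simp: r_def)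
    have r_hess: "u \<bullet> HV x u \<ge> r x * (norm u)^2" for x u
    proof -
      have "r x * (norm u)^2 \<le> l x * (norm u)^2" by (intro mult_right_mono) (auto simp: r_def)
      then show ?thesis using l(2)[where x = x and u = u] by linarith
    qed
    have r_meas: "r \<in> borel_measurable ?M"
      using borel_measurable_continuous_onI[OF r_cont] measurable_cong_sets[OF sets refl] by blast
    have r_int: "integrable ?M r"
    proof (rule Bochner_Integration.integrable_bound[OF const(1)[of "a + \<omega>"] r_meas])
      have "norm (r x) \<le> norm (a + \<omega>)" for x
        using r_bounds[of x] a_ge rho0_pos by simp
      then show "AE x in ?M. norm (r x) \<le> norm (a + \<omega>)" by simp
    qed
    have r_ge: "\<rho>0 \<le> r x" for x using r_bounds(1)[of x] a_ge by simp
    interpret convex_potential V DV HV r \<rho>0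
      by unfold_locales (fact V_grad V_hess V_hess_cont r_hess r_ge rho0_pos)+
    have "poincare_const ?M \<le> 1 / (\<rho>0 + \<epsilon>)"
    proof (rule poincare_const_gibbs_le[OF V_int r_cont r_int _ \<epsilon>(1)])
      show "\<forall>\<^sub>F N in sequentially. curved_grid.covariance_control (cube_grid R N) (R / N) V r \<epsilon> (\<omega> * sqrt (2 * \<epsilon> / \<rho>0) + \<delta>)" if "R > 0" "\<delta> > 0" for R \<delta>
        by (rule covariance_control_osc[OF r_bounds \<epsilon>(1) that])
      show "0 \<le> \<omega> * sqrt (2 * \<epsilon> / \<rho>0)" using \<omega> \<epsilon>(1) rho0_pos by simp
      \<comment> \<open>Passing to \<open>r\<close> can only raise the mean, so the
        \<open>\<epsilon>\<close> computed from \<open>\<rho>\<close> remains admissible.\<close>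
      have "\<mu>\<rho> \<le> (\<integral>x. r x \<partial>?M)"
        unfolding \<mu>\<rho>_def by (rule Bochner_Integration.integral_mono[OF int_\<rho> r_int]) (rule \<rho>_r)
      then show "\<rho>0 + \<epsilon> + \<omega> * sqrt (2 * \<epsilon> / \<rho>0) \<le> (\<integral>x. r x \<partial>?M)" using \<epsilon>(2) by linarith
    qed
    then show ?thesis by (simp add: \<epsilon>_def \<omega>_def)
  qed
  moreover have "poincare_const ?M \<le> 1 / (\<rho>0 + eps_prime (\<mu>\<rho> - \<rho>0) (4 / \<rho>0^2 * (real_of_ereal (lip_const \<rho>))^2))"
    if lip: "\<exists>L. lipschitz_on L UNIV \<rho>"
  proof -
    define L where "L = real_of_ereal (lip_const \<rho>)"
    have lipL: "L-lipschitz_on UNIV \<rho>" unfolding L_def by (rule lipschitz_lip_const[OF lip])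
    have L: "L \<ge> 0" using lipL by (rule lipschitz_on_nonneg)
    define K where "K = 4 / \<rho>0^2 * L^2"
    define \<epsilon> where "\<epsilon> = eps_prime (\<mu>\<rho> - \<rho>0) K"
    have K: "K \<ge> 0" by (simp add: K_def)
    have \<epsilon>: "\<epsilon> \<ge> 0" "\<epsilon> + sqrt (2 * K * \<epsilon>) = \<mu>\<rho> - \<rho>0"
      using eps_prime_root[OF m K] by (simp_all add: \<epsilon>_def)
    \<comment> \<open>The left side is \<open>sqrt (K * \<epsilon>)\<close>, which is where the
      constant 4 in \<open>K\<close> comes from; the factor 2 is left over as slack.\<close>
    have \<kappa>: "2 * L / \<rho>0 * sqrt \<epsilon> \<le> sqrt (2 * K * \<epsilon>)"
    proof (rule real_le_rsqrt)
      have "(2 * L / \<rho>0 * sqrt \<epsilon>)^2 = K * \<epsilon>"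
        using \<epsilon>(1) by (simp add: K_def power_mult_distrib power_divide)
      also have "\<dots> \<le> 2 * K * \<epsilon>" using K \<epsilon>(1) by simp
      finally show "(2 * L / \<rho>0 * sqrt \<epsilon>)^2 \<le> 2 * K * \<epsilon>" .
    qed
    interpret convex_potential V DV HV \<rho> \<rho>0
      by unfold_locales (fact V_grad V_hess V_hess_cont hess_bound rho_ge rho0_pos)+
    have "poincare_const ?M \<le> 1 / (\<rho>0 + \<epsilon>)"
    proof (rule poincare_const_gibbs_le[OF V_int _ int_\<rho> _ \<epsilon>(1)])
      show "continuous_on UNIV \<rho>" by (rule lipschitz_on_continuous_on[OF lipL])
      show "\<forall>\<^sub>F N in sequentially. curved_grid.covariance_control (cube_grid R N) (R / N) V \<rho> \<epsilon> (2 * L / \<rho>0 * sqrt \<epsilon> + \<delta>)" if "R > 0" "\<delta> > 0" for R \<delta>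
        by (rule covariance_control_lip[OF lipL \<epsilon>(1) that])
      show "0 \<le> 2 * L / \<rho>0 * sqrt \<epsilon>" using L rho0_pos \<epsilon>(1) by simp
      show "\<rho>0 + \<epsilon> + 2 * L / \<rho>0 * sqrt \<epsilon> \<le> (\<integral>x. \<rho> x \<partial>?M)"
        using \<kappa> \<epsilon>(2) by (simp add: \<mu>\<rho>_def)
    qed
    then show ?thesis by (simp add: \<epsilon>_def K_def L_def)
  qed
  ultimately show ?thesis by (simp add: \<mu>\<rho>_def)
qed

end
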